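(* Let $\Sigma$ be a well-formed LF signature and $\Gamma$ a context such that $\vdash\Gamma\ \mathrm{ctx}$ is derivable. Then $\Gamma\vdash P\Rightarrow K'$ has a derivation if and only if there is an $a{:}\Pi y_1{:}A_1.\ldots\Pi y_n{:}A_n.K\in\Sigma$ such that (1) $P$ is of the form $a\,M_1\ldots M_n$; (2) there is a sequence of types $A_1',\ldots,A_n'$ such that for $1\le i\le n$ there are derivations of $[\{\langle y_1,M_1,A_1^-\rangle,\ldots,\langle y_{i-1},M_{i-1},A_{i-1}^-\rangle\}]A_i=A_i'$ and of $\Gamma\vdash M_i\Leftarrow A_i'$; and (3) $[\{\langle y_1,M_1,A_1^-\rangle,\ldots,\langle y_n,M_n,A_n^-\rangle\}]K=K'$ and $\Gamma\vdash K'\ \mathrm{kind}$ have derivations.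
   Context: Canonical LF syntax: kinds $K::=\mathrm{Type}\mid\Pi x{:}A.K$; types $A::=P\mid\Pi x{:}A.B$; atomic types $P::=a\mid P\,M$; canonical terms $M::=R\mid\lambda x.M$; atomic terms $R::=c\mid x\mid R\,M$; signatures $\Sigma::=\cdot\mid\Sigma,c{:}A\mid\Sigma,a{:}K$; contexts $\Gamma::=\cdot\mid\Gamma,x{:}A$. Arity types from $o$ and $\rightarrow$; erasure $P^-=o$, $(\Pi x{:}A_1.A_2)^-=A_1^-\rightarrow A_2^-$. A substitution is a finite set of triples $\langle x,M,\alpha\rangle$ (distinct variables, canonical terms, arity types). Hereditary substitution $[\theta]E=E'$ is the least relation closed under: $[\theta]R=R'$ if $[\theta]_rR=R'$; $[\theta]R=M'$ if $[\theta]_rR=M':\alpha'$; $[\theta](\lambda x.M)=\lambda x.M'$ if $x$ is not in $\mathrm{dom}(\theta)$ nor free in its range terms and $[\theta]M=M'$; $[\theta]_rx=M:\alpha$ if $\langle x,M,\alpha\rangle\in\theta$; $[\theta]_r(R\,M)=M''':\alpha''$ if $[\theta]_rR=\lambda x.M':\alpha'\rightarrow\alpha''$, $[\theta]M=M''$, $[\{\langle x,M'',\alpha'\rangle\}]M'=M'''$; $[\theta]_rc=c$; $[\theta]_rx=x$ if $x\notin\mathrm{dom}(\theta)$; $[\theta]_r(R\,M)=R'\,M'$ if $[\theta]_rR=R'$ and $[\theta]M=M'$; for types and kinds, substitution distributes to components ($[\theta]a=a$, $[\theta]\mathrm{Type}=\mathrm{Type}$, binders fresh for $\theta$). LF judgements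 (fixed $\Sigma$; bound variables fresh for $\Gamma$): $\vdash\cdot\ \mathrm{ctx}$; $\vdash\Gamma,x{:}A\ \mathrm{ctx}$ if $\vdash\Gamma\ \mathrm{ctx}$, $\Gamma\vdash A\ \mathrm{type}$, $x$ not in $\Gamma$; $\Gamma\vdash\mathrm{Type}\ \mathrm{kind}$; $\Gamma\vdash\Pi x{:}A.K\ \mathrm{kind}$ if $\Gamma\vdash A\ \mathrm{type}$ and $\Gamma,x{:}A\vdash K\ \mathrm{kind}$; $\Gamma\vdash P\ \mathrm{type}$ if $\Gamma\vdash P\Rightarrow\mathrm{Type}$; $\Gamma\vdash\Pi x{:}A_1.A_2\ \mathrm{type}$ if $\Gamma\vdash A_1\ \mathrm{type}$ and $\Gamma,x{:}A_1\vdash A_2\ \mathrm{type}$; $\Gamma\vdash a\Rightarrow K$ if $a{:}K\in\Sigma$; $\Gamma\vdash P\,M\Rightarrow K$ if $\Gamma\vdash P\Rightarrow\Pi x{:}A.K_1$, $\Gamma\vdash M\Leftarrow A$ and $[\{\langle x,M,A^-\rangle\}]K_1=K$; $\Gamma\vdash R\Leftarrow P$ if $\Gamma\vdash R\Rightarrow P$; $\Gamma\vdash\lambda x.M\Leftarrow\Pi x{:}A_1.A_2$ if $\Gamma,x{:}A_1\vdash M\Leftarrow A_2$; $\Gamma\vdash x\Rightarrow A$ if $x{:}A\in\Gamma$; $\Gamma\vdash c\Rightarrow A$ if $c{:}A\in\Sigma$; $\Gamma\vdash R\,M\Rightarrow A$ if $\Gamma\vdash R\Rightarrow\Pi x{:}A_1.A_2$,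 $\Gamma\vdash M\Leftarrow A_1$ and $[\{\langle x,M,A_1^-\rangle\}]A_2=A$. $\Sigma$ is well-formed if its constants are distinct and each declaration is well-formed in the empty context relative to the preceding declarations. *)

theory Defs
  imports Main "HOL-Library.Finite_Map"
begin

(* Expressions are taken modulo alpha-equivalence by a locally nameless encoding: free variables
   are named (FVar), bound ones are de Bruijn indices (BVar).  The named binders "lambda x. M" and
   "Pi x:A. E" are the operations lam, tpi, kpi below, and every rule is stated with them,
   so x ranges over all admissible names of the bound variable. *)

type_synonym var = nat
type_synonym obj_const = string
type_synonym typ_const = string

datatype canon = Atm atom | Lam canon
  and atom = Const obj_const | FVar var | BVar nat | App atom canon

datatype atyp = TConst typ_const | TApp atyp canon

datatype tp = At atyp | Pi tp tp

datatype kind = KType | KPi tp kind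

datatype arity = Base | Arr arity arity

fun erase :: "tp \<Rightarrow> arity" where
  "erase (At P) = Base"
| "erase (Pi A B) = Arr (erase A) (erase B)"

primrec fv_canon :: "canon \<Rightarrow> var set" and fv_atom :: "atom \<Rightarrow> var set" where
  "fv_canon (Atm R) = fv_atom R"
| "fv_canon (Lam M) = fv_canon M"
| "fv_atom (Const c) = {}"
| "fv_atom (FVar x) = {x}"
| "fv_atom (BVar i) = {}"
| "fv_atom (App R M) = fv_atom R \<union> fv_canon M"

(* Binding x at depth k.  Indices from k upwards are shifted, so an index that points outside the
   expression is never captured: it behaves as one more free variable, about which no rule
   below says anything. *)

primrec close_canon :: "nat \<Rightarrow> var \<Rightarrow> canon \<Rightarrow> canon" and close_atom :: "nat \<Rightarrow> var \<Rightarrow> atom \<Rightarrow> atom" where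
  "close_canon k x (Atm R) = Atm (close_atom k x R)"
| "close_canon k x (Lam M) = Lam (close_canon (Suc k) x M)"
| "close_atom k x (Const c) = Const c"
| "close_atom k x (FVar y) = (if y = x then BVar k else FVar y)"
| "close_atom k x (BVar i) = (if i < k then BVar i else BVar (Suc i))"
| "close_atom k x (App R M) = App (close_atom k x R) (close_canon k x M)"

primrec close_atyp :: "nat \<Rightarrow> var \<Rightarrow> atyp \<Rightarrow> atyp" where
  "close_atyp k x (TConst a) = TConst a"
| "close_atyp k x (TApp P M) = TApp (close_atyp k x P) (close_canon k x M)"

primrec close_tp :: "nat \<Rightarrow> var \<Rightarrow> tp \<Rightarrow> tp" where
  "close_tp k x (At P) = At (close_atyp k x P)"
| "close_tp k x (Pi A B) = Pi (close_tp k x A) (close_tp (Suc k) x B)"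

primrec close_kind :: "nat \<Rightarrow> var \<Rightarrow> kind \<Rightarrow> kind" where
  "close_kind k x KType = KType"
| "close_kind k x (KPi A K) = KPi (close_tp k x A) (close_kind (Suc k) x K)"

definition lam :: "var \<Rightarrow> canon \<Rightarrow> canon" where
  "lam x M = Lam (close_canon 0 x M)"

definition tpi :: "var \<Rightarrow> tp \<Rightarrow> tp \<Rightarrow> tp" where
  "tpi x A B = Pi A (close_tp 0 x B)"

definition kpi :: "var \<Rightarrow> tp \<Rightarrow> kind \<Rightarrow> kind" where
  "kpi x A K = KPi A (close_kind 0 x K)"

(* A finite set of triples with distinct variables, i.e. a finite map. *)
type_synonym subst = "(var, canon \<times> arity) fmap"

definition single :: "var \<Rightarrow> canon \<Rightarrow> arity \<Rightarrow> subst" where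
  "single x M \<alpha> = fmupd x (M, \<alpha>) fmempty"

definition fv_range :: "subst \<Rightarrow> var set" where
  "fv_range \<theta> = (\<Union>(M, \<alpha>) \<in> fmran' \<theta>. fv_canon M)"

definition fresh_subst :: "var \<Rightarrow> subst \<Rightarrow> bool" where
  "fresh_subst x \<theta> \<longleftrightarrow> x \<notin> fmdom' \<theta> \<and> x \<notin> fv_range \<theta>"

(* hs \<theta> M M' is [\<theta>]M = M' on canonical terms; hs_at \<theta> R R' and hs_tm \<theta> R M' \<alpha> are the two forms
   [\<theta>]_r R = R' and [\<theta>]_r R = M' : \<alpha> on atomic terms. *)

inductive hs :: "subst \<Rightarrow> canon \<Rightarrow> canon \<Rightarrow> bool"
  and hs_at :: "subst \<Rightarrow> atom \<Rightarrow> atom \<Rightarrow> bool"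
  and hs_tm :: "subst \<Rightarrow> atom \<Rightarrow> canon \<Rightarrow> arity \<Rightarrow> bool"
where
  hs_Atm: "hs_at \<theta> R R' \<Longrightarrow> hs \<theta> (Atm R) (Atm R')"
| hs_Red: "hs_tm \<theta> R M' \<alpha>' \<Longrightarrow> hs \<theta> (Atm R) M'"
| hs_Lam: "fresh_subst x \<theta> \<Longrightarrow> hs \<theta> M M' \<Longrightarrow> hs \<theta> (lam x M) (lam x M')"
| hs_tm_Var: "fmlookup \<theta> x = Some (M, \<alpha>) \<Longrightarrow> hs_tm \<theta> (FVar x) M \<alpha>"
| hs_tm_App: "hs_tm \<theta> R (lam x M') (Arr \<alpha>' \<alpha>'') \<Longrightarrow> hs \<theta> M M'' \<Longrightarrow>
    hs (single x M'' \<alpha>') M' M''' \<Longrightarrow> hs_tm \<theta> (App R M) M''' \<alpha>''"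
| hs_at_Const: "hs_at \<theta> (Const c) (Const c)"
| hs_at_Var: "x \<notin> fmdom' \<theta> \<Longrightarrow> hs_at \<theta> (FVar x) (FVar x)"
| hs_at_App: "hs_at \<theta> R R' \<Longrightarrow> hs \<theta> M M' \<Longrightarrow> hs_at \<theta> (App R M) (App R' M')"

inductive hs_atyp :: "subst \<Rightarrow> atyp \<Rightarrow> atyp \<Rightarrow> bool" where
  hs_TConst: "hs_atyp \<theta> (TConst a) (TConst a)"
| hs_TApp: "hs_atyp \<theta> P P' \<Longrightarrow> hs \<theta> M M' \<Longrightarrow> hs_atyp \<theta> (TApp P M) (TApp P' M')"

inductive hs_tp :: "subst \<Rightarrow> tp \<Rightarrow> tp \<Rightarrow> bool" where
  hs_At: "hs_atyp \<theta> P P' \<Longrightarrow> hs_tp \<theta> (At P) (At P')"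
| hs_Pi: "fresh_subst x \<theta> \<Longrightarrow> hs_tp \<theta> A A' \<Longrightarrow> hs_tp \<theta> B B' \<Longrightarrow> hs_tp \<theta> (tpi x A B) (tpi x A' B')"

inductive hs_kind :: "subst \<Rightarrow> kind \<Rightarrow> kind \<Rightarrow> bool" where
  hs_KType: "hs_kind \<theta> KType KType"
| hs_KPi: "fresh_subst x \<theta> \<Longrightarrow> hs_tp \<theta> A A' \<Longrightarrow> hs_kind \<theta> K K' \<Longrightarrow> hs_kind \<theta> (kpi x A K) (kpi x A' K')"

datatype decl = ObjDecl obj_const tp | TypDecl typ_const kind

(* Signatures and contexts are lists with the most recent entry first, so "\<Gamma>, x:A" is (x, A) # \<Gamma>. *)
type_synonym sign = "decl list"
type_synonym ctx = "(var \<times> tp) list"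

abbreviation fresh_ctx :: "var \<Rightarrow> ctx \<Rightarrow> bool" where
  "fresh_ctx x \<Gamma> \<equiv> x \<notin> fst ` set \<Gamma>"

(* atyp_syn: \<Gamma> |- P => K;  check: \<Gamma> |- M <= A;  synth: \<Gamma> |- R => A *)

inductive atyp_syn :: "sign \<Rightarrow> ctx \<Rightarrow> atyp \<Rightarrow> kind \<Rightarrow> bool"
  and check :: "sign \<Rightarrow> ctx \<Rightarrow> canon \<Rightarrow> tp \<Rightarrow> bool"
  and synth :: "sign \<Rightarrow> ctx \<Rightarrow> atom \<Rightarrow> tp \<Rightarrow> bool"
  for \<Sigma> :: sign
where
  atyp_syn_Const: "TypDecl a K \<in> set \<Sigma> \<Longrightarrow> atyp_syn \<Sigma> \<Gamma> (TConst a) K"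
| atyp_syn_App: "atyp_syn \<Sigma> \<Gamma> P (kpi x A K\<^sub>1) \<Longrightarrow> check \<Sigma> \<Gamma> M A \<Longrightarrow>
    hs_kind (single x M (erase A)) K\<^sub>1 K \<Longrightarrow> atyp_syn \<Sigma> \<Gamma> (TApp P M) K"
| check_Atm: "synth \<Sigma> \<Gamma> R (At P) \<Longrightarrow> check \<Sigma> \<Gamma> (Atm R) (At P)"
| check_Lam: "fresh_ctx x \<Gamma> \<Longrightarrow> check \<Sigma> ((x, A\<^sub>1) # \<Gamma>) M A\<^sub>2 \<Longrightarrow>
    check \<Sigma> \<Gamma> (lam x M) (tpi x A\<^sub>1 A\<^sub>2)"
| synth_Var: "(x, A) \<in> set \<Gamma> \<Longrightarrow> synth \<Sigma> \<Gamma> (FVar x) A"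
| synth_Const: "ObjDecl c A \<in> set \<Sigma> \<Longrightarrow> synth \<Sigma> \<Gamma> (Const c) A"
| synth_App: "synth \<Sigma> \<Gamma> R (tpi x A\<^sub>1 A\<^sub>2) \<Longrightarrow> check \<Sigma> \<Gamma> M A\<^sub>1 \<Longrightarrow>
    hs_tp (single x M (erase A\<^sub>1)) A\<^sub>2 A \<Longrightarrow> synth \<Sigma> \<Gamma> (App R M) A"

inductive tp_wf :: "sign \<Rightarrow> ctx \<Rightarrow> tp \<Rightarrow> bool" for \<Sigma> :: sign where
  tp_wf_At: "atyp_syn \<Sigma> \<Gamma> P KType \<Longrightarrow> tp_wf \<Sigma> \<Gamma> (At P)"
| tp_wf_Pi: "tp_wf \<Sigma> \<Gamma> A\<^sub>1 \<Longrightarrow> fresh_ctx x \<Gamma> \<Longrightarrow> tp_wf \<Sigma> ((x, A\<^sub>1) # \<Gamma>) A\<^sub>2 \<Longrightarrow>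
    tp_wf \<Sigma> \<Gamma> (tpi x A\<^sub>1 A\<^sub>2)"

inductive kind_wf :: "sign \<Rightarrow> ctx \<Rightarrow> kind \<Rightarrow> bool" for \<Sigma> :: sign where
  kind_wf_Type: "kind_wf \<Sigma> \<Gamma> KType"
| kind_wf_Pi: "tp_wf \<Sigma> \<Gamma> A \<Longrightarrow> fresh_ctx x \<Gamma> \<Longrightarrow> kind_wf \<Sigma> ((x, A) # \<Gamma>) K \<Longrightarrow>
    kind_wf \<Sigma> \<Gamma> (kpi x A K)"

inductive ctx_wf :: "sign \<Rightarrow> ctx \<Rightarrow> bool" for \<Sigma> :: sign where
  ctx_wf_Nil: "ctx_wf \<Sigma> []"
| ctx_wf_Cons: "ctx_wf \<Sigma> \<Gamma> \<Longrightarrow> tp_wf \<Sigma> \<Gamma> A \<Longrightarrow> fresh_ctx x \<Gamma> \<Longrightarrow> ctx_wf \<Sigma> ((x, A) # \<Gamma>)"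

(* Object-level and type-level constants are separate syntactic categories, so distinctness is
   only needed within each of them. *)
inductive sig_wf :: "sign \<Rightarrow> bool" where
  sig_wf_Nil: "sig_wf []"
| sig_wf_Obj: "sig_wf \<Sigma> \<Longrightarrow> \<forall>B. ObjDecl c B \<notin> set \<Sigma> \<Longrightarrow> tp_wf \<Sigma> [] A \<Longrightarrow> sig_wf (ObjDecl c A # \<Sigma>)"
| sig_wf_Typ: "sig_wf \<Sigma> \<Longrightarrow> \<forall>L. TypDecl a L \<notin> set \<Sigma> \<Longrightarrow> kind_wf \<Sigma> [] K \<Longrightarrow> sig_wf (TypDecl a K # \<Sigma>)"

(* Pi y_1:A_1. ... Pi y_n:A_n. K, for the lists of the y_i and the A_i *)
definition kpis :: "var list \<Rightarrow> tp list \<Rightarrow> kind \<Rightarrow> kind" where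
  "kpis ys As K = foldr (\<lambda>(y, A). kpi y A) (zip ys As) K"

(* a M_1 ... M_n *)
definition tapps :: "atyp \<Rightarrow> canon list \<Rightarrow> atyp" where
  "tapps P Ms = foldl TApp P Ms"

(* The substitution of the first i triples (y_j, M_j, erase A_j); meant for distinct ys. *)
definition psubst :: "nat \<Rightarrow> var list \<Rightarrow> canon list \<Rightarrow> tp list \<Rightarrow> subst" where
  "psubst i ys Ms As = fmap_of_list (take i (zip ys (zip Ms (map erase As))))"

end

theory Submission
  imports Defs
begin

text \<open>Both directions follow the spine \<open>a M\<^sub>1 \<dots> M\<^sub>n\<close> one argument at a time. An application substitutes \<open>M\<^sub>i\<close> for
  \<open>y\<^sub>i\<close> in a kind that already is the result of substituting \<open>M\<^sub>1, \<dots>, M\<^sub>i\<^sub>-\<^sub>1\<close>, and this has to agree with the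
  simultaneous substitution of \<open>M\<^sub>1, \<dots>, M\<^sub>i\<close>. The agreement is an instance of a composition theorem for
  hereditary substitution, proved for expressions that respect simple arities (where hereditary
  substitution is total) by induction on the sum of the arity bounds of the two substitutions.
  Well-formedness of \<open>K'\<close> needs the substitution theorem for the LF judgements; it is proved for
  simultaneous substitutions, which also covers weakening.\<close>

section \<open>Opening and renaming\<close>

text \<open>The obstacle is that \<open>hs\<close> is a partial relation: a reduction may get stuck,
  and a dangling index has no rule. Two orders of substitution can only be compared if the results
  along both routes exist, so totality has to precede composition, and totality needs a terminating
  measure, which the simple arities provide. Arities in place of LF types also break a circle: at
  each application the substitution theorem needs the given substitution to commute with the one in
  the result type, before anything is known about substitution in typing derivations. Hence
  \<open>ar_sig\<close> and \<open>ar_ctx\<close> record the arity content of well-formed signatures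
  and contexts and replace well-formedness in most lemmas. The other obstacle is names. Each rule
  picks a name for its bound variable, and the \<open>ys\<close> of the statement are arbitrary
  distinct names, which may clash with \<Gamma> or with the arguments. The computations use fresh
  names and are carried back by renaming.\<close>

primrec open_canon :: "nat \<Rightarrow> var \<Rightarrow> canon \<Rightarrow> canon" and open_atom :: "nat \<Rightarrow> var \<Rightarrow> atom \<Rightarrow> atom" where
  "open_canon k x (Atm R) = Atm (open_atom k x R)"
| "open_canon k x (Lam M) = Lam (open_canon (Suc k) x M)"
| "open_atom k x (Const c) = Const c"
| "open_atom k x (FVar y) = FVar y"
| "open_atom k x (BVar i) = (if i < k then BVar i else if i = k then FVar x else BVar (i - 1))"
| "open_atom k x (App R M) = App (open_atom k x R) (open_canon k x M)"

primrec open_atyp :: "nat \<Rightarrow> var \<Rightarrow> atyp \<Rightarrow> atyp" where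
  "open_atyp k x (TConst a) = TConst a"
| "open_atyp k x (TApp P M) = TApp (open_atyp k x P) (open_canon k x M)"

primrec open_tp :: "nat \<Rightarrow> var \<Rightarrow> tp \<Rightarrow> tp" where
  "open_tp k x (At P) = At (open_atyp k x P)"
| "open_tp k x (Pi A B) = Pi (open_tp k x A) (open_tp (Suc k) x B)"

primrec open_kind :: "nat \<Rightarrow> var \<Rightarrow> kind \<Rightarrow> kind" where
  "open_kind k x KType = KType"
| "open_kind k x (KPi A K) = KPi (open_tp k x A) (open_kind (Suc k) x K)"

primrec ren_canon :: "(var \<Rightarrow> var) \<Rightarrow> canon \<Rightarrow> canon" and ren_atom :: "(var \<Rightarrow> var) \<Rightarrow> atom \<Rightarrow> atom" where
  "ren_canon f (Atm R) = Atm (ren_atom f R)"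
| "ren_canon f (Lam M) = Lam (ren_canon f M)"
| "ren_atom f (Const c) = Const c"
| "ren_atom f (FVar y) = FVar (f y)"
| "ren_atom f (BVar i) = BVar i"
| "ren_atom f (App R M) = App (ren_atom f R) (ren_canon f M)"

primrec ren_atyp :: "(var \<Rightarrow> var) \<Rightarrow> atyp \<Rightarrow> atyp" where
  "ren_atyp f (TConst a) = TConst a"
| "ren_atyp f (TApp P M) = TApp (ren_atyp f P) (ren_canon f M)"

primrec ren_tp :: "(var \<Rightarrow> var) \<Rightarrow> tp \<Rightarrow> tp" where
  "ren_tp f (At P) = At (ren_atyp f P)"
| "ren_tp f (Pi A B) = Pi (ren_tp f A) (ren_tp f B)"

primrec ren_kind :: "(var \<Rightarrow> var) \<Rightarrow> kind \<Rightarrow> kind" where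
  "ren_kind f KType = KType"
| "ren_kind f (KPi A K) = KPi (ren_tp f A) (ren_kind f K)"

primrec fv_atyp :: "atyp \<Rightarrow> var set" where
  "fv_atyp (TConst a) = {}"
| "fv_atyp (TApp P M) = fv_atyp P \<union> fv_canon M"

primrec fv_tp :: "tp \<Rightarrow> var set" where
  "fv_tp (At P) = fv_atyp P"
| "fv_tp (Pi A B) = fv_tp A \<union> fv_tp B"

text \<open>Hereditary substitution acts on a kind as on the type obtained by replacing its target
  \<^const>\<open>KType\<close> with an arbitrary constant, so all its properties for kinds come from types.\<close>

primrec kind_tp :: "kind \<Rightarrow> tp" where
  "kind_tp KType = At (TConst [])"
| "kind_tp (KPi A K) = Pi A (kind_tp K)"

abbreviation fv_kind :: "kind \<Rightarrow> var set" where
  "fv_kind K \<equiv> fv_tp (kind_tp K)"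

lemma kind_tp_inject [simp]: "kind_tp K = kind_tp K' \<longleftrightarrow> K = K'"
proof (induction K arbitrary: K')
  case KType then show ?case by (cases K') auto
next
  case (KPi A K) then show ?case by (cases K') auto
qed

lemma kind_tp_close [simp]: "kind_tp (close_kind k x K) = close_tp k x (kind_tp K)"
  by (induction K arbitrary: k) auto

lemma kind_tp_open [simp]: "kind_tp (open_kind k x K) = open_tp k x (kind_tp K)"
  by (induction K arbitrary: k) auto

lemma kind_tp_ren [simp]: "kind_tp (ren_kind f K) = ren_tp f (kind_tp K)"
  by (induction K) auto

section \<open>Free variables and renaming; opening and closing as inverses\<close>

lemma finite_fv_canon [simp]: "finite (fv_canon M)" and finite_fv_atom [simp]: "finite (fv_atom R)"
  by (induction M and R) auto

lemma finite_fv_atyp [simp]: "finite (fv_atyp P)"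
  by (induction P) auto

lemma finite_fv_tp [simp]: "finite (fv_tp A)"
  by (induction A) auto

lemma ren_canon_cong: "(\<And>z. z \<in> fv_canon M \<Longrightarrow> f z = g z) \<Longrightarrow> ren_canon f M = ren_canon g M"
  and ren_atom_cong: "(\<And>z. z \<in> fv_atom R \<Longrightarrow> f z = g z) \<Longrightarrow> ren_atom f R = ren_atom g R"
  by (induction M and R) auto

lemma ren_atyp_cong: "(\<And>z. z \<in> fv_atyp P \<Longrightarrow> f z = g z) \<Longrightarrow> ren_atyp f P = ren_atyp g P"
  by (induction P) (auto intro: ren_canon_cong)

lemma ren_tp_cong: "(\<And>z. z \<in> fv_tp A \<Longrightarrow> f z = g z) \<Longrightarrow> ren_tp f A = ren_tp g A"
  by (induction A) (auto intro: ren_atyp_cong)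

lemma ren_canon_ident [simp]: "ren_canon (\<lambda>z. z) M = M" and ren_atom_ident [simp]: "ren_atom (\<lambda>z. z) R = R"
  by (induction M and R) auto

lemma ren_atyp_ident [simp]: "ren_atyp (\<lambda>z. z) P = P"
  by (induction P) auto

lemma ren_tp_ident [simp]: "ren_tp (\<lambda>z. z) A = A"
  by (induction A) auto

lemma ren_canon_id: "(\<And>z. z \<in> fv_canon M \<Longrightarrow> f z = z) \<Longrightarrow> ren_canon f M = M"
  using ren_canon_cong[of M f "\<lambda>z. z"] by simp

lemma ren_tp_id: "(\<And>z. z \<in> fv_tp A \<Longrightarrow> f z = z) \<Longrightarrow> ren_tp f A = A"
  using ren_tp_cong[of A f "\<lambda>z. z"] by simp

lemma erase_ren [simp]: "erase (ren_tp f A) = erase A"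
  by (induction A) auto

lemma erase_open [simp]: "erase (open_tp k x A) = erase A"
  by (induction A arbitrary: k) auto

lemma erase_close [simp]: "erase (close_tp k x A) = erase A"
  by (induction A arbitrary: k) auto

lemma fv_close_canon [simp]: "fv_canon (close_canon k x M) = fv_canon M - {x}"
  and fv_close_atom [simp]: "fv_atom (close_atom k x R) = fv_atom R - {x}"
  by (induction M and R arbitrary: k and k) auto

lemma fv_close_atyp [simp]: "fv_atyp (close_atyp k x P) = fv_atyp P - {x}"
  by (induction P) auto

lemma fv_close_tp [simp]: "fv_tp (close_tp k x A) = fv_tp A - {x}"
  by (induction A arbitrary: k) auto

lemma fv_open_canon_lower: "fv_canon M \<subseteq> fv_canon (open_canon k x M)"
  and fv_open_atom_lower: "fv_atom R \<subseteq> fv_atom (open_atom k x R)"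
  by (induction M and R arbitrary: k and k) (auto; blast)+

lemma fv_open_canon_upper: "fv_canon (open_canon k x M) \<subseteq> insert x (fv_canon M)"
  and fv_open_atom_upper: "fv_atom (open_atom k x R) \<subseteq> insert x (fv_atom R)"
  by (induction M and R arbitrary: k and k) (auto; blast)+

lemma fv_open_atyp_upper: "fv_atyp (open_atyp k x P) \<subseteq> insert x (fv_atyp P)"
  by (induction P) (use fv_open_canon_upper in fastforce)+

lemma fv_open_tp_upper: "fv_tp (open_tp k x A) \<subseteq> insert x (fv_tp A)"
proof (induction A arbitrary: k)
  case (At P) show ?case using fv_open_atyp_upper by simp
next
  case (Pi A B) then show ?case by fastforce
qed

lemma open_close_canon: "open_canon k y (close_canon k x M) = ren_canon (\<lambda>z. if z = x then y else z) M"
  and open_close_atom: "open_atom k y (close_atom k x R) = ren_atom (\<lambda>z. if z = x then y else z) R"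
  by (induction M and R arbitrary: k and k) auto

lemma open_close_atyp: "open_atyp k y (close_atyp k x P) = ren_atyp (\<lambda>z. if z = x then y else z) P"
  by (induction P) (auto simp: open_close_canon)

lemma open_close_tp: "open_tp k y (close_tp k x A) = ren_tp (\<lambda>z. if z = x then y else z) A"
  by (induction A arbitrary: k) (auto simp: open_close_atyp)

lemma open_close_canon_same [simp]: "open_canon k x (close_canon k x M) = M"
  by (subst open_close_canon) (rule ren_canon_id, simp)

lemma open_close_tp_same [simp]: "open_tp k x (close_tp k x A) = A"
  by (subst open_close_tp) (rule ren_tp_id, simp)

text \<open>Closing shifts outer dangling indices up and opening lowers them again, so the two are
  inverse on all expressions, locally closed or not, as soon as \<open>x\<close> is fresh.\<close>

lemma close_open_canon [simp]: "x \<notin> fv_canon M \<Longrightarrow> close_canon k x (open_canon k x M) = M"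
  and close_open_atom [simp]: "x \<notin> fv_atom R \<Longrightarrow> close_atom k x (open_atom k x R) = R"
  by (induction M and R arbitrary: k and k) auto

lemma close_open_atyp [simp]: "x \<notin> fv_atyp P \<Longrightarrow> close_atyp k x (open_atyp k x P) = P"
  by (induction P) auto

lemma close_open_tp [simp]: "x \<notin> fv_tp A \<Longrightarrow> close_tp k x (open_tp k x A) = A"
  by (induction A arbitrary: k) auto

lemma close_open_kind [simp]: "x \<notin> fv_kind K \<Longrightarrow> close_kind k x (open_kind k x K) = K"
  by (induction K arbitrary: k) auto

lemma lam_open: "x \<notin> fv_canon M \<Longrightarrow> lam x (open_canon 0 x M) = Lam M"
  by (simp add: lam_def)

lemma tpi_open: "x \<notin> fv_tp B \<Longrightarrow> tpi x A (open_tp 0 x B) = Pi A B"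
  by (simp add: tpi_def)

lemma kpi_open: "x \<notin> fv_kind K \<Longrightarrow> kpi x A (open_kind 0 x K) = KPi A K"
  by (simp add: kpi_def)

text \<open>The condition is capture avoidance: no other free variable may be sent to the new binder
  name. It admits non-injective \<open>f\<close>, which occur when a bound variable is opened with a
  name already in use.\<close>

lemma ren_close_canon:
  "(\<And>z. z \<in> fv_canon M \<Longrightarrow> z \<noteq> x \<Longrightarrow> f z \<noteq> y) \<Longrightarrow>
    ren_canon f (close_canon k x M) = close_canon k y (ren_canon (f(x := y)) M)"
  and ren_close_atom:
  "(\<And>z. z \<in> fv_atom R \<Longrightarrow> z \<noteq> x \<Longrightarrow> f z \<noteq> y) \<Longrightarrow>
    ren_atom f (close_atom k x R) = close_atom k y (ren_atom (f(x := y)) R)"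
  by (induction M and R arbitrary: k and k) auto

lemma ren_close_atyp:
  "(\<And>z. z \<in> fv_atyp P \<Longrightarrow> z \<noteq> x \<Longrightarrow> f z \<noteq> y) \<Longrightarrow>
    ren_atyp f (close_atyp k x P) = close_atyp k y (ren_atyp (f(x := y)) P)"
  by (induction P) (auto simp: ren_close_canon)

lemma ren_close_tp:
  "(\<And>z. z \<in> fv_tp A \<Longrightarrow> z \<noteq> x \<Longrightarrow> f z \<noteq> y) \<Longrightarrow>
    ren_tp f (close_tp k x A) = close_tp k y (ren_tp (f(x := y)) A)"
  by (induction A arbitrary: k) (auto simp: ren_close_atyp)

lemma ren_lam:
  "(\<And>z. z \<in> fv_canon M \<Longrightarrow> z \<noteq> x \<Longrightarrow> f z \<noteq> y) \<Longrightarrow> ren_canon f (lam x M) = lam y (ren_canon (f(x := y)) M)"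
  by (simp add: lam_def ren_close_canon)

lemma ren_tpi:
  "(\<And>z. z \<in> fv_tp B \<Longrightarrow> z \<noteq> x \<Longrightarrow> f z \<noteq> y) \<Longrightarrow>
    ren_tp f (tpi x A B) = tpi y (ren_tp f A) (ren_tp (f(x := y)) B)"
  by (simp add: tpi_def ren_close_tp)

lemma ren_open_canon: "ren_canon f (open_canon k x M) = open_canon k (f x) (ren_canon f M)"
  and ren_open_atom: "ren_atom f (open_atom k x R) = open_atom k (f x) (ren_atom f R)"
  by (induction M and R arbitrary: k and k) auto

lemma ren_open_atyp: "ren_atyp f (open_atyp k x P) = open_atyp k (f x) (ren_atyp f P)"
  by (induction P) (auto simp: ren_open_canon)

lemma ren_open_tp: "ren_tp f (open_tp k x A) = open_tp k (f x) (ren_tp f A)"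
  by (induction A arbitrary: k) (auto simp: ren_open_atyp)

section \<open>Hereditary substitution: renaming, inversion, functionality\<close>

lemma fmlookup_single [simp]: "fmlookup (single x M \<alpha>) z = (if z = x then Some (M, \<alpha>) else None)"
  by (simp add: single_def)

lemma fv_range_iff: "x \<in> fv_range \<theta> \<longleftrightarrow> (\<exists>z M \<alpha>. fmlookup \<theta> z = Some (M, \<alpha>) \<and> x \<in> fv_canon M)"
  unfolding fv_range_def by (simp add: fmlookup_ran'_iff Bex_def) blast

lemma notin_fmdom'_iff: "x \<notin> fmdom' \<theta> \<longleftrightarrow> fmlookup \<theta> x = None"
  by (auto simp: fmlookup_dom'_iff)

lemma fresh_subst_iff:
  "fresh_subst x \<theta> \<longleftrightarrow> fmlookup \<theta> x = None \<and> (\<forall>z M \<alpha>. fmlookup \<theta> z = Some (M, \<alpha>) \<longrightarrow> x \<notin> fv_canon M)"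
  unfolding fresh_subst_def fv_range_iff notin_fmdom'_iff by blast

lemma finite_fv_range [simp]: "finite (fv_range \<theta>)"
proof -
  have "fmran' \<theta> \<subseteq> (\<lambda>x. the (fmlookup \<theta> x)) ` fmdom' \<theta>"
  proof
    fix p assume "p \<in> fmran' \<theta>"
    then obtain x where "fmlookup \<theta> x = Some p" by (auto simp: fmlookup_ran'_iff)
    then show "p \<in> (\<lambda>x. the (fmlookup \<theta> x)) ` fmdom' \<theta>"
      by (intro image_eqI[of _ _ x]) (auto intro: fmdom'I)
  qed
  then have "finite (fmran' \<theta>)" by (rule finite_subset) simp
  then show ?thesis unfolding fv_range_def by auto
qed

lemma fresh_substI: "x \<notin> fmdom' \<theta> \<union> fv_range \<theta> \<Longrightarrow> fresh_subst x \<theta>"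
  by (simp add: fresh_subst_def)

text \<open>\<open>\<theta>'\<close> acts on a term renamed by \<open>f\<close> as \<open>\<theta>\<close> followed by the renaming \<open>g\<close>. The variables of
  the source and of the result are renamed independently, so that this covers equivariance as well
  as renaming only the domain of a substitution.\<close>

definition ren_compat :: "(var \<Rightarrow> var) \<Rightarrow> (var \<Rightarrow> var) \<Rightarrow> subst \<Rightarrow> subst \<Rightarrow> var \<Rightarrow> bool" where
  "ren_compat f g \<theta> \<theta>' z \<longleftrightarrow> (case fmlookup \<theta> z of
     None \<Rightarrow> fmlookup \<theta>' (f z) = None \<and> f z = g z
   | Some (N, \<alpha>) \<Rightarrow> fmlookup \<theta>' (f z) = Some (ren_canon g N, \<alpha>))"

text \<open>The binder \<open>x\<close> becomes \<open>y\<close> in source and result alike, so both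
  renamings are updated. As \<open>x\<close> is fresh for the range of \<open>\<theta>\<close>, the
  update of \<open>g\<close> does not disturb the range terms.\<close>

lemma ren_compat_binder:
  assumes "fresh_subst x \<theta>" "fmlookup \<theta>' y = None" "z \<noteq> x \<Longrightarrow> ren_compat f g \<theta> \<theta>' z"
  shows "ren_compat (f(x := y)) (g(x := y)) \<theta> \<theta>' z"
proof (cases "fmlookup \<theta> z")
  case None
  then show ?thesis using assms by (auto simp: ren_compat_def fresh_subst_iff)
next
  case (Some p)
  then obtain N \<alpha> where p: "fmlookup \<theta> z = Some (N, \<alpha>)" by (cases p) auto
  then have "z \<noteq> x" "x \<notin> fv_canon N" using assms(1) by (auto simp: fresh_subst_iff)
  moreover from \<open>x \<notin> fv_canon N\<close> have "ren_canon (g(x := y)) N = ren_canon g N"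
    by (intro ren_canon_cong) auto
  ultimately show ?thesis using assms(3) p by (auto simp: ren_compat_def)
qed

lemma ex_fresh: "finite (S :: var set) \<Longrightarrow> \<exists>y. y \<notin> S"
  by (rule ex_new_if_finite) auto

text \<open>Compatibility is demanded on free variables only, because globally it fails in an
  important use: renaming the variable \<open>x\<close> of a single substitution to some
  \<open>y \<noteq> x\<close> is not compatible at \<open>y\<close> itself.\<close>

lemma hs_ren:
  "hs \<theta> M M' \<Longrightarrow> (\<And>z. z \<in> fv_canon M \<Longrightarrow> ren_compat f g \<theta> \<theta>' z) \<Longrightarrow>
    hs \<theta>' (ren_canon f M) (ren_canon g M')"
  and hs_at_ren:
  "hs_at \<theta> R R' \<Longrightarrow> (\<And>z. z \<in> fv_atom R \<Longrightarrow> ren_compat f g \<theta> \<theta>' z) \<Longrightarrow>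
    hs_at \<theta>' (ren_atom f R) (ren_atom g R')"
  and hs_tm_ren:
  "hs_tm \<theta> R M' \<alpha> \<Longrightarrow> (\<And>z. z \<in> fv_atom R \<Longrightarrow> ren_compat f g \<theta> \<theta>' z) \<Longrightarrow>
    hs_tm \<theta>' (ren_atom f R) (ren_canon g M') \<alpha>"
proof (induction arbitrary: f g \<theta>' and f g \<theta>' and f g \<theta>' rule: hs_hs_at_hs_tm.inducts)
  case (hs_Lam x \<theta> M M')
  obtain y where y: "y \<notin> fmdom' \<theta>' \<union> fv_range \<theta>' \<union> f ` fv_canon M \<union> g ` fv_canon M'"
    using ex_fresh[of "fmdom' \<theta>' \<union> fv_range \<theta>' \<union> f ` fv_canon M \<union> g ` fv_canon M'"] by auto
  then have "fresh_subst y \<theta>'" by (intro fresh_substI) auto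
  moreover have "hs \<theta>' (ren_canon (f(x := y)) M) (ren_canon (g(x := y)) M')"
    using y hs_Lam.hyps hs_Lam.prems
    by (intro hs_Lam.IH ren_compat_binder) (auto simp: lam_def fmlookup_dom'_iff)
  ultimately have "hs \<theta>' (lam y (ren_canon (f(x := y)) M)) (lam y (ren_canon (g(x := y)) M'))"
    by (rule hs_hs_at_hs_tm.hs_Lam)
  moreover have "ren_canon f (lam x M) = lam y (ren_canon (f(x := y)) M)"
    "ren_canon g (lam x M') = lam y (ren_canon (g(x := y)) M')"
    using y by (auto intro!: ren_lam)
  ultimately show ?case by simp
next
  case (hs_tm_App \<theta> R x M' \<alpha>' \<alpha>'' M M'' M''')
  obtain y where y: "y \<notin> g ` fv_canon M'"
    using ex_fresh[of "g ` fv_canon M'"] by auto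
  have "ren_canon g (lam x M') = lam y (ren_canon (g(x := y)) M')"
    using y by (auto intro!: ren_lam)
  then have R: "hs_tm \<theta>' (ren_atom f R) (lam y (ren_canon (g(x := y)) M')) (Arr \<alpha>' \<alpha>'')"
    using hs_tm_App.IH(1)[of f g \<theta>'] hs_tm_App.prems by auto
  moreover have "hs \<theta>' (ren_canon f M) (ren_canon g M'')"
    using hs_tm_App.prems by (intro hs_tm_App.IH) auto
  \<comment> \<open>Here the two renamings differ: in the body \<open>x\<close> stands for the
    substituted variable and becomes \<open>y\<close>, while in the result of the reduction
    \<open>x\<close> is an ordinary variable, renamed by \<open>g\<close>.\<close>
  moreover have "hs (single y (ren_canon g M'') \<alpha>') (ren_canon (g(x := y)) M') (ren_canon g M''')"
    using y by (intro hs_tm_App.IH) (auto simp: ren_compat_def)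
  ultimately show ?case by (auto intro: hs_hs_at_hs_tm.hs_tm_App)
next
  case (hs_tm_Var \<theta> x M \<alpha>)
  then show ?case by (auto simp: ren_compat_def intro!: hs_hs_at_hs_tm.hs_tm_Var)
next
  case (hs_at_Var x \<theta>)
  then have "fmlookup \<theta>' (f x) = None" "f x = g x"
    by (auto simp: ren_compat_def fmlookup_dom'_iff split: option.splits)
  then show ?case by (auto simp: fmlookup_dom'_iff intro!: hs_hs_at_hs_tm.hs_at_Var)
qed (auto intro: hs_hs_at_hs_tm.intros)

lemma hs_atyp_ren:
  "hs_atyp \<theta> P P' \<Longrightarrow> (\<And>z. z \<in> fv_atyp P \<Longrightarrow> ren_compat f g \<theta> \<theta>' z) \<Longrightarrow>
    hs_atyp \<theta>' (ren_atyp f P) (ren_atyp g P')"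
  by (induction rule: hs_atyp.induct) (auto intro: hs_atyp.intros hs_ren)

lemma hs_tp_ren:
  "hs_tp \<theta> A A' \<Longrightarrow> (\<And>z. z \<in> fv_tp A \<Longrightarrow> ren_compat f g \<theta> \<theta>' z) \<Longrightarrow>
    hs_tp \<theta>' (ren_tp f A) (ren_tp g A')"
proof (induction arbitrary: f g \<theta>' rule: hs_tp.induct)
  case (hs_Pi x \<theta> A A' B B')
  obtain y where y: "y \<notin> fmdom' \<theta>' \<union> fv_range \<theta>' \<union> f ` fv_tp B \<union> g ` fv_tp B'"
    using ex_fresh[of "fmdom' \<theta>' \<union> fv_range \<theta>' \<union> f ` fv_tp B \<union> g ` fv_tp B'"] by auto
  then have "fresh_subst y \<theta>'" by (intro fresh_substI) auto
  moreover have "hs_tp \<theta>' (ren_tp f A) (ren_tp g A')"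
    using hs_Pi.prems by (intro hs_Pi.IH) (auto simp: tpi_def)
  moreover have "hs_tp \<theta>' (ren_tp (f(x := y)) B) (ren_tp (g(x := y)) B')"
    using y hs_Pi.hyps hs_Pi.prems
    by (intro hs_Pi.IH ren_compat_binder) (auto simp: tpi_def fmlookup_dom'_iff)
  ultimately have "hs_tp \<theta>' (tpi y (ren_tp f A) (ren_tp (f(x := y)) B))
      (tpi y (ren_tp g A') (ren_tp (g(x := y)) B'))"
    by (rule hs_tp.hs_Pi)
  moreover have "ren_tp f (tpi x A B) = tpi y (ren_tp f A) (ren_tp (f(x := y)) B)"
    "ren_tp g (tpi x A' B') = tpi y (ren_tp g A') (ren_tp (g(x := y)) B')"
    using y by (auto intro!: ren_tpi)
  ultimately show ?case by simp
qed (auto intro: hs_tp.intros hs_atyp_ren)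

lemma kind_tp_kpi: "kind_tp (kpi x A K) = tpi x A (kind_tp K)"
  by (simp add: kpi_def tpi_def)

lemma hs_kind_imp_hs_tp: "hs_kind \<theta> K K' \<Longrightarrow> hs_tp \<theta> (kind_tp K) (kind_tp K')"
  by (induction rule: hs_kind.induct) (auto simp: kind_tp_kpi intro: hs_tp.intros hs_atyp.intros)

text \<open>The image of \<open>kind_tp\<close> is closed under substitution. Totality, proved for
  types, yields only a type; this turns it back into a kind.\<close>

lemma hs_tp_kind_tp: "hs_tp \<theta> (kind_tp K) A' \<Longrightarrow> \<exists>K'. A' = kind_tp K' \<and> hs_kind \<theta> K K'"
proof (induction \<theta> "kind_tp K" A' arbitrary: K rule: hs_tp.induct)
  case (hs_At \<theta> P P')
  then have "K = KType" "P = TConst []" by (cases K; auto)+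
  with hs_At have "P' = TConst []" by (auto elim: hs_atyp.cases)
  then show ?case using \<open>K = KType\<close> by (auto intro!: exI[of _ KType] hs_kind.intros)
next
  case (hs_Pi x \<theta> A A' B B')
  then obtain K0 where K: "K = KPi A K0" "kind_tp K0 = close_tp 0 x B"
    by (cases K) (auto simp: tpi_def)
  then have "B = kind_tp (open_kind 0 x K0)" by simp
  from hs_Pi(5)[OF this] obtain K1 where K1: "B' = kind_tp K1" "hs_kind \<theta> (open_kind 0 x K0) K1"
    by blast
  have "x \<notin> fv_kind K0" using K(2) by simp
  then have "K = kpi x A (open_kind 0 x K0)" using K(1) by (simp add: kpi_open)
  with K1 hs_Pi have "hs_kind \<theta> K (kpi x A' K1)" by (auto intro: hs_kind.intros)
  then show ?case using K1 by (auto simp: kind_tp_kpi intro!: exI[of _ "kpi x A' K1"])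
qed

lemma hs_kind_iff: "hs_kind \<theta> K K' \<longleftrightarrow> hs_tp \<theta> (kind_tp K) (kind_tp K')"
  using hs_kind_imp_hs_tp hs_tp_kind_tp by fastforce

section \<open>Inversion at a binder name of choice\<close>

lemma ren_compat_refl: "ren_compat (\<lambda>z. z) (\<lambda>z. z) \<theta> \<theta> z"
  by (auto simp: ren_compat_def split: option.split)

lemma ren_compat_open:
  assumes "fresh_subst x \<theta>" "fmlookup \<theta> y = None"
  shows "ren_compat (\<lambda>z. if z = x then y else z) (\<lambda>z. if z = x then y else z) \<theta> \<theta> z"
  using ren_compat_binder[OF assms ren_compat_refl, of z] by (simp add: fun_upd_def)

text \<open>The rule fixes some binder name \<open>x\<close>. Since renamings may identify
  variables, \<open>x\<close> can be exchanged for any \<open>y\<close> outside the domain of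
  \<open>\<theta>\<close>, even one that occurs in \<open>B\<close> or in the range.\<close>

lemma hs_Lam_inv:
  assumes "hs \<theta> (Lam B) M'"
  obtains B' where "M' = Lam B'"
    "\<And>y. fmlookup \<theta> y = None \<Longrightarrow> hs \<theta> (open_canon 0 y B) (open_canon 0 y B')"
  using assms
proof cases
  case (hs_Lam x M M0)
  show thesis
  proof (rule that[of "close_canon 0 x M0"])
    show "M' = Lam (close_canon 0 x M0)" using hs_Lam by (simp add: lam_def)
    fix y assume "fmlookup \<theta> y = None"
    then have "hs \<theta> (ren_canon (\<lambda>z. if z = x then y else z) M) (ren_canon (\<lambda>z. if z = x then y else z) M0)"
      using hs_Lam ren_compat_open[of x \<theta> y] by (intro hs_ren) blast+
    then show "hs \<theta> (open_canon 0 y B) (open_canon 0 y (close_canon 0 x M0))"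
      using hs_Lam by (simp add: lam_def open_close_canon)
  qed
qed

lemma hs_LamI:
  assumes "hs \<theta> (open_canon 0 y B) (open_canon 0 y B')" "fresh_subst y \<theta>"
    "y \<notin> fv_canon B" "y \<notin> fv_canon B'"
  shows "hs \<theta> (Lam B) (Lam B')"
  using hs_Lam[OF assms(2,1)] assms(3,4) by (simp add: lam_open)

lemma hs_Pi_inv:
  assumes "hs_tp \<theta> (Pi A B) T"
  obtains A' B' where "T = Pi A' B'" "hs_tp \<theta> A A'"
    "\<And>y. fmlookup \<theta> y = None \<Longrightarrow> hs_tp \<theta> (open_tp 0 y B) (open_tp 0 y B')"
  using assms
proof cases
  case (hs_Pi x A1 A' B1 B0)
  show thesis
  proof (rule that[of A' "close_tp 0 x B0"])
    show "T = Pi A' (close_tp 0 x B0)" "hs_tp \<theta> A A'" using hs_Pi by (simp_all add: tpi_def)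
    fix y assume "fmlookup \<theta> y = None"
    then have "hs_tp \<theta> (ren_tp (\<lambda>z. if z = x then y else z) B1) (ren_tp (\<lambda>z. if z = x then y else z) B0)"
      using hs_Pi ren_compat_open[of x \<theta> y] by (intro hs_tp_ren) blast+
    then show "hs_tp \<theta> (open_tp 0 y B) (open_tp 0 y (close_tp 0 x B0))"
      using hs_Pi by (simp add: tpi_def open_close_tp)
  qed
qed

lemma hs_PiI:
  assumes "hs_tp \<theta> A A'" "hs_tp \<theta> (open_tp 0 y B) (open_tp 0 y B')" "fresh_subst y \<theta>"
    "y \<notin> fv_tp B" "y \<notin> fv_tp B'"
  shows "hs_tp \<theta> (Pi A B) (Pi A' B')"
  using hs_tp.hs_Pi[OF assms(3,1,2)] assms(4,5) by (simp add: tpi_open)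

lemma hs_KPi_inv:
  assumes "hs_kind \<theta> (KPi A K) T"
  obtains A' K' where "T = KPi A' K'" "hs_tp \<theta> A A'"
    "\<And>y. fmlookup \<theta> y = None \<Longrightarrow> hs_kind \<theta> (open_kind 0 y K) (open_kind 0 y K')"
proof -
  from assms have "hs_tp \<theta> (Pi A (kind_tp K)) (kind_tp T)" by (simp add: hs_kind_iff)
  then obtain A' B' where *: "kind_tp T = Pi A' B'" "hs_tp \<theta> A A'"
    "\<And>y. fmlookup \<theta> y = None \<Longrightarrow> hs_tp \<theta> (open_tp 0 y (kind_tp K)) (open_tp 0 y B')"
    by (rule hs_Pi_inv) blast
  from *(1) obtain K' where "T = KPi A' K'" "B' = kind_tp K'" by (cases T) auto
  with * show thesis by (intro that[of A' K']) (auto simp: hs_kind_iff)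
qed

lemma ren_compat_single_alpha:
  assumes "F - {x} = G - {y}" "z \<in> F"
  shows "ren_compat (\<lambda>z. if z = x then y else z) (\<lambda>z. z) (single x P a) (single y P a) z"
  using assms by (auto simp: ren_compat_def)

text \<open>A redex comes with a binder name of its own. The first hypothesis says that
  \<open>M\<close> and \<open>N\<close> are the same body under two names; the domain variable is
  renamed while the result keeps its names, so \<open>hs_ren\<close> is used with the identity on
  the result side.\<close>

lemma hs_single_alpha:
  assumes "close_canon 0 x M = close_canon 0 y N" "hs (single x P a) M M'"
  shows "hs (single y P a) N M'"
proof -
  have N: "N = ren_canon (\<lambda>z. if z = x then y else z) M"
    by (metis assms(1) open_close_canon open_close_canon_same)
  have "fv_canon M - {x} = fv_canon N - {y}" by (metis assms(1) fv_close_canon)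
  then have "hs (single y P a) (ren_canon (\<lambda>z. if z = x then y else z) M) (ren_canon (\<lambda>z. z) M')"
    by (intro hs_ren[OF assms(2)] ren_compat_single_alpha)
  then show ?thesis using N by simp
qed

lemma hs_tp_single_alpha:
  assumes "close_tp 0 x A = close_tp 0 y B" "hs_tp (single x P a) A A'"
  shows "hs_tp (single y P a) B A'"
proof -
  have N: "B = ren_tp (\<lambda>z. if z = x then y else z) A"
    by (metis assms(1) open_close_tp open_close_tp_same)
  have "fv_tp A - {x} = fv_tp B - {y}" by (metis assms(1) fv_close_tp)
  then have "hs_tp (single y P a) (ren_tp (\<lambda>z. if z = x then y else z) A) (ren_tp (\<lambda>z. z) A')"
    by (intro hs_tp_ren[OF assms(2)] ren_compat_single_alpha)
  then show ?thesis using N by simp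
qed

lemma binder_distinct [simp]:
  "Atm R \<noteq> lam x M" "lam x M \<noteq> Atm R" "At P \<noteq> tpi x A B" "tpi x A B \<noteq> At P" "KType \<noteq> kpi x A K" "kpi x A K \<noteq> KType"
  by (simp_all add: lam_def tpi_def kpi_def)

inductive_cases hs_AtmE: "hs \<theta> (Atm R) M'"
inductive_cases hs_tm_VarE: "hs_tm \<theta> (FVar x) M' \<alpha>"
inductive_cases hs_tm_ConstE: "hs_tm \<theta> (Const c) M' \<alpha>"
inductive_cases hs_tm_AppE: "hs_tm \<theta> (App R M) M' \<alpha>"
inductive_cases hs_at_VarE: "hs_at \<theta> (FVar x) R'"
inductive_cases hs_at_ConstE: "hs_at \<theta> (Const c) R'"
inductive_cases hs_at_AppE: "hs_at \<theta> (App R M) R'"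
inductive_cases hs_TConstE: "hs_atyp \<theta> (TConst a) P'"
inductive_cases hs_TAppE: "hs_atyp \<theta> (TApp P M) P'"
inductive_cases hs_AtE: "hs_tp \<theta> (At P) A'"

section \<open>Free variables of results, and functionality\<close>

lemma fv_range_single [simp]: "fv_range (single x M a) = fv_canon M"
  by (auto simp: fv_range_iff split: if_splits)

lemma fmdom'_single [simp]: "fmdom' (single x M a) = {x}"
  by (auto simp: fmlookup_dom'_iff split: if_splits)

lemma fv_open_atyp_lower: "fv_atyp P \<subseteq> fv_atyp (open_atyp k x P)"
  by (induction P) (use fv_open_canon_lower in fastforce)+

lemma fv_open_tp_lower: "fv_tp A \<subseteq> fv_tp (open_tp k x A)"
proof (induction A arbitrary: k)
  case (At P) show ?case using fv_open_atyp_lower by simp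
next
  case (Pi A B) then show ?case by fastforce
qed

lemma hs_fv: "hs \<theta> M M' \<Longrightarrow> fv_canon M' \<subseteq> (fv_canon M - fmdom' \<theta>) \<union> fv_range \<theta>"
  and hs_at_fv: "hs_at \<theta> R R' \<Longrightarrow> fv_atom R' \<subseteq> (fv_atom R - fmdom' \<theta>) \<union> fv_range \<theta>"
  and hs_tm_fv: "hs_tm \<theta> R M' \<alpha> \<Longrightarrow> fv_canon M' \<subseteq> (fv_atom R - fmdom' \<theta>) \<union> fv_range \<theta>"
proof (induction rule: hs_hs_at_hs_tm.inducts)
  case (hs_Lam x \<theta> M M')
  then show ?case by (auto simp: lam_def fresh_subst_def)
next
  case (hs_tm_App \<theta> R x M' \<alpha>' \<alpha>'' M M'' M''')
  then have "fv_canon M' - {x} \<subseteq> (fv_atom R - fmdom' \<theta>) \<union> fv_range \<theta>"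
    "fv_canon M''' \<subseteq> (fv_canon M' - {x}) \<union> fv_canon M''"
    by (auto simp: lam_def)
  with hs_tm_App.IH(2) show ?case by auto
next
  case (hs_tm_Var \<theta> x M \<alpha>)
  then show ?case by (blast intro: fv_range_iff[THEN iffD2])
qed auto

lemma hs_atyp_fv: "hs_atyp \<theta> P P' \<Longrightarrow> fv_atyp P' \<subseteq> (fv_atyp P - fmdom' \<theta>) \<union> fv_range \<theta>"
  by (induction rule: hs_atyp.induct) (use hs_fv in fastforce)+

lemma hs_tp_fv: "hs_tp \<theta> A A' \<Longrightarrow> fv_tp A' \<subseteq> (fv_tp A - fmdom' \<theta>) \<union> fv_range \<theta>"
proof (induction rule: hs_tp.induct)
  case (hs_At \<theta> P P') then show ?case using hs_atyp_fv by simp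
next
  case (hs_Pi x \<theta> A A' B B')
  then show ?case by (auto simp: tpi_def fresh_subst_def)
qed

text \<open>The head decides: a term yields \<open>hs_tm\<close> only if its head is a variable in
  the domain, and \<open>hs_at\<close> only if it is a constant or a variable outside.\<close>

lemma hs_at_not_hs_tm:
  assumes "hs_at \<theta> R R'" "hs_tm \<theta> R M' \<alpha>"
  shows False
proof -
  from assms(2) have "\<forall>R'. \<not> hs_at \<theta> R R'"
    by (induction rule: hs_hs_at_hs_tm.inducts(3)[of _ _ _ _ "\<lambda>_ _ _. True" "\<lambda>_ _ _. True"])
      (auto elim!: hs_at_VarE hs_at_AppE simp: fmlookup_dom'_iff)
  then show False using assms(1) by blast
qed

lemma hs_functional: "hs \<theta> M M1 \<Longrightarrow> hs \<theta> M M2 \<Longrightarrow> M1 = M2"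
  and hs_at_functional: "hs_at \<theta> R R1 \<Longrightarrow> hs_at \<theta> R R2 \<Longrightarrow> R1 = R2"
  and hs_tm_functional: "hs_tm \<theta> R N1 \<alpha>1 \<Longrightarrow> hs_tm \<theta> R N2 \<alpha>2 \<Longrightarrow> N1 = N2 \<and> \<alpha>1 = \<alpha>2"
proof (induction arbitrary: M2 and R2 and N2 \<alpha>2 rule: hs_hs_at_hs_tm.inducts)
  case (hs_Atm \<theta> R R')
  from hs_Atm.prems show ?case by (rule hs_AtmE) (use hs_Atm hs_at_not_hs_tm in blast)+
next
  case (hs_Red \<theta> R M' \<alpha>')
  from hs_Red.prems show ?case by (rule hs_AtmE) (use hs_Red hs_at_not_hs_tm in blast)+
next
  case (hs_Lam x \<theta> M M')
  from \<open>hs \<theta> (lam x M) M2\<close> obtain B' where B': "M2 = Lam B'"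
    "\<And>y. fmlookup \<theta> y = None \<Longrightarrow> hs \<theta> (open_canon 0 y (close_canon 0 x M)) (open_canon 0 y B')"
    unfolding lam_def by (rule hs_Lam_inv) blast
  \<comment> \<open>Opening the second result with the binder of the first makes the induction
    hypothesis applicable without renaming.\<close>
  have "hs \<theta> M (open_canon 0 x B')"
    using B'(2)[of x] hs_Lam.hyps by (simp add: fresh_subst_iff)
  then have "M' = open_canon 0 x B'" by (rule hs_Lam.IH)
  moreover have "x \<notin> fv_canon B'"
    using hs_fv[OF \<open>hs \<theta> (lam x M) M2\<close>] B'(1) hs_Lam.hyps by (auto simp: lam_def fresh_subst_def)
  ultimately show ?case using B' by (simp add: lam_open)
next
  case (hs_tm_App \<theta> R x M' \<alpha>' \<alpha>'' M M'' M''')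
  from \<open>hs_tm \<theta> (App R M) N2 \<alpha>2\<close> obtain x2 M2' a2 N where
    *: "hs_tm \<theta> R (lam x2 M2') (Arr a2 \<alpha>2)" "hs \<theta> M N" "hs (single x2 N a2) M2' N2"
    by (elim hs_tm_AppE) blast
  from hs_tm_App.IH(1)[OF *(1)] hs_tm_App.IH(2)[OF *(2)]
  have eq: "close_canon 0 x2 M2' = close_canon 0 x M'" "a2 = \<alpha>'" "\<alpha>2 = \<alpha>''" "N = M''"
    by (auto simp: lam_def)
  from hs_single_alpha[OF eq(1) *(3)] have "hs (single x M'' \<alpha>') M' N2" using eq by simp
  then have "M''' = N2" by (rule hs_tm_App.IH)
  then show ?case using eq by simp
next
  case (hs_tm_Var \<theta> x M \<alpha>)
  then show ?case by (elim hs_tm_VarE) simp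
next
  case (hs_at_Const \<theta> c)
  then show ?case by (auto elim!: hs_at_ConstE)
next
  case (hs_at_Var x \<theta>)
  then show ?case by (auto elim!: hs_at_VarE)
next
  case (hs_at_App \<theta> R R' M M')
  from hs_at_App.prems show ?case by (rule hs_at_AppE) (use hs_at_App in blast)
qed

lemma hs_atyp_functional: "hs_atyp \<theta> P P1 \<Longrightarrow> hs_atyp \<theta> P P2 \<Longrightarrow> P1 = P2"
proof (induction arbitrary: P2 rule: hs_atyp.induct)
  case (hs_TApp \<theta> P P' M M')
  from hs_TApp.prems show ?case by (rule hs_TAppE) (use hs_TApp hs_functional in blast)
qed (auto elim: hs_TConstE)

lemma hs_tp_functional: "hs_tp \<theta> A A1 \<Longrightarrow> hs_tp \<theta> A A2 \<Longrightarrow> A1 = A2"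
proof (induction arbitrary: A2 rule: hs_tp.induct)
  case (hs_At \<theta> P P')
  from hs_At.prems show ?case by (rule hs_AtE) (use hs_At hs_atyp_functional in blast)
next
  case (hs_Pi x \<theta> A A' B B')
  from \<open>hs_tp \<theta> (tpi x A B) A2\<close> obtain A0 B0 where B0: "A2 = Pi A0 B0" "hs_tp \<theta> A A0"
    "\<And>y. fmlookup \<theta> y = None \<Longrightarrow> hs_tp \<theta> (open_tp 0 y (close_tp 0 x B)) (open_tp 0 y B0)"
    unfolding tpi_def by (rule hs_Pi_inv) blast
  have "hs_tp \<theta> B (open_tp 0 x B0)"
    using B0(3)[of x] hs_Pi.hyps by (simp add: fresh_subst_iff)
  then have "B' = open_tp 0 x B0" by (rule hs_Pi.IH)
  \<comment> \<open>The free variable bound for the whole Pi type is too weak, because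
    \<open>x\<close> may be free in \<open>A\<close>. Opening with some \<open>y \<noteq> x\<close>
    isolates the body.\<close>
  moreover have "x \<notin> fv_tp B0"
  proof -
    obtain y where y: "y \<notin> insert x (fmdom' \<theta>)"
      using ex_fresh[of "insert x (fmdom' \<theta>)"] by auto
    then have "fv_tp (open_tp 0 y B0) \<subseteq> insert y (fv_tp B - {x}) \<union> fv_range \<theta>"
      using hs_tp_fv[OF B0(3)[of y]] fv_open_tp_upper[of 0 y "close_tp 0 x B"]
      by (auto simp: notin_fmdom'_iff)
    then show ?thesis using fv_open_tp_lower[of B0 0 y] y hs_Pi.hyps by (auto simp: fresh_subst_def)
  qed
  moreover have "A' = A0" using B0(2) by (rule hs_Pi.IH)
  ultimately show ?case using B0 by (simp add: tpi_open)
qed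

lemma hs_kind_functional: "hs_kind \<theta> K K1 \<Longrightarrow> hs_kind \<theta> K K2 \<Longrightarrow> K1 = K2"
  using hs_tp_functional by (fastforce simp: hs_kind_iff)

section \<open>Arities\<close>

text \<open>Constants may be used at any arity: totality and composition need arities only for the
  variables that get replaced. So arities of atomic terms are not unique.\<close>

inductive ar :: "(var \<rightharpoonup> arity) \<Rightarrow> canon \<Rightarrow> arity \<Rightarrow> bool"
  and ar_at :: "(var \<rightharpoonup> arity) \<Rightarrow> atom \<Rightarrow> arity \<Rightarrow> bool" where
  ar_Atm: "ar_at \<Theta> R Base \<Longrightarrow> ar \<Theta> (Atm R) Base"
| ar_Lam: "finite L \<Longrightarrow> (\<And>x. x \<notin> L \<Longrightarrow> ar (\<Theta>(x \<mapsto> \<alpha>)) (open_canon 0 x B) \<beta>) \<Longrightarrow> ar \<Theta> (Lam B) (Arr \<alpha> \<beta>)"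
| ar_Const: "ar_at \<Theta> (Const c) \<alpha>"
| ar_Var: "\<Theta> x = Some \<alpha> \<Longrightarrow> ar_at \<Theta> (FVar x) \<alpha>"
| ar_App: "ar_at \<Theta> R (Arr \<alpha> \<beta>) \<Longrightarrow> ar \<Theta> M \<alpha> \<Longrightarrow> ar_at \<Theta> (App R M) \<beta>"

text \<open>Any arity will do for an argument here: the head of an atomic type is a constant, so no
  redex is ever created at this application.\<close>

primrec ar_atyp :: "(var \<rightharpoonup> arity) \<Rightarrow> atyp \<Rightarrow> bool" where
  "ar_atyp \<Theta> (TConst a) \<longleftrightarrow> True"
| "ar_atyp \<Theta> (TApp P M) \<longleftrightarrow> ar_atyp \<Theta> P \<and> (\<exists>\<alpha>. ar \<Theta> M \<alpha>)"

inductive ar_tp :: "(var \<rightharpoonup> arity) \<Rightarrow> tp \<Rightarrow> bool" where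
  ar_tp_At: "ar_atyp \<Theta> P \<Longrightarrow> ar_tp \<Theta> (At P)"
| ar_tp_Pi: "ar_tp \<Theta> A \<Longrightarrow> finite L \<Longrightarrow> (\<And>x. x \<notin> L \<Longrightarrow> ar_tp (\<Theta>(x \<mapsto> erase A)) (open_tp 0 x B)) \<Longrightarrow>
    ar_tp \<Theta> (Pi A B)"

abbreviation ar_kind :: "(var \<rightharpoonup> arity) \<Rightarrow> kind \<Rightarrow> bool" where
  "ar_kind \<Theta> K \<equiv> ar_tp \<Theta> (kind_tp K)"

text \<open>With \<open>f\<close> the identity this changes the environment off the free variables;
  with \<open>f\<close> sending \<open>x\<close> to \<open>y\<close> it changes the name at which a
  body is opened.\<close>

lemma ar_ren:
  "ar \<Theta> M \<alpha> \<Longrightarrow> (\<And>z. z \<in> fv_canon M \<Longrightarrow> \<Theta>' (f z) = \<Theta> z) \<Longrightarrow> ar \<Theta>' (ren_canon f M) \<alpha>"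
  and ar_at_ren:
  "ar_at \<Theta> R \<beta> \<Longrightarrow> (\<And>z. z \<in> fv_atom R \<Longrightarrow> \<Theta>' (f z) = \<Theta> z) \<Longrightarrow> ar_at \<Theta>' (ren_atom f R) \<beta>"
proof (induction arbitrary: \<Theta>' f and \<Theta>' f rule: ar_ar_at.inducts)
  case (ar_Lam L \<Theta> \<alpha> B \<beta>)
  have "ar (\<Theta>'(y \<mapsto> \<alpha>)) (open_canon 0 y (ren_canon f B)) \<beta>"
    if y: "y \<notin> L \<union> fv_canon B \<union> f ` fv_canon B" for y
  proof -
    \<comment> \<open>The opened variable is kept fixed. As \<open>y\<close> avoids the
      \<open>f\<close>-images of the free variables of \<open>B\<close>, none of them picks up the
      new entry of \<open>\<Theta>'\<close>.\<close>
    have "ar (\<Theta>'(y \<mapsto> \<alpha>)) (ren_canon (f(y := y)) (open_canon 0 y B)) \<beta>"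
    proof (rule ar_Lam.IH)
      fix z assume "z \<in> fv_canon (open_canon 0 y B)"
      then have "z = y \<or> z \<in> fv_canon B" using fv_open_canon_upper by fastforce
      then show "(\<Theta>'(y \<mapsto> \<alpha>)) ((f(y := y)) z) = (\<Theta>(y \<mapsto> \<alpha>)) z"
        using y ar_Lam.prems by auto
    qed (use y in auto)
    moreover have "ren_canon (f(y := y)) B = ren_canon f B" using y by (intro ren_canon_cong) auto
    ultimately show ?thesis by (simp add: ren_open_canon)
  qed
  then show ?case
    using ar_Lam.hyps by (auto intro!: ar_ar_at.ar_Lam[of "L \<union> fv_canon B \<union> f ` fv_canon B"])
next
  case (ar_App \<Theta> R \<alpha> \<beta> M)
  have "ar_at \<Theta>' (ren_atom f R) (Arr \<alpha> \<beta>)"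
    by (rule ar_App.IH) (simp add: ar_App.prems)
  moreover have "ar \<Theta>' (ren_canon f M) \<alpha>"
    by (rule ar_App.IH) (simp add: ar_App.prems)
  ultimately show ?case unfolding ren_atom.simps by (rule ar_ar_at.ar_App)
next
  case (ar_Atm \<Theta> R)
  then show ?case unfolding ren_canon.simps by (intro ar_ar_at.ar_Atm) simp
next
  case (ar_Const \<Theta> c \<alpha>)
  show ?case unfolding ren_atom.simps by (rule ar_ar_at.ar_Const)
next
  case (ar_Var \<Theta> x \<alpha>)
  then show ?case unfolding ren_atom.simps by (intro ar_ar_at.ar_Var) simp
qed

lemma ar_atyp_ren:
  "ar_atyp \<Theta> P \<Longrightarrow> (\<And>z. z \<in> fv_atyp P \<Longrightarrow> \<Theta>' (f z) = \<Theta> z) \<Longrightarrow> ar_atyp \<Theta>' (ren_atyp f P)"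
proof (induction P)
  case (TApp P M)
  then obtain \<alpha> where "ar \<Theta> M \<alpha>" by auto
  then have "ar \<Theta>' (ren_canon f M) \<alpha>" by (rule ar_ren) (simp add: TApp.prems)
  then show ?case using TApp by auto
qed simp

lemma ar_tp_ren:
  "ar_tp \<Theta> A \<Longrightarrow> (\<And>z. z \<in> fv_tp A \<Longrightarrow> \<Theta>' (f z) = \<Theta> z) \<Longrightarrow> ar_tp \<Theta>' (ren_tp f A)"
proof (induction arbitrary: \<Theta>' f rule: ar_tp.induct)
  case (ar_tp_Pi \<Theta> A L B)
  have "ar_tp (\<Theta>'(y \<mapsto> erase A)) (open_tp 0 y (ren_tp f B))"
    if y: "y \<notin> L \<union> fv_tp B \<union> f ` fv_tp B" for y
  proof -
    have "ar_tp (\<Theta>'(y \<mapsto> erase A)) (ren_tp (f(y := y)) (open_tp 0 y B))"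
    proof (rule ar_tp_Pi.IH)
      fix z assume "z \<in> fv_tp (open_tp 0 y B)"
      then have "z = y \<or> z \<in> fv_tp B" using fv_open_tp_upper by fastforce
      then show "(\<Theta>'(y \<mapsto> erase A)) ((f(y := y)) z) = (\<Theta>(y \<mapsto> erase A)) z"
        using y ar_tp_Pi.prems by auto
    qed (use y in auto)
    moreover have "ren_tp (f(y := y)) B = ren_tp f B" using y by (intro ren_tp_cong) auto
    ultimately show ?thesis by (simp add: ren_open_tp)
  qed
  then show ?case
    using ar_tp_Pi.hyps ar_tp_Pi.IH(1)[of \<Theta>' f] ar_tp_Pi.prems unfolding ren_tp.simps
    by (intro ar_tp.ar_tp_Pi[of _ _ "L \<union> fv_tp B \<union> f ` fv_tp B"]) simp_all
next
  case (ar_tp_At \<Theta> P)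
  then show ?case unfolding ren_tp.simps by (intro ar_tp.ar_tp_At ar_atyp_ren) simp_all
qed

lemma ar_cong: "ar \<Theta> M \<alpha> \<Longrightarrow> (\<And>z. z \<in> fv_canon M \<Longrightarrow> \<Theta>' z = \<Theta> z) \<Longrightarrow> ar \<Theta>' M \<alpha>"
  using ar_ren[of \<Theta> M \<alpha> \<Theta>' "\<lambda>z. z"] by simp

lemma ar_tp_cong: "ar_tp \<Theta> A \<Longrightarrow> (\<And>z. z \<in> fv_tp A \<Longrightarrow> \<Theta>' z = \<Theta> z) \<Longrightarrow> ar_tp \<Theta>' A"
  using ar_tp_ren[of \<Theta> A \<Theta>' "\<lambda>z. z"] by simp

lemma ar_fv: "ar \<Theta> M \<alpha> \<Longrightarrow> fv_canon M \<subseteq> dom \<Theta>"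
  and ar_at_fv: "ar_at \<Theta> R \<beta> \<Longrightarrow> fv_atom R \<subseteq> dom \<Theta>"
proof (induction rule: ar_ar_at.inducts)
  case (ar_Lam L \<Theta> \<alpha> B \<beta>)
  obtain y where y: "y \<notin> L \<union> fv_canon B"
    using ex_fresh[of "L \<union> fv_canon B"] ar_Lam.hyps by auto
  then have "fv_canon B \<subseteq> dom (\<Theta>(y \<mapsto> \<alpha>))"
    using ar_Lam.IH[of y] fv_open_canon_lower[of B 0 y] by blast
  then show ?case using y by (auto split: if_splits)
qed auto

lemma ar_atyp_fv: "ar_atyp \<Theta> P \<Longrightarrow> fv_atyp P \<subseteq> dom \<Theta>"
  by (induction P) (use ar_fv in fastforce)+

lemma ar_tp_fv: "ar_tp \<Theta> A \<Longrightarrow> fv_tp A \<subseteq> dom \<Theta>"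
proof (induction rule: ar_tp.induct)
  case (ar_tp_At \<Theta> P) then show ?case using ar_atyp_fv by simp
next
  case (ar_tp_Pi \<Theta> A L B)
  obtain y where y: "y \<notin> L \<union> fv_tp B"
    using ex_fresh[of "L \<union> fv_tp B"] ar_tp_Pi.hyps by auto
  then have "fv_tp B \<subseteq> dom (\<Theta>(y \<mapsto> erase A))"
    using ar_tp_Pi.IH(2)[of y] fv_open_tp_lower[of B 0 y] by blast
  then show ?case using y ar_tp_Pi.IH(1) by (auto split: if_splits)
qed

inductive_cases ar_LamE: "ar \<Theta> (Lam B) \<gamma>"
inductive_cases ar_tp_PiE: "ar_tp \<Theta> (Pi A B)"

text \<open>This connects the cofinite premise with a single instance: one fresh name suffices to
  introduce an abstraction, and inversion is available at every name that is not free in the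
  body.\<close>

lemma ar_open_ren:
  assumes "ar (\<Theta>(x \<mapsto> \<alpha>)) (open_canon 0 x B) \<beta>" "x \<notin> fv_canon B" "y \<notin> fv_canon B"
  shows "ar (\<Theta>(y \<mapsto> \<alpha>)) (open_canon 0 y B) \<beta>"
proof -
  define f where "f = (\<lambda>z. if z = x then y else z)"
  have "ar (\<Theta>(y \<mapsto> \<alpha>)) (ren_canon f (open_canon 0 x B)) \<beta>"
  proof (rule ar_ren[OF assms(1)])
    fix z assume "z \<in> fv_canon (open_canon 0 x B)"
    then have "z = x \<or> z \<in> fv_canon B" using fv_open_canon_upper by fastforce
    then show "(\<Theta>(y \<mapsto> \<alpha>)) (f z) = (\<Theta>(x \<mapsto> \<alpha>)) z" using assms(2,3) by (auto simp: f_def)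
  qed
  moreover have "ren_canon f B = B" using assms(2) by (intro ren_canon_id) (auto simp: f_def)
  ultimately show ?thesis by (simp add: ren_open_canon f_def)
qed

lemma ar_tp_open_ren:
  assumes "ar_tp (\<Theta>(x \<mapsto> \<alpha>)) (open_tp 0 x B)" "x \<notin> fv_tp B" "y \<notin> fv_tp B"
  shows "ar_tp (\<Theta>(y \<mapsto> \<alpha>)) (open_tp 0 y B)"
proof -
  define f where "f = (\<lambda>z. if z = x then y else z)"
  have "ar_tp (\<Theta>(y \<mapsto> \<alpha>)) (ren_tp f (open_tp 0 x B))"
  proof (rule ar_tp_ren[OF assms(1)])
    fix z assume "z \<in> fv_tp (open_tp 0 x B)"
    then have "z = x \<or> z \<in> fv_tp B" using fv_open_tp_upper by fastforce
    then show "(\<Theta>(y \<mapsto> \<alpha>)) (f z) = (\<Theta>(x \<mapsto> \<alpha>)) z" using assms(2,3) by (auto simp: f_def)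
  qed
  moreover have "ren_tp f B = B" using assms(2) by (intro ren_tp_id) (auto simp: f_def)
  ultimately show ?thesis by (simp add: ren_open_tp f_def)
qed

lemma ar_Lam_inv:
  assumes "ar \<Theta> (Lam B) (Arr \<alpha> \<beta>)" "y \<notin> fv_canon B"
  shows "ar (\<Theta>(y \<mapsto> \<alpha>)) (open_canon 0 y B) \<beta>"
proof -
  from assms(1) obtain L where L: "finite L" "\<And>x. x \<notin> L \<Longrightarrow> ar (\<Theta>(x \<mapsto> \<alpha>)) (open_canon 0 x B) \<beta>"
    by (rule ar_LamE) blast
  obtain x where "x \<notin> L \<union> fv_canon B" using ex_fresh[of "L \<union> fv_canon B"] L(1) by auto
  then show ?thesis using ar_open_ren[of \<Theta> x \<alpha> B \<beta> y] L(2) assms(2) by auto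
qed

lemma ar_tp_Pi_inv:
  assumes "ar_tp \<Theta> (Pi A B)" "y \<notin> fv_tp B"
  shows "ar_tp (\<Theta>(y \<mapsto> erase A)) (open_tp 0 y B)"
proof -
  from assms(1) obtain L where L: "finite L"
    "\<And>x. x \<notin> L \<Longrightarrow> ar_tp (\<Theta>(x \<mapsto> erase A)) (open_tp 0 x B)"
    by (rule ar_tp_PiE) blast
  obtain x where "x \<notin> L \<union> fv_tp B" using ex_fresh[of "L \<union> fv_tp B"] L(1) by auto
  then show ?thesis using ar_tp_open_ren[of \<Theta> x "erase A" B y] L(2) assms(2) by auto
qed

lemma ar_LamI:
  assumes "ar (\<Theta>(y \<mapsto> \<alpha>)) (open_canon 0 y B) \<beta>" "y \<notin> fv_canon B"
  shows "ar \<Theta> (Lam B) (Arr \<alpha> \<beta>)"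
  using ar_open_ren[OF assms] by (intro ar_Lam[of "fv_canon B"]) auto

lemma ar_tp_PiI:
  assumes "ar_tp \<Theta> A" "ar_tp (\<Theta>(y \<mapsto> erase A)) (open_tp 0 y B)" "y \<notin> fv_tp B"
  shows "ar_tp \<Theta> (Pi A B)"
  using assms(1) ar_tp_open_ren[OF assms(2,3)] by (intro ar_tp_Pi[of _ _ "fv_tp B"]) auto

lemma ar_lamI: "ar (\<Theta>(x \<mapsto> \<alpha>)) M \<beta> \<Longrightarrow> ar \<Theta> (lam x M) (Arr \<alpha> \<beta>)"
  unfolding lam_def by (rule ar_LamI[of _ x]) auto

lemma ar_tp_tpi: "ar_tp \<Theta> (tpi x A B) \<longleftrightarrow> ar_tp \<Theta> A \<and> ar_tp (\<Theta>(x \<mapsto> erase A)) B"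
proof
  assume *: "ar_tp \<Theta> (tpi x A B)"
  then show "ar_tp \<Theta> A \<and> ar_tp (\<Theta>(x \<mapsto> erase A)) B"
    using ar_tp_Pi_inv[of \<Theta> A "close_tp 0 x B" x] by (auto simp: tpi_def elim: ar_tp_PiE)
next
  assume "ar_tp \<Theta> A \<and> ar_tp (\<Theta>(x \<mapsto> erase A)) B"
  then show "ar_tp \<Theta> (tpi x A B)" unfolding tpi_def by (intro ar_tp_PiI[of _ _ x]) auto
qed

section \<open>Totality and arity preservation of hereditary substitution\<close>

definition ar_subst :: "subst \<Rightarrow> (var \<rightharpoonup> arity) \<Rightarrow> (var \<rightharpoonup> arity) \<Rightarrow> bool" where
  "ar_subst \<theta> \<Theta> \<Theta>' \<longleftrightarrow> (\<forall>x \<alpha>. \<Theta> x = Some \<alpha> \<longrightarrow> (case fmlookup \<theta> x of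
     None \<Rightarrow> \<Theta>' x = Some \<alpha>
   | Some (M, \<beta>) \<Rightarrow> \<beta> = \<alpha> \<and> ar \<Theta>' M \<alpha>))"

lemma ar_subst_None: "ar_subst \<theta> \<Theta> \<Theta>' \<Longrightarrow> \<Theta> x = Some \<alpha> \<Longrightarrow> fmlookup \<theta> x = None \<Longrightarrow> \<Theta>' x = Some \<alpha>"
  unfolding ar_subst_def by force

lemma ar_subst_Some:
  "ar_subst \<theta> \<Theta> \<Theta>' \<Longrightarrow> \<Theta> x = Some \<alpha> \<Longrightarrow> fmlookup \<theta> x = Some (M, \<beta>) \<Longrightarrow> \<beta> = \<alpha> \<and> ar \<Theta>' M \<alpha>"
  unfolding ar_subst_def by force

lemma ar_subst_binder:
  assumes "ar_subst \<theta> \<Theta> \<Theta>'" "fresh_subst y \<theta>"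
  shows "ar_subst \<theta> (\<Theta>(y \<mapsto> a)) (\<Theta>'(y \<mapsto> a))"
  unfolding ar_subst_def
proof (intro allI impI)
  fix x \<alpha> assume x: "(\<Theta>(y \<mapsto> a)) x = Some \<alpha>"
  show "case fmlookup \<theta> x of None \<Rightarrow> (\<Theta>'(y \<mapsto> a)) x = Some \<alpha>
    | Some (M, \<beta>) \<Rightarrow> \<beta> = \<alpha> \<and> ar (\<Theta>'(y \<mapsto> a)) M \<alpha>"
  proof (cases "fmlookup \<theta> x")
    case None
    then show ?thesis using x ar_subst_None[OF assms(1)] by (auto split: if_splits)
  next
    case (Some p)
    then obtain M \<beta> where p: "fmlookup \<theta> x = Some (M, \<beta>)" by (cases p) auto
    then have "x \<noteq> y" "y \<notin> fv_canon M" using assms(2) by (auto simp: fresh_subst_iff)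
    then have "\<beta> = \<alpha> \<and> ar \<Theta>' M \<alpha>" using ar_subst_Some[OF assms(1) _ p] x by simp
    moreover have "ar (\<Theta>'(y \<mapsto> a)) M \<alpha>"
      by (rule ar_cong[of \<Theta>']) (use calculation \<open>y \<notin> fv_canon M\<close> in auto)
    ultimately show ?thesis using p by simp
  qed
qed

lemma ar_subst_single: "ar \<Theta> M a \<Longrightarrow> ar_subst (single x M a) (\<Theta>(x \<mapsto> a)) \<Theta>"
  by (auto simp: ar_subst_def)

definition arity_bound :: "nat \<Rightarrow> subst \<Rightarrow> bool" where
  "arity_bound n \<theta> \<longleftrightarrow> (\<forall>x M \<alpha>. fmlookup \<theta> x = Some (M, \<alpha>) \<longrightarrow> size \<alpha> \<le> n)"

lemma arity_bound_single [simp]: "arity_bound (size a) (single x M a)"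
  by (simp add: arity_bound_def)

lemma ex_arity_bound: "\<exists>n. arity_bound n \<theta>"
proof -
  \<comment> \<open>For the empty substitution \<open>Max\<close> is taken of the empty set and is
    unspecified, but then the bound holds vacuously.\<close>
  let ?S = "(\<lambda>x. size (snd (the (fmlookup \<theta> x)))) ` fmdom' \<theta>"
  have "arity_bound (Max ?S) \<theta>"
    unfolding arity_bound_def
  proof (intro allI impI)
    fix x M \<alpha> assume *: "fmlookup \<theta> x = Some (M, \<alpha>)"
    then have "size \<alpha> \<in> ?S" by (intro image_eqI[of _ _ x]) (auto intro: fmdom'I)
    then show "size \<alpha> \<le> Max ?S" by (intro Max_ge) auto
  qed
  then show ?thesis ..
qed

text \<open>The arity bound decreases at each reduction, and between reductions the term does.\<close>

lemma hs_total_bounded: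
  "(\<forall>\<Theta> M \<alpha> \<theta> \<Theta>'. ar \<Theta> M \<alpha> \<longrightarrow> arity_bound n \<theta> \<longrightarrow> ar_subst \<theta> \<Theta> \<Theta>' \<longrightarrow> (\<exists>M'. hs \<theta> M M' \<and> ar \<Theta>' M' \<alpha>)) \<and>
   (\<forall>\<Theta> R \<beta> \<theta> \<Theta>'. ar_at \<Theta> R \<beta> \<longrightarrow> arity_bound n \<theta> \<longrightarrow> ar_subst \<theta> \<Theta> \<Theta>' \<longrightarrow>
      (\<exists>R'. hs_at \<theta> R R' \<and> ar_at \<Theta>' R' \<beta>) \<or> (\<exists>M'. hs_tm \<theta> R M' \<beta> \<and> ar \<Theta>' M' \<beta> \<and> size \<beta> \<le> n))"
proof (induction n rule: less_induct)
  case (less n)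
  have "ar \<Theta> M \<alpha> \<Longrightarrow> (\<And>\<theta> \<Theta>'. arity_bound n \<theta> \<Longrightarrow> ar_subst \<theta> \<Theta> \<Theta>' \<Longrightarrow> \<exists>M'. hs \<theta> M M' \<and> ar \<Theta>' M' \<alpha>)"
    and "ar_at \<Theta> R \<beta> \<Longrightarrow> (\<And>\<theta> \<Theta>'. arity_bound n \<theta> \<Longrightarrow> ar_subst \<theta> \<Theta> \<Theta>' \<Longrightarrow>
      (\<exists>R'. hs_at \<theta> R R' \<and> ar_at \<Theta>' R' \<beta>) \<or> (\<exists>M'. hs_tm \<theta> R M' \<beta> \<and> ar \<Theta>' M' \<beta> \<and> size \<beta> \<le> n))"
    for \<Theta> M \<alpha> R \<beta>
  proof (induction rule: ar_ar_at.inducts)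
    case (ar_Atm \<Theta> R)
    then show ?case by (meson ar_ar_at.ar_Atm hs_Atm hs_Red)
  next
    case (ar_Lam L \<Theta> \<alpha> B \<beta>)
    obtain y where y: "y \<notin> L \<union> fmdom' \<theta> \<union> fv_range \<theta> \<union> fv_canon B"
      using ex_fresh[of "L \<union> fmdom' \<theta> \<union> fv_range \<theta> \<union> fv_canon B"] ar_Lam.hyps by auto
    then have fr: "fresh_subst y \<theta>" by (intro fresh_substI) auto
    then obtain M' where M': "hs \<theta> (open_canon 0 y B) M'" "ar (\<Theta>'(y \<mapsto> \<alpha>)) M' \<beta>"
      using ar_Lam.IH[of y \<theta> "\<Theta>'(y \<mapsto> \<alpha>)"] ar_subst_binder[OF ar_Lam.prems(2) fr] ar_Lam.prems y
      by blast
    have "hs \<theta> (Lam B) (lam y M')"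
      using hs_Lam[OF fr M'(1)] y by (simp add: lam_open)
    then show ?case using ar_lamI[OF M'(2)] by blast
  next
    case (ar_Const \<Theta> c \<alpha>)
    show ?case using hs_at_Const ar_ar_at.ar_Const by blast
  next
    case (ar_Var \<Theta> x \<alpha>)
    show ?case
    proof (cases "fmlookup \<theta> x")
      case None
      then have "hs_at \<theta> (FVar x) (FVar x)" by (intro hs_at_Var) (simp add: notin_fmdom'_iff)
      moreover have "ar_at \<Theta>' (FVar x) \<alpha>"
        using ar_subst_None[OF ar_Var.prems(2) ar_Var.hyps None] by (rule ar_ar_at.ar_Var)
      ultimately show ?thesis by blast
    next
      case (Some p)
      then obtain M \<beta> where p: "fmlookup \<theta> x = Some (M, \<beta>)" by (cases p) auto
      then have "size \<beta> \<le> n" using ar_Var.prems by (auto simp: arity_bound_def)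
      then show ?thesis using ar_subst_Some[OF ar_Var.prems(2) ar_Var.hyps p] p
        by (auto intro!: hs_tm_Var)
    qed
  next
    case (ar_App \<Theta> R \<alpha> \<beta> M)
    obtain N where N: "hs \<theta> M N" "ar \<Theta>' N \<alpha>" using ar_App.IH(2) ar_App.prems by blast
    from ar_App.IH(1)[OF ar_App.prems] show ?case
    proof
      assume "\<exists>R'. hs_at \<theta> R R' \<and> ar_at \<Theta>' R' (Arr \<alpha> \<beta>)"
      then show ?thesis using N by (blast intro: hs_at_App ar_ar_at.ar_App)
    next
      assume "\<exists>M'. hs_tm \<theta> R M' (Arr \<alpha> \<beta>) \<and> ar \<Theta>' M' (Arr \<alpha> \<beta>) \<and> size (Arr \<alpha> \<beta>) \<le> n"
      then obtain M' where M': "hs_tm \<theta> R M' (Arr \<alpha> \<beta>)" "ar \<Theta>' M' (Arr \<alpha> \<beta>)" "size (Arr \<alpha> \<beta>) \<le> n"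
        by blast
      then obtain B where B: "M' = Lam B" by (auto elim: ar.cases)
      obtain y where y: "y \<notin> fv_canon B" using ex_fresh[of "fv_canon B"] by auto
      \<comment> \<open>The body \<open>B\<close> is not a subterm of the application, so only the
        outer induction applies. The conjunct on \<open>size\<close> in the claim for atomic terms
        is there for this step: an arity returned by \<open>hs_tm\<close> never exceeds the bound,
        hence its argument part lies strictly below.\<close>
      have "size \<alpha> < n" using M'(3) by simp
      then obtain M'' where M'': "hs (single y N \<alpha>) (open_canon 0 y B) M''" "ar \<Theta>' M'' \<beta>"
        using less.IH ar_Lam_inv[OF M'(2)[unfolded B] y] ar_subst_single[OF N(2), of y]
          arity_bound_single by blast
      have "hs_tm \<theta> (App R M) M'' \<beta>"
        using hs_tm_App[OF _ N(1) M''(1)] M'(1) B y by (simp add: lam_open)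
      then show ?thesis using M'' M'(3) by auto
    qed
  qed
  then show ?case by blast
qed

lemma hs_total:
  assumes "ar \<Theta> M \<alpha>" "ar_subst \<theta> \<Theta> \<Theta>'"
  obtains M' where "hs \<theta> M M'" "ar \<Theta>' M' \<alpha>"
  using assms ex_arity_bound[of \<theta>] hs_total_bounded by meson

lemma hs_ar: "hs \<theta> M M' \<Longrightarrow> ar \<Theta> M \<alpha> \<Longrightarrow> ar_subst \<theta> \<Theta> \<Theta>' \<Longrightarrow> ar \<Theta>' M' \<alpha>"
  by (metis hs_total hs_functional)

text \<open>Arities of atomic terms are not unique below a constant, but a term with an
  \<open>hs_tm\<close> result has a replaced variable as head, which fixes its arity. Formally,
  totality offers two results, one excluded by disjointness and the other identified by
  functionality.\<close>

lemma hs_tm_ar: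
  assumes "hs_tm \<theta> R M' \<gamma>" "ar_at \<Theta> R \<beta>" "ar_subst \<theta> \<Theta> \<Theta>'" "arity_bound n \<theta>"
  shows "\<gamma> = \<beta> \<and> ar \<Theta>' M' \<beta> \<and> size \<beta> \<le> n"
proof -
  from hs_total_bounded[of n] assms(2-4)
  have "(\<exists>R'. hs_at \<theta> R R' \<and> ar_at \<Theta>' R' \<beta>) \<or> (\<exists>M'. hs_tm \<theta> R M' \<beta> \<and> ar \<Theta>' M' \<beta> \<and> size \<beta> \<le> n)"
    by blast
  then show ?thesis using hs_at_not_hs_tm[OF _ assms(1)] hs_tm_functional[OF assms(1)] by blast
qed

text \<open>Without a rule for a dangling \<open>BVar\<close> the identity is false for terms that
  are not locally closed; the arity derivation rules these out.\<close>

lemma hs_ident: "ar \<Theta> M \<alpha> \<Longrightarrow> fmdom' \<theta> \<inter> fv_canon M = {} \<Longrightarrow> hs \<theta> M M"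
  and hs_at_ident: "ar_at \<Theta> R \<beta> \<Longrightarrow> fmdom' \<theta> \<inter> fv_atom R = {} \<Longrightarrow> hs_at \<theta> R R"
proof (induction rule: ar_ar_at.inducts)
  case (ar_Lam L \<Theta> \<alpha> B \<beta>)
  obtain y where y: "y \<notin> L \<union> fmdom' \<theta> \<union> fv_range \<theta> \<union> fv_canon B"
    using ex_fresh[of "L \<union> fmdom' \<theta> \<union> fv_range \<theta> \<union> fv_canon B"] ar_Lam.hyps by auto
  have "fv_canon (open_canon 0 y B) \<subseteq> insert y (fv_canon B)" by (rule fv_open_canon_upper)
  then have "hs \<theta> (open_canon 0 y B) (open_canon 0 y B)"
    using y ar_Lam.prems by (intro ar_Lam.IH) auto
  then show ?case using y by (intro hs_LamI[of _ y] fresh_substI) auto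
qed (auto intro: hs_hs_at_hs_tm.intros)

lemma hs_atyp_ident: "ar_atyp \<Theta> P \<Longrightarrow> fmdom' \<theta> \<inter> fv_atyp P = {} \<Longrightarrow> hs_atyp \<theta> P P"
proof (induction P)
  case (TApp P M)
  then show ?case using hs_ident by (auto intro!: hs_TApp simp: Int_Un_distrib)
qed (auto intro: hs_atyp.intros)

lemma hs_tp_ident: "ar_tp \<Theta> A \<Longrightarrow> fmdom' \<theta> \<inter> fv_tp A = {} \<Longrightarrow> hs_tp \<theta> A A"
proof (induction rule: ar_tp.induct)
  case (ar_tp_At \<Theta> P)
  then show ?case using hs_atyp_ident by (auto intro: hs_At)
next
  case (ar_tp_Pi \<Theta> A L B)
  obtain y where y: "y \<notin> L \<union> fmdom' \<theta> \<union> fv_range \<theta> \<union> fv_tp B"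
    using ex_fresh[of "L \<union> fmdom' \<theta> \<union> fv_range \<theta> \<union> fv_tp B"] ar_tp_Pi.hyps by auto
  have "fv_tp (open_tp 0 y B) \<subseteq> insert y (fv_tp B)" by (rule fv_open_tp_upper)
  then have "hs_tp \<theta> (open_tp 0 y B) (open_tp 0 y B)"
    using y ar_tp_Pi.prems by (intro ar_tp_Pi.IH) auto
  moreover have "hs_tp \<theta> A A" using ar_tp_Pi by auto
  ultimately show ?case using y by (intro hs_PiI[of _ _ _ y] fresh_substI) auto
qed

section \<open>Composition of hereditary substitutions\<close>

text \<open>Pointwise form of: \<open>\<rho>\<close> is \<open>\<theta>\<close> followed by
  \<open>\<sigma>\<close>. Being pointwise, it can be required on the variables of an environment
  only. That [\<open>\<sigma>\<close>]\<open>M\<close> exists is part of the condition, since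
  \<open>hs\<close> is partial.\<close>

definition hs_compat :: "subst \<Rightarrow> subst \<Rightarrow> subst \<Rightarrow> var \<Rightarrow> bool" where
  "hs_compat \<theta> \<sigma> \<rho> x \<longleftrightarrow> (case fmlookup \<theta> x of
     None \<Rightarrow> fmlookup \<rho> x = fmlookup \<sigma> x
   | Some (M, \<alpha>) \<Rightarrow> \<exists>M'. hs \<sigma> M M' \<and> fmlookup \<rho> x = Some (M', \<alpha>))"

lemma hs_compat_None: "hs_compat \<theta> \<sigma> \<rho> x \<Longrightarrow> fmlookup \<theta> x = None \<Longrightarrow> fmlookup \<rho> x = fmlookup \<sigma> x"
  by (simp add: hs_compat_def)

lemma hs_compat_Some:
  "hs_compat \<theta> \<sigma> \<rho> x \<Longrightarrow> fmlookup \<theta> x = Some (M, \<alpha>) \<Longrightarrow> \<exists>M'. hs \<sigma> M M' \<and> fmlookup \<rho> x = Some (M', \<alpha>)"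
  by (simp add: hs_compat_def)

lemma hs_compat_binder:
  assumes "\<And>x. x \<in> dom \<Theta> \<Longrightarrow> hs_compat \<theta> \<sigma> \<rho> x" "y \<notin> fmdom' \<theta> \<union> fmdom' \<sigma> \<union> fmdom' \<rho>"
    "x \<in> dom (\<Theta>(y \<mapsto> a))"
  shows "hs_compat \<theta> \<sigma> \<rho> x"
  using assms by (cases "x = y") (auto simp: hs_compat_def notin_fmdom'_iff)

text \<open>The two composites through which the reduct of a redex \<open>(\<lambda>y. B) N\<close> is compared after \<open>\<sigma>\<close>.\<close>

lemma hs_compat_single_left:
  assumes "hs \<sigma> N N'" "fmlookup \<sigma> y = None"
  shows "hs_compat (single y N a) \<sigma> (fmupd y (N', a) \<sigma>) x"
  using assms by (auto simp: hs_compat_def)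

lemma hs_compat_single_right:
  assumes "ar_subst \<sigma> \<Theta> \<Theta>'" "fresh_subst y \<sigma>" "x \<in> dom (\<Theta>(y \<mapsto> a))"
  shows "hs_compat \<sigma> (single y N a) (fmupd y (N, a) \<sigma>) x"
proof (cases "x = y")
  case True
  then show ?thesis using assms by (simp add: hs_compat_def fresh_subst_iff)
next
  case False
  show ?thesis
  proof (cases "fmlookup \<sigma> x")
    case None
    then show ?thesis using False by (simp add: hs_compat_def)
  next
    case (Some p)
    then obtain M \<beta> where p: "fmlookup \<sigma> x = Some (M, \<beta>)" by (cases p) auto
    obtain \<alpha> where "\<Theta> x = Some \<alpha>" using assms(3) False by auto
    from ar_subst_Some[OF assms(1) this p] have "ar \<Theta>' M \<alpha>" by simp
    \<comment> \<open>A term that \<open>\<sigma>\<close> puts in place of \<open>x\<close> does not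
      contain \<open>y\<close>, so the later substitution for \<open>y\<close> leaves it
      alone.\<close>
    then have "hs (single y N a) M M"
      using p assms(2) by (intro hs_ident) (auto simp: fresh_subst_iff)
    then show ?thesis using False p by (simp add: hs_compat_def)
  qed
qed

text \<open>Each reduction replaces one of the two substitutions by one of smaller arity, hence the
  induction on the sum of the bounds.\<close>

lemma hs_comp_bounded:
  "\<forall>n m \<Theta> M \<alpha> \<theta> \<sigma> \<rho> \<Theta>' \<Theta>'' M1 M2. n + m = k \<longrightarrow> ar \<Theta> M \<alpha> \<longrightarrow> arity_bound n \<theta> \<longrightarrow> arity_bound m \<sigma> \<longrightarrow>
     ar_subst \<theta> \<Theta> \<Theta>' \<longrightarrow> ar_subst \<sigma> \<Theta>' \<Theta>'' \<longrightarrow> (\<forall>x\<in>dom \<Theta>. hs_compat \<theta> \<sigma> \<rho> x) \<longrightarrow>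
     hs \<theta> M M1 \<longrightarrow> hs \<sigma> M1 M2 \<longrightarrow> hs \<rho> M M2"
proof (induction k rule: less_induct)
  case (less k)
  have main: "hs \<rho> M M2"
    if "n + m < k" "ar \<Theta> M \<alpha>" "arity_bound n \<theta>" "arity_bound m \<sigma>" "ar_subst \<theta> \<Theta> \<Theta>'"
      "ar_subst \<sigma> \<Theta>' \<Theta>''" "\<And>x. x \<in> dom \<Theta> \<Longrightarrow> hs_compat \<theta> \<sigma> \<rho> x" "hs \<theta> M M1" "hs \<sigma> M1 M2"
    for n m \<Theta> M \<alpha> \<theta> \<sigma> \<rho> \<Theta>' \<Theta>'' M1 M2
    using less.IH[OF that(1)] that by blast
  \<comment> \<open>The three claims for an atomic term follow its head: untouched by both
    substitutions, replaced by \<open>\<sigma>\<close> after \<open>\<theta>\<close> has left it, or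
    replaced by \<open>\<theta>\<close>, whose result is then passed through
    \<open>\<sigma>\<close>.\<close>
  have comp: "\<lbrakk>ar \<Theta> M \<alpha>; n + m = k; arity_bound n \<theta>; arity_bound m \<sigma>; ar_subst \<theta> \<Theta> \<Theta>'; ar_subst \<sigma> \<Theta>' \<Theta>'';
      \<And>x. x \<in> dom \<Theta> \<Longrightarrow> hs_compat \<theta> \<sigma> \<rho> x; hs \<theta> M M1; hs \<sigma> M1 M2\<rbrakk> \<Longrightarrow> hs \<rho> M M2"
    and "\<lbrakk>ar_at \<Theta> R \<beta>; n + m = k; arity_bound n \<theta>; arity_bound m \<sigma>; ar_subst \<theta> \<Theta> \<Theta>'; ar_subst \<sigma> \<Theta>' \<Theta>'';
      \<And>x. x \<in> dom \<Theta> \<Longrightarrow> hs_compat \<theta> \<sigma> \<rho> x\<rbrakk> \<Longrightarrow>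
      (\<forall>R1 R2. hs_at \<theta> R R1 \<longrightarrow> hs_at \<sigma> R1 R2 \<longrightarrow> hs_at \<rho> R R2) \<and>
      (\<forall>R1 M2 b. hs_at \<theta> R R1 \<longrightarrow> hs_tm \<sigma> R1 M2 b \<longrightarrow> hs_tm \<rho> R M2 b) \<and>
      (\<forall>M1 M2 b. hs_tm \<theta> R M1 b \<longrightarrow> hs \<sigma> M1 M2 \<longrightarrow> hs_tm \<rho> R M2 b)"
    for n m \<Theta> M \<alpha> R \<beta> \<theta> \<sigma> \<rho> \<Theta>' \<Theta>'' M1 M2
  proof (induction arbitrary: \<theta> \<sigma> \<rho> \<Theta>' \<Theta>'' M1 M2 and \<theta> \<sigma> \<rho> \<Theta>' \<Theta>'' rule: ar_ar_at.inducts)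
    case (ar_Atm \<Theta> R)
    note IH = ar_Atm.IH[OF ar_Atm.prems(1-6)]
    from \<open>hs \<theta> (Atm R) M1\<close> show ?case
    proof (rule hs_AtmE)
      fix R' assume "M1 = Atm R'" "hs_at \<theta> R R'"
      from \<open>hs \<sigma> M1 M2\<close>[unfolded \<open>M1 = Atm R'\<close>] show ?thesis
        by (rule hs_AtmE) (use \<open>hs_at \<theta> R R'\<close> IH in \<open>blast intro: hs_Atm hs_Red\<close>)+
    next
      fix b assume "hs_tm \<theta> R M1 b"
      with \<open>hs \<sigma> M1 M2\<close> IH show ?thesis by (blast intro: hs_Red)
    qed
  next
    case (ar_Lam L \<Theta> \<alpha> B \<beta>)
    from \<open>hs \<theta> (Lam B) M1\<close> obtain B1 where B1: "M1 = Lam B1"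
      "\<And>y. fmlookup \<theta> y = None \<Longrightarrow> hs \<theta> (open_canon 0 y B) (open_canon 0 y B1)"
      by (rule hs_Lam_inv) blast
    from \<open>hs \<sigma> M1 M2\<close>[unfolded B1(1)] obtain B2 where B2: "M2 = Lam B2"
      "\<And>y. fmlookup \<sigma> y = None \<Longrightarrow> hs \<sigma> (open_canon 0 y B1) (open_canon 0 y B2)"
      by (rule hs_Lam_inv) blast
    let ?S = "L \<union> fmdom' \<theta> \<union> fv_range \<theta> \<union> fmdom' \<sigma> \<union> fv_range \<sigma> \<union> fmdom' \<rho> \<union> fv_range \<rho> \<union> fv_canon B \<union> fv_canon B2"
    obtain y where y: "y \<notin> ?S" using ex_fresh[of ?S] ar_Lam.hyps by auto
    then have fr: "fresh_subst y \<theta>" "fresh_subst y \<sigma>" "fresh_subst y \<rho>" by (auto intro!: fresh_substI)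
    have "hs \<rho> (open_canon 0 y B) (open_canon 0 y B2)"
    proof (rule ar_Lam.IH[of y _ _ "\<Theta>'(y \<mapsto> \<alpha>)" "\<Theta>''(y \<mapsto> \<alpha>)"])
      show "hs \<theta> (open_canon 0 y B) (open_canon 0 y B1)" "hs \<sigma> (open_canon 0 y B1) (open_canon 0 y B2)"
        using B1(2) B2(2) fr by (auto simp: fresh_subst_iff)
      show "hs_compat \<theta> \<sigma> \<rho> x" if "x \<in> dom (\<Theta>(y \<mapsto> \<alpha>))" for x
        by (rule hs_compat_binder[OF ar_Lam.prems(6) _ that]) (use y in auto)
    qed (use y ar_Lam.prems ar_subst_binder fr in blast)+
    then show ?case unfolding B2 using y fr by (intro hs_LamI[of _ y]) auto
  next
    case (ar_Const \<Theta> c \<alpha>)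
    show ?case by (auto elim!: hs_at_ConstE hs_tm_ConstE intro: hs_at_Const)
  next
    case (ar_Var \<Theta> x \<alpha>)
    have x: "hs_compat \<theta> \<sigma> \<rho> x" using ar_Var by auto
    show ?case
    proof (intro conjI allI impI)
      fix R1 R2 assume "hs_at \<theta> (FVar x) R1" "hs_at \<sigma> R1 R2"
      then have "fmlookup \<theta> x = None" "fmlookup \<sigma> x = None" "R2 = FVar x"
        by (auto elim!: hs_at_VarE simp: notin_fmdom'_iff)
      with hs_compat_None[OF x] show "hs_at \<rho> (FVar x) R2"
        by (auto intro!: hs_at_Var simp: fmlookup_dom'_iff)
    next
      fix R1 M2 b assume "hs_at \<theta> (FVar x) R1" "hs_tm \<sigma> R1 M2 b"
      then have "fmlookup \<theta> x = None" "fmlookup \<sigma> x = Some (M2, b)"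
        by (auto elim!: hs_at_VarE hs_tm_VarE simp: notin_fmdom'_iff)
      with hs_compat_None[OF x] show "hs_tm \<rho> (FVar x) M2 b"
        by (auto intro!: hs_tm_Var)
    next
      fix M1 M2 b assume "hs_tm \<theta> (FVar x) M1 b" "hs \<sigma> M1 M2"
      then have "fmlookup \<theta> x = Some (M1, b)" by (auto elim!: hs_tm_VarE)
      from hs_compat_Some[OF x this] \<open>hs \<sigma> M1 M2\<close> hs_functional show "hs_tm \<rho> (FVar x) M2 b"
        by (blast intro: hs_tm_Var)
    qed
  next
    case (ar_App \<Theta> R \<alpha> \<beta> N)
    note R = ar_App.IH(1)[OF ar_App.prems] and N = ar_App.IH(2)[OF ar_App.prems]
    show ?case
    proof (intro conjI allI impI)
      fix R1 R2 assume "hs_at \<theta> (App R N) R1" "hs_at \<sigma> R1 R2"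
      then show "hs_at \<rho> (App R N) R2"
        using R N by (elim hs_at_AppE) (blast intro: hs_at_App elim: hs_at_AppE)
    next
      fix R1 M2 b assume "hs_at \<theta> (App R N) R1" "hs_tm \<sigma> R1 M2 b"
      then show "hs_tm \<rho> (App R N) M2 b"
        using R N by (elim hs_at_AppE) (blast intro: hs_tm_App elim: hs_tm_AppE)
    next
      fix M1 M2 b assume "hs_tm \<theta> (App R N) M1 b" and M2: "hs \<sigma> M1 M2"
      then obtain x B0 a N1 where tm: "hs_tm \<theta> R (lam x B0) (Arr a b)" and N1: "hs \<theta> N N1"
        and M1: "hs (single x N1 a) B0 M1"
        by (elim hs_tm_AppE) blast
      define B where "B = close_canon 0 x B0"
      have tm: "hs_tm \<theta> R (Lam B) (Arr a b)" using tm by (simp add: B_def lam_def)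
      \<comment> \<open>The arities used by the reduction are those of the arity derivation, so the
        reduction takes place at an arity below \<open>n\<close>.\<close>
      from hs_tm_ar[OF tm ar_App.hyps(1) ar_App.prems(4,2)]
      have ab: "a = \<alpha>" "b = \<beta>" and arB: "ar \<Theta>' (Lam B) (Arr \<alpha> \<beta>)" and sz: "size (Arr \<alpha> \<beta>) \<le> n"
        by auto
      have arN1: "ar \<Theta>' N1 \<alpha>" by (rule hs_ar[OF N1 ar_App.hyps(2) ar_App.prems(4)])
      obtain N2 where N2: "hs \<sigma> N1 N2" "ar \<Theta>'' N2 \<alpha>"
        using hs_total[OF arN1 ar_App.prems(5)] by blast
      obtain X where X: "hs \<sigma> (Lam B) X" "ar \<Theta>'' X (Arr \<alpha> \<beta>)"
        using hs_total[OF arB ar_App.prems(5)] by blast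
      from X(1) obtain B2 where B2: "X = Lam B2"
        "\<And>y. fmlookup \<sigma> y = None \<Longrightarrow> hs \<sigma> (open_canon 0 y B) (open_canon 0 y B2)"
        by (rule hs_Lam_inv) blast
      let ?S = "fmdom' \<sigma> \<union> fv_range \<sigma> \<union> fv_canon B \<union> fv_canon B2"
      obtain y where y: "y \<notin> ?S" using ex_fresh[of ?S] by auto
      then have fr: "fresh_subst y \<sigma>" by (auto intro!: fresh_substI)
      have oB: "hs \<sigma> (open_canon 0 y B) (open_canon 0 y B2)"
        using B2(2) fr by (auto simp: fresh_subst_iff)
      have arB': "ar (\<Theta>'(y \<mapsto> \<alpha>)) (open_canon 0 y B) \<beta>" using ar_Lam_inv[OF arB] y by simp
      have arB2: "ar (\<Theta>''(y \<mapsto> \<alpha>)) (open_canon 0 y B2) \<beta>"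
        using ar_Lam_inv[OF X(2)[unfolded B2(1)]] y by simp
      \<comment> \<open>\<open>M2\<close> comes from reducing and then applying
        \<open>\<sigma>\<close>; \<open>M3\<close> comes from applying \<open>\<sigma>\<close> to
        function and argument and then reducing. Its existence is an instance of totality.\<close>
      obtain M3 where M3: "hs (single y N2 \<alpha>) (open_canon 0 y B2) M3"
        using hs_total[OF arB2 ar_subst_single[OF N2(2)]] by blast
      let ?\<rho> = "fmupd y (N2, \<alpha>) \<sigma>"
      have oM1: "hs (single y N1 \<alpha>) (open_canon 0 y B) M1"
        using hs_single_alpha[OF _ M1, of y "open_canon 0 y B"] y ab by (simp add: B_def)
      have "hs ?\<rho> (open_canon 0 y B) M2"
      proof (rule main[OF _ arB' arity_bound_single ar_App.prems(3) ar_subst_single[OF arN1] ar_App.prems(5) _ oM1 M2])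
        show "size \<alpha> + m < k" using sz ar_App.prems(1) by simp
        show "hs_compat (single y N1 \<alpha>) \<sigma> ?\<rho> x" for x
          using fr by (intro hs_compat_single_left[OF N2(1)]) (simp add: fresh_subst_iff)
      qed
      \<comment> \<open>Now \<open>\<sigma>\<close> acts first, so its bound \<open>m\<close> takes
        the first place. Neither lexicographic order on the pair (\<open>n\<close>,
        \<open>m\<close>) need decrease in both uses, but the sum does.\<close>
      moreover have "hs ?\<rho> (open_canon 0 y B) M3"
      proof (rule main[OF _ arB' ar_App.prems(3) arity_bound_single ar_subst_binder[OF ar_App.prems(5) fr]
            ar_subst_single[OF N2(2)] _ oB M3])
        show "m + size \<alpha> < k" using sz ar_App.prems(1) by simp
        show "hs_compat \<sigma> (single y N2 \<alpha>) ?\<rho> x" if "x \<in> dom (\<Theta>'(y \<mapsto> \<alpha>))" for x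
          by (rule hs_compat_single_right[OF ar_App.prems(5) fr that])
      qed
      ultimately have "M3 = M2" by (rule hs_functional[symmetric])
      have "hs_tm \<rho> R (lam y (open_canon 0 y B2)) (Arr \<alpha> \<beta>)"
        using R tm X(1) B2(1) y ab by (auto simp: lam_open)
      moreover have "hs \<rho> N N2" using N N1 N2(1) by blast
      ultimately show "hs_tm \<rho> (App R N) M2 b"
        using hs_tm_App M3 \<open>M3 = M2\<close> ab by blast
    qed
  qed
  show ?case by (intro allI impI, rule comp) (assumption | blast)+
qed

lemma hs_comp:
  assumes "hs \<theta> M M1" "hs \<sigma> M1 M2" "ar \<Theta> M \<alpha>" "ar_subst \<theta> \<Theta> \<Theta>'" "ar_subst \<sigma> \<Theta>' \<Theta>''"
    "\<And>x. x \<in> dom \<Theta> \<Longrightarrow> hs_compat \<theta> \<sigma> \<rho> x"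
  shows "hs \<rho> M M2"
proof -
  obtain n m where "arity_bound n \<theta>" "arity_bound m \<sigma>" using ex_arity_bound by blast
  then show ?thesis using hs_comp_bounded[rule_format, OF refl] assms by blast
qed

section \<open>Composition and totality for types, with two laws for a single argument\<close>

lemma hs_atyp_comp:
  assumes "ar_subst \<theta> \<Theta> \<Theta>'" "ar_subst \<sigma> \<Theta>' \<Theta>''" "\<And>x. x \<in> dom \<Theta> \<Longrightarrow> hs_compat \<theta> \<sigma> \<rho> x"
  shows "ar_atyp \<Theta> P \<Longrightarrow> hs_atyp \<theta> P P1 \<Longrightarrow> hs_atyp \<sigma> P1 P2 \<Longrightarrow> hs_atyp \<rho> P P2"
proof (induction P arbitrary: P1 P2)
  case (TConst a)
  then show ?case by (auto elim!: hs_TConstE intro: hs_TConst)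
next
  case (TApp P M)
  from TApp.prems(1) obtain \<alpha> where \<alpha>: "ar_atyp \<Theta> P" "ar \<Theta> M \<alpha>" by auto
  from TApp.prems(2) obtain P' M' where 1: "P1 = TApp P' M'" "hs_atyp \<theta> P P'" "hs \<theta> M M'"
    by (rule hs_TAppE)
  from TApp.prems(3)[unfolded 1(1)] obtain P'' M'' where
    2: "P2 = TApp P'' M''" "hs_atyp \<sigma> P' P''" "hs \<sigma> M' M''"
    by (rule hs_TAppE)
  have "hs_atyp \<rho> P P''" by (rule TApp.IH[OF \<alpha>(1) 1(2) 2(2)])
  moreover have "hs \<rho> M M''" by (rule hs_comp[OF 1(3) 2(3) \<alpha>(2) assms])
  ultimately show ?case unfolding 2(1) by (rule hs_TApp)
qed

lemma hs_tp_comp: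
  assumes "ar_tp \<Theta> A" "hs_tp \<theta> A A1" "hs_tp \<sigma> A1 A2"
    "ar_subst \<theta> \<Theta> \<Theta>'" "ar_subst \<sigma> \<Theta>' \<Theta>''" "\<And>x. x \<in> dom \<Theta> \<Longrightarrow> hs_compat \<theta> \<sigma> \<rho> x"
  shows "hs_tp \<rho> A A2"
  using assms
proof (induction arbitrary: \<Theta>' \<Theta>'' A1 A2 rule: ar_tp.induct)
  case (ar_tp_At \<Theta> P)
  from \<open>hs_tp \<theta> (At P) A1\<close> obtain P1 where 1: "A1 = At P1" "hs_atyp \<theta> P P1" by (auto elim!: hs_AtE)
  from \<open>hs_tp \<sigma> A1 A2\<close>[unfolded 1(1)] obtain P2 where 2: "A2 = At P2" "hs_atyp \<sigma> P1 P2"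
    by (auto elim!: hs_AtE)
  show ?case unfolding 2(1)
    by (intro hs_At hs_atyp_comp[OF ar_tp_At.prems(3-5) ar_tp_At.hyps 1(2) 2(2)])
next
  case (ar_tp_Pi \<Theta> A L B)
  from \<open>hs_tp \<theta> (Pi A B) A1\<close> obtain A' B' where 1: "A1 = Pi A' B'" "hs_tp \<theta> A A'"
    "\<And>y. fmlookup \<theta> y = None \<Longrightarrow> hs_tp \<theta> (open_tp 0 y B) (open_tp 0 y B')"
    by (rule hs_Pi_inv) blast
  from \<open>hs_tp \<sigma> A1 A2\<close>[unfolded 1(1)] obtain A'' B'' where 2: "A2 = Pi A'' B''" "hs_tp \<sigma> A' A''"
    "\<And>y. fmlookup \<sigma> y = None \<Longrightarrow> hs_tp \<sigma> (open_tp 0 y B') (open_tp 0 y B'')"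
    by (rule hs_Pi_inv) blast
  let ?S = "L \<union> fmdom' \<theta> \<union> fv_range \<theta> \<union> fmdom' \<sigma> \<union> fv_range \<sigma> \<union> fmdom' \<rho> \<union> fv_range \<rho> \<union> fv_tp B \<union> fv_tp B''"
  obtain y where y: "y \<notin> ?S" using ex_fresh[of ?S] ar_tp_Pi.hyps by auto
  then have fr: "fresh_subst y \<theta>" "fresh_subst y \<sigma>" "fresh_subst y \<rho>" by (auto intro!: fresh_substI)
  have "hs_tp \<rho> (open_tp 0 y B) (open_tp 0 y B'')"
  proof (rule ar_tp_Pi.IH(2)[of y _ _ "\<Theta>'(y \<mapsto> erase A)" "\<Theta>''(y \<mapsto> erase A)"])
    show "hs_tp \<theta> (open_tp 0 y B) (open_tp 0 y B')" "hs_tp \<sigma> (open_tp 0 y B') (open_tp 0 y B'')"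
      using 1(3) 2(3) fr by (auto simp: fresh_subst_iff)
    show "hs_compat \<theta> \<sigma> \<rho> x" if "x \<in> dom (\<Theta>(y \<mapsto> erase A))" for x
      by (rule hs_compat_binder[OF ar_tp_Pi.prems(5) _ that]) (use y in auto)
  qed (use y ar_tp_Pi.prems ar_subst_binder fr in blast)+
  moreover have "hs_tp \<rho> A A''" by (rule ar_tp_Pi.IH(1)[OF 1(2) 2(2) ar_tp_Pi.prems(3-5)])
  ultimately show ?case unfolding 2(1) using y fr by (intro hs_PiI[of _ _ _ y]) auto
qed

lemma hs_tp_erase: "hs_tp \<theta> A A' \<Longrightarrow> erase A' = erase A"
  by (induction rule: hs_tp.induct) (auto simp: tpi_def)

lemma hs_atyp_total: "ar_atyp \<Theta> P \<Longrightarrow> ar_subst \<theta> \<Theta> \<Theta>' \<Longrightarrow> \<exists>P'. hs_atyp \<theta> P P' \<and> ar_atyp \<Theta>' P'"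
proof (induction P)
  case (TConst a)
  then show ?case by (intro exI[of _ "TConst a"]) (auto intro: hs_TConst)
next
  case (TApp P M)
  from TApp obtain P' where P': "hs_atyp \<theta> P P'" "ar_atyp \<Theta>' P'" by auto
  from TApp.prems(1) obtain \<alpha> where "ar \<Theta> M \<alpha>" by auto
  from hs_total[OF this TApp.prems(2)] obtain M' where "hs \<theta> M M'" "ar \<Theta>' M' \<alpha>" by blast
  with P' show ?case by (intro exI[of _ "TApp P' M'"]) (auto intro: hs_TApp)
qed

lemma hs_tp_total_ex: "ar_tp \<Theta> A \<Longrightarrow> ar_subst \<theta> \<Theta> \<Theta>' \<Longrightarrow> \<exists>A'. hs_tp \<theta> A A' \<and> ar_tp \<Theta>' A'"
proof (induction arbitrary: \<Theta>' rule: ar_tp.induct)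
  case (ar_tp_At \<Theta> P)
  then show ?case using hs_atyp_total by (meson hs_At ar_tp.ar_tp_At)
next
  case (ar_tp_Pi \<Theta> A L B)
  let ?S = "L \<union> fmdom' \<theta> \<union> fv_range \<theta> \<union> fv_tp B"
  obtain y where y: "y \<notin> ?S" using ex_fresh[of ?S] ar_tp_Pi.hyps by auto
  then have fr: "fresh_subst y \<theta>" by (intro fresh_substI) auto
  obtain A' where A': "hs_tp \<theta> A A'" "ar_tp \<Theta>' A'" using ar_tp_Pi by blast
  obtain B' where B': "hs_tp \<theta> (open_tp 0 y B) B'" "ar_tp (\<Theta>'(y \<mapsto> erase A)) B'"
    using ar_tp_Pi.IH(2)[of y "\<Theta>'(y \<mapsto> erase A)"] ar_subst_binder[OF ar_tp_Pi.prems fr] y by blast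
  have "hs_tp \<theta> (Pi A B) (tpi y A' B')"
    using hs_tp.hs_Pi[OF fr A'(1) B'(1)] y by (simp add: tpi_open)
  moreover have "ar_tp \<Theta>' (tpi y A' B')" using A' B'(2) hs_tp_erase[OF A'(1)] by (simp add: ar_tp_tpi)
  ultimately show ?case by blast
qed

lemma hs_tp_total:
  assumes "ar_tp \<Theta> A" "ar_subst \<theta> \<Theta> \<Theta>'"
  obtains A' where "hs_tp \<theta> A A'" "ar_tp \<Theta>' A'"
  using hs_tp_total_ex[OF assms] by blast

lemma hs_tp_ar: "hs_tp \<theta> A A' \<Longrightarrow> ar_tp \<Theta> A \<Longrightarrow> ar_subst \<theta> \<Theta> \<Theta>' \<Longrightarrow> ar_tp \<Theta>' A'"
  by (metis hs_tp_total hs_tp_functional)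

text \<open>The step of a spine: one more argument after \<open>\<theta>\<close> amounts to one more
  triple in the simultaneous substitution.\<close>

lemma hs_tp_extend:
  assumes "ar_tp (\<Theta>(y \<mapsto> a)) B" "ar_subst \<theta> \<Theta> \<Theta>'" "fresh_subst y \<theta>" "ar \<Theta>' N a"
    "hs_tp \<theta> B B'" "hs_tp (single y N a) B' C"
  shows "hs_tp (fmupd y (N, a) \<theta>) B C"
  by (rule hs_tp_comp[OF assms(1,5,6) ar_subst_binder[OF assms(2,3)] ar_subst_single[OF assms(4)]
        hs_compat_single_right[OF assms(2,3)]])

text \<open>The usual law
  [\<open>\<theta>\<close>][\<open>N\<close>/\<open>y\<close>]\<open>B\<close> =
  [[\<open>\<theta>\<close>]\<open>N\<close>/\<open>y\<close>][\<open>\<theta>\<close>]\<open>B\<close>.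
  Both sides equal the result of \<open>\<theta>\<close> extended by \<open>N'\<close> at
  \<open>y\<close>; totality makes the right side exist and functionality identifies the
  two.\<close>

lemma hs_tp_commute:
  assumes "ar_tp (\<Theta>(y \<mapsto> a)) B" "ar_subst \<theta> \<Theta> \<Theta>'" "fresh_subst y \<theta>" "ar \<Theta> N a"
    "hs \<theta> N N'" "hs_tp (single y N a) B B1" "hs_tp \<theta> B1 C" "hs_tp \<theta> B B2"
  shows "hs_tp (single y N' a) B2 C"
proof -
  have N': "ar \<Theta>' N' a" by (rule hs_ar[OF assms(5,4,2)])
  have B2: "ar_tp (\<Theta>'(y \<mapsto> a)) B2" by (rule hs_tp_ar[OF assms(8,1) ar_subst_binder[OF assms(2,3)]])
  obtain C' where C': "hs_tp (single y N' a) B2 C'"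
    using hs_tp_total[OF B2 ar_subst_single[OF N']] by blast
  have "hs_tp (fmupd y (N', a) \<theta>) B C"
    using assms(3)
    by (intro hs_tp_comp[OF assms(1,6,7) ar_subst_single[OF assms(4)] assms(2)]
        hs_compat_single_left[OF assms(5)]) (simp add: fresh_subst_iff)
  moreover have "hs_tp (fmupd y (N', a) \<theta>) B C'"
    by (rule hs_tp_extend[OF assms(1-3) N' assms(8) C'])
  ultimately show ?thesis using C' hs_tp_functional by blast
qed

section \<open>Arities and renaming in the LF judgements\<close>

text \<open>Inductions over typed terms run along local closure rather than along an arity derivation, whose
  arities below a constant need not be those of the typing derivation.\<close>

inductive lc :: "canon \<Rightarrow> bool" and lc_at :: "atom \<Rightarrow> bool" where
  lc_Atm: "lc_at R \<Longrightarrow> lc (Atm R)"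
| lc_Lam: "finite L \<Longrightarrow> (\<And>x. x \<notin> L \<Longrightarrow> lc (open_canon 0 x B)) \<Longrightarrow> lc (Lam B)"
| lc_Const: "lc_at (Const c)"
| lc_Var: "lc_at (FVar x)"
| lc_App: "lc_at R \<Longrightarrow> lc M \<Longrightarrow> lc_at (App R M)"

lemma ar_lc: "ar \<Theta> M \<alpha> \<Longrightarrow> lc M" and ar_at_lc: "ar_at \<Theta> R \<beta> \<Longrightarrow> lc_at R"
  by (induction rule: ar_ar_at.inducts) (auto intro: lc_lc_at.intros)

definition ctx_ar :: "ctx \<Rightarrow> (var \<rightharpoonup> arity)" where
  "ctx_ar \<Gamma> = map_of (map (\<lambda>(x, A). (x, erase A)) \<Gamma>)"

lemma ctx_ar_Nil [simp]: "ctx_ar [] = Map.empty"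
  by (simp add: ctx_ar_def)

lemma ctx_ar_Cons [simp]: "ctx_ar ((x, A) # \<Gamma>) = (ctx_ar \<Gamma>)(x \<mapsto> erase A)"
  by (simp add: ctx_ar_def)

lemma dom_ctx_ar: "dom (ctx_ar \<Gamma>) = fst ` set \<Gamma>"
  by (force simp: ctx_ar_def dom_map_of_conv_image_fst image_image)

text \<open>Each type is read in the whole context rather than in the entries before it. This makes
  the notion independent of order, so that weakening can be phrased as inclusion of sets.\<close>

definition ar_ctx :: "ctx \<Rightarrow> bool" where
  "ar_ctx \<Gamma> \<longleftrightarrow> distinct (map fst \<Gamma>) \<and> (\<forall>(x, A) \<in> set \<Gamma>. ar_tp (ctx_ar \<Gamma>) A)"

lemma ar_ctx_lookup: "ar_ctx \<Gamma> \<Longrightarrow> (x, A) \<in> set \<Gamma> \<Longrightarrow> ctx_ar \<Gamma> x = Some (erase A) \<and> ar_tp (ctx_ar \<Gamma>) A"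
  unfolding ar_ctx_def ctx_ar_def
  by (auto intro!: map_of_is_SomeI simp: distinct_map inj_on_def image_iff) (force+)?

lemma fresh_ctx_fv: "fresh_ctx y \<Gamma> \<Longrightarrow> ar_tp (ctx_ar \<Gamma>) A \<Longrightarrow> y \<notin> fv_tp A"
  using ar_tp_fv dom_ctx_ar by blast

lemma ar_ctx_Cons:
  assumes "ar_ctx \<Gamma>" "fresh_ctx x \<Gamma>" "ar_tp (ctx_ar \<Gamma>) A"
  shows "ar_ctx ((x, A) # \<Gamma>)"
proof -
  have "ar_tp ((ctx_ar \<Gamma>)(x \<mapsto> erase A)) B" if "ar_tp (ctx_ar \<Gamma>) B" for B
    by (rule ar_tp_cong[OF that]) (use fresh_ctx_fv[OF assms(2) that] in auto)
  then show ?thesis using assms unfolding ar_ctx_def by auto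
qed

definition ar_sig :: "sign \<Rightarrow> bool" where
  "ar_sig \<Sigma> \<longleftrightarrow> (\<forall>c A. ObjDecl c A \<in> set \<Sigma> \<longrightarrow> ar_tp Map.empty A) \<and>
    (\<forall>a K. TypDecl a K \<in> set \<Sigma> \<longrightarrow> ar_kind Map.empty K)"

lemma ar_tp_closed: "ar_tp Map.empty A \<Longrightarrow> fv_tp A = {} \<and> ar_tp \<Theta> A"
  using ar_tp_fv[of Map.empty A] ar_tp_cong[of Map.empty A \<Theta>] by auto

lemma hs_kind_ar: "hs_kind \<theta> K K' \<Longrightarrow> ar_kind \<Theta> K \<Longrightarrow> ar_subst \<theta> \<Theta> \<Theta>' \<Longrightarrow> ar_kind \<Theta>' K'"
  by (auto simp: hs_kind_iff intro: hs_tp_ar)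

text \<open>Checking assumes that the type is arity-correct and synthesis delivers it, following the
  flow of types through the rules.\<close>

lemma atyp_syn_ar: "atyp_syn \<Sigma> \<Gamma> P K \<Longrightarrow> ar_sig \<Sigma> \<Longrightarrow> ar_ctx \<Gamma> \<Longrightarrow> ar_atyp (ctx_ar \<Gamma>) P \<and> ar_kind (ctx_ar \<Gamma>) K"
  and check_ar: "check \<Sigma> \<Gamma> M A \<Longrightarrow> ar_sig \<Sigma> \<Longrightarrow> ar_ctx \<Gamma> \<Longrightarrow> ar_tp (ctx_ar \<Gamma>) A \<Longrightarrow> ar (ctx_ar \<Gamma>) M (erase A)"
  and synth_ar: "synth \<Sigma> \<Gamma> R A \<Longrightarrow> ar_sig \<Sigma> \<Longrightarrow> ar_ctx \<Gamma> \<Longrightarrow>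
    ar_at (ctx_ar \<Gamma>) R (erase A) \<and> ar_tp (ctx_ar \<Gamma>) A"
proof (induction rule: atyp_syn_check_synth.inducts)
  case (atyp_syn_Const a K \<Gamma>)
  then show ?case using ar_tp_closed by (auto simp: ar_sig_def)
next
  case (atyp_syn_App \<Gamma> P x A K\<^sub>1 M K)
  then have "ar_tp (ctx_ar \<Gamma>) A" "ar_kind ((ctx_ar \<Gamma>)(x \<mapsto> erase A)) K\<^sub>1"
    by (auto simp: kind_tp_kpi ar_tp_tpi)
  with atyp_syn_App have "ar (ctx_ar \<Gamma>) M (erase A)" by simp
  with atyp_syn_App \<open>ar_kind ((ctx_ar \<Gamma>)(x \<mapsto> erase A)) K\<^sub>1\<close> show ?case
    by (auto intro: hs_kind_ar ar_subst_single)
next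
  case (check_Atm \<Gamma> R P)
  then show ?case by (auto intro: ar_Atm)
next
  case (check_Lam x \<Gamma> A\<^sub>1 M A\<^sub>2)
  then have "ar_tp (ctx_ar \<Gamma>) A\<^sub>1" "ar_tp ((ctx_ar \<Gamma>)(x \<mapsto> erase A\<^sub>1)) A\<^sub>2" by (auto simp: ar_tp_tpi)
  with check_Lam have "ar ((ctx_ar \<Gamma>)(x \<mapsto> erase A\<^sub>1)) M (erase A\<^sub>2)"
    by (auto intro: ar_ctx_Cons simp: fun_upd_def)
  then show ?case by (simp add: tpi_def ar_lamI)
next
  case (synth_Var x A \<Gamma>)
  then show ?case using ar_ctx_lookup by (blast intro: ar_Var)
next
  case (synth_Const c A \<Gamma>)
  then show ?case using ar_tp_closed by (auto simp: ar_sig_def intro: ar_Const)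
next
  case (synth_App \<Gamma> R x A\<^sub>1 A\<^sub>2 M A)
  then have A: "ar_tp (ctx_ar \<Gamma>) A\<^sub>1" "ar_tp ((ctx_ar \<Gamma>)(x \<mapsto> erase A\<^sub>1)) A\<^sub>2"
    and R: "ar_at (ctx_ar \<Gamma>) R (Arr (erase A\<^sub>1) (erase A\<^sub>2))"
    by (auto simp: ar_tp_tpi) (simp add: tpi_def)
  with synth_App have M: "ar (ctx_ar \<Gamma>) M (erase A\<^sub>1)" by simp
  have "ar_tp (ctx_ar \<Gamma>) A" by (rule hs_tp_ar[OF synth_App.hyps A(2) ar_subst_single[OF M]])
  moreover have "ar_at (ctx_ar \<Gamma>) (App R M) (erase A)"
    using ar_App[OF R M] hs_tp_erase[OF synth_App.hyps] by simp
  ultimately show ?case by blast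
qed

lemma tp_wf_ar: "tp_wf \<Sigma> \<Gamma> A \<Longrightarrow> ar_sig \<Sigma> \<Longrightarrow> ar_ctx \<Gamma> \<Longrightarrow> ar_tp (ctx_ar \<Gamma>) A"
proof (induction rule: tp_wf.induct)
  case (tp_wf_At \<Gamma> P)
  then show ?case using atyp_syn_ar by (blast intro: ar_tp_At)
next
  case (tp_wf_Pi \<Gamma> A\<^sub>1 x A\<^sub>2)
  then show ?case using ar_ctx_Cons by (fastforce simp: ar_tp_tpi)
qed

lemma kind_wf_ar: "kind_wf \<Sigma> \<Gamma> K \<Longrightarrow> ar_sig \<Sigma> \<Longrightarrow> ar_ctx \<Gamma> \<Longrightarrow> ar_kind (ctx_ar \<Gamma>) K"
proof (induction rule: kind_wf.induct)
  case (kind_wf_Type \<Gamma>)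
  then show ?case by (auto intro: ar_tp_At)
next
  case (kind_wf_Pi \<Gamma> A x K)
  then show ?case using ar_ctx_Cons tp_wf_ar by (fastforce simp: kind_tp_kpi ar_tp_tpi)
qed

lemma ctx_wf_ar: "ctx_wf \<Sigma> \<Gamma> \<Longrightarrow> ar_sig \<Sigma> \<Longrightarrow> ar_ctx \<Gamma>"
proof (induction rule: ctx_wf.induct)
  case ctx_wf_Nil
  then show ?case by (simp add: ar_ctx_def)
next
  case (ctx_wf_Cons \<Gamma> A x)
  then show ?case by (auto intro: ar_ctx_Cons tp_wf_ar)
qed

lemma sig_wf_ar: "sig_wf \<Sigma> \<Longrightarrow> ar_sig \<Sigma>"
proof (induction rule: sig_wf.induct)
  case sig_wf_Nil
  then show ?case by (simp add: ar_sig_def)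
next
  case (sig_wf_Obj \<Sigma> c A)
  have "ar_ctx []" by (simp add: ar_ctx_def)
  with sig_wf_Obj have "ar_tp Map.empty A" using tp_wf_ar by fastforce
  with sig_wf_Obj show ?case by (auto simp: ar_sig_def)
next
  case (sig_wf_Typ \<Sigma> a K)
  have "ar_ctx []" by (simp add: ar_ctx_def)
  with sig_wf_Typ have "ar_kind Map.empty K" using kind_wf_ar by fastforce
  with sig_wf_Typ show ?case by (auto simp: ar_sig_def)
qed

section \<open>Injective renaming of the LF judgements, and inversion at a fresh name\<close>

definition ren_ctx :: "(var \<Rightarrow> var) \<Rightarrow> ctx \<Rightarrow> ctx" where
  "ren_ctx f \<Gamma> = map (\<lambda>(x, A). (f x, ren_tp f A)) \<Gamma>"

lemma ren_ctx_Cons [simp]: "ren_ctx f ((x, A) # \<Gamma>) = (f x, ren_tp f A) # ren_ctx f \<Gamma>"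
  by (simp add: ren_ctx_def)

lemma fresh_ren_ctx: "inj f \<Longrightarrow> fresh_ctx x \<Gamma> \<Longrightarrow> fresh_ctx (f x) (ren_ctx f \<Gamma>)"
  by (force simp: ren_ctx_def inj_def)

lemma ren_lam_inj: "inj f \<Longrightarrow> ren_canon f (lam x M) = lam (f x) (ren_canon f M)"
  using ren_lam[of M x f "f x"] by (simp add: inj_eq)

lemma ren_tpi_inj: "inj f \<Longrightarrow> ren_tp f (tpi x A B) = tpi (f x) (ren_tp f A) (ren_tp f B)"
  using ren_tpi[of B x f "f x" A] by (simp add: inj_eq)

lemma ren_kpi_inj: "inj f \<Longrightarrow> ren_kind f (kpi x A K) = kpi (f x) (ren_tp f A) (ren_kind f K)"
  by (subst kind_tp_inject[symmetric]) (simp add: kind_tp_kpi ren_tpi_inj)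

lemma ren_compat_single: "inj f \<Longrightarrow> ren_compat f f (single x M a) (single (f x) (ren_canon f M) a) z"
  by (simp add: ren_compat_def inj_eq)

lemma ren_tp_closed: "ar_tp Map.empty A \<Longrightarrow> ren_tp f A = A"
  using ar_tp_closed by (intro ren_tp_id) blast

text \<open>In contrast to \<open>hs_ren\<close> the renaming is injective, so that fresh binders
  stay fresh for the renamed context. Declared types and kinds are closed by \<open>ar_sig\<close>,
  hence unchanged.\<close>

lemma atyp_syn_ren: "atyp_syn \<Sigma> \<Gamma> P K \<Longrightarrow> ar_sig \<Sigma> \<Longrightarrow> inj f \<Longrightarrow> atyp_syn \<Sigma> (ren_ctx f \<Gamma>) (ren_atyp f P) (ren_kind f K)"
  and check_ren: "check \<Sigma> \<Gamma> M A \<Longrightarrow> ar_sig \<Sigma> \<Longrightarrow> inj f \<Longrightarrow> check \<Sigma> (ren_ctx f \<Gamma>) (ren_canon f M) (ren_tp f A)"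
  and synth_ren: "synth \<Sigma> \<Gamma> R A \<Longrightarrow> ar_sig \<Sigma> \<Longrightarrow> inj f \<Longrightarrow> synth \<Sigma> (ren_ctx f \<Gamma>) (ren_atom f R) (ren_tp f A)"
proof (induction rule: atyp_syn_check_synth.inducts)
  case (atyp_syn_Const a K \<Gamma>)
  then have "ren_kind f K = K"
    by (subst kind_tp_inject[symmetric]) (auto simp: ar_sig_def ren_tp_closed)
  then show ?case using atyp_syn_Const by (auto intro: atyp_syn_check_synth.atyp_syn_Const)
next
  case (atyp_syn_App \<Gamma> P x A K\<^sub>1 M K)
  have "hs_kind (single (f x) (ren_canon f M) (erase (ren_tp f A))) (ren_kind f K\<^sub>1) (ren_kind f K)"
    using atyp_syn_App.hyps hs_tp_ren[OF _ ren_compat_single[OF atyp_syn_App.prems(2)]] by (simp add: hs_kind_iff)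
  then show ?case using atyp_syn_App
    by (auto intro: atyp_syn_check_synth.atyp_syn_App simp: ren_kpi_inj)
next
  case (check_Atm \<Gamma> R P)
  then show ?case by (auto intro: atyp_syn_check_synth.check_Atm)
next
  case (check_Lam x \<Gamma> A\<^sub>1 M A\<^sub>2)
  then show ?case
    by (simp add: ren_lam_inj ren_tpi_inj atyp_syn_check_synth.check_Lam fresh_ren_ctx)
next
  case (synth_Var x A \<Gamma>)
  then show ?case by (force intro!: atyp_syn_check_synth.synth_Var simp: ren_ctx_def)
next
  case (synth_Const c A \<Gamma>)
  then have "ren_tp f A = A" by (auto simp: ar_sig_def ren_tp_closed)
  then show ?case using synth_Const by (auto intro: atyp_syn_check_synth.synth_Const)
next
  case (synth_App \<Gamma> R x A\<^sub>1 A\<^sub>2 M A)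
  have "hs_tp (single (f x) (ren_canon f M) (erase (ren_tp f A\<^sub>1))) (ren_tp f A\<^sub>2) (ren_tp f A)"
    using synth_App.hyps hs_tp_ren[OF _ ren_compat_single[OF synth_App.prems(2)]] by simp
  then show ?case using synth_App
    by (auto intro: atyp_syn_check_synth.synth_App simp: ren_tpi_inj)
qed

lemma tp_wf_ren: "tp_wf \<Sigma> \<Gamma> A \<Longrightarrow> ar_sig \<Sigma> \<Longrightarrow> inj f \<Longrightarrow> tp_wf \<Sigma> (ren_ctx f \<Gamma>) (ren_tp f A)"
proof (induction rule: tp_wf.induct)
  case (tp_wf_At \<Gamma> P)
  then show ?case using atyp_syn_ren[of \<Sigma> \<Gamma> P KType f] by (auto intro: tp_wf.tp_wf_At)
next
  case (tp_wf_Pi \<Gamma> A\<^sub>1 x A\<^sub>2)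
  then show ?case by (simp add: ren_tpi_inj tp_wf.tp_wf_Pi fresh_ren_ctx)
qed

lemma kind_wf_ren: "kind_wf \<Sigma> \<Gamma> K \<Longrightarrow> ar_sig \<Sigma> \<Longrightarrow> inj f \<Longrightarrow> kind_wf \<Sigma> (ren_ctx f \<Gamma>) (ren_kind f K)"
proof (induction rule: kind_wf.induct)
  case (kind_wf_Type \<Gamma>)
  then show ?case by (auto intro: kind_wf.kind_wf_Type)
next
  case (kind_wf_Pi \<Gamma> A x K)
  then show ?case by (simp add: ren_kpi_inj kind_wf.kind_wf_Pi fresh_ren_ctx tp_wf_ren)
qed

text \<open>Sending \<open>x\<close> to \<open>y\<close> alone is not injective; the transposition
  is, and it agrees with that renaming on expressions in which \<open>y\<close> does not
  occur.\<close>

definition swap_var :: "var \<Rightarrow> var \<Rightarrow> var \<Rightarrow> var" where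
  "swap_var x y z = (if z = x then y else if z = y then x else z)"

lemma inj_swap_var: "inj (swap_var x y)"
  by (auto simp: inj_def swap_var_def)

lemma ren_ctx_swap_var:
  assumes "ar_ctx \<Gamma>" "fresh_ctx x \<Gamma>" "fresh_ctx y \<Gamma>"
  shows "ren_ctx (swap_var x y) \<Gamma> = \<Gamma>"
  unfolding ren_ctx_def
proof (rule map_idI)
  fix p assume "p \<in> set \<Gamma>"
  then obtain z A where p: "p = (z, A)" and zA: "(z, A) \<in> set \<Gamma>" by (metis surj_pair)
  then have "ar_tp (ctx_ar \<Gamma>) A" using ar_ctx_lookup assms(1) by blast
  then have "x \<notin> fv_tp A" "y \<notin> fv_tp A" using fresh_ctx_fv assms by blast+
  then have "ren_tp (swap_var x y) A = A" by (intro ren_tp_id) (auto simp: swap_var_def)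
  moreover have "z \<noteq> x" "z \<noteq> y" using zA assms(2,3) by force+
  ultimately show "(case p of (z, A) \<Rightarrow> (swap_var x y z, ren_tp (swap_var x y) A)) = p"
    by (simp add: p swap_var_def)
qed

lemma ren_tp_swap_var:
  assumes "ar_tp (ctx_ar \<Gamma>) A" "fresh_ctx x \<Gamma>" "fresh_ctx y \<Gamma>"
  shows "ren_tp (swap_var x y) A = A"
  using fresh_ctx_fv[OF assms(2,1)] fresh_ctx_fv[OF assms(3,1)]
  by (intro ren_tp_id) (auto simp: swap_var_def)

lemma ren_tp_swap_var_open:
  assumes "y \<notin> fv_tp (close_tp 0 x A)"
  shows "ren_tp (swap_var x y) A = open_tp 0 y (close_tp 0 x A)"
  unfolding open_close_tp using assms by (intro ren_tp_cong) (auto simp: swap_var_def)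

lemma ren_canon_swap_var_open:
  assumes "y \<notin> fv_canon (close_canon 0 x M)"
  shows "ren_canon (swap_var x y) M = open_canon 0 y (close_canon 0 x M)"
  unfolding open_close_canon using assms by (intro ren_canon_cong) (auto simp: swap_var_def)

lemma ren_kind_swap_var_open:
  assumes "y \<notin> fv_kind (close_kind 0 x K)"
  shows "ren_kind (swap_var x y) K = open_kind 0 y (close_kind 0 x K)"
  using ren_tp_swap_var_open[of y x "kind_tp K"] assms by (subst kind_tp_inject[symmetric]) simp

text \<open>The derivation uses one binder name \<open>x\<close>. Swapping \<open>x\<close> and
  \<open>y\<close> in it gives a derivation for \<open>y\<close>, while \<open>\<Gamma>\<close> and
  the domain type stay fixed because neither name occurs in them.\<close>

lemma check_Lam_inv:
  assumes "check \<Sigma> \<Gamma> (Lam B) (Pi A\<^sub>1 A\<^sub>2)" "ar_sig \<Sigma>" "ar_ctx \<Gamma>" "ar_tp (ctx_ar \<Gamma>) (Pi A\<^sub>1 A\<^sub>2)" "fresh_ctx y \<Gamma>"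
  shows "check \<Sigma> ((y, A\<^sub>1) # \<Gamma>) (open_canon 0 y B) (open_tp 0 y A\<^sub>2)"
  using assms(1)
proof cases
  case (check_Lam x A1 M A2)
  then have eq: "A1 = A\<^sub>1" "A\<^sub>2 = close_tp 0 x A2" "B = close_canon 0 x M" by (auto simp: tpi_def lam_def)
  have A1: "ar_tp (ctx_ar \<Gamma>) A\<^sub>1" using assms(4) by (auto elim: ar_tp_PiE)
  have "y \<notin> fv_tp A\<^sub>2" using fresh_ctx_fv[OF assms(5,4)] by simp
  moreover have "y \<notin> fv_canon B"
    using ar_fv[OF check_ar[OF assms(1-4)]] assms(5) dom_ctx_ar by auto
  moreover have "check \<Sigma> (ren_ctx (swap_var x y) ((x, A\<^sub>1) # \<Gamma>)) (ren_canon (swap_var x y) M) (ren_tp (swap_var x y) A2)"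
    using check_Lam eq by (intro check_ren assms(2) inj_swap_var) simp
  ultimately show ?thesis
    using ren_ctx_swap_var[OF assms(3) _ assms(5)] ren_tp_swap_var[OF A1 _ assms(5)] check_Lam eq
    by (simp add: ren_tp_swap_var_open ren_canon_swap_var_open) (simp add: swap_var_def)
qed

lemma tp_wf_Pi_inv:
  assumes "tp_wf \<Sigma> \<Gamma> (Pi A B)" "ar_sig \<Sigma>" "ar_ctx \<Gamma>" "fresh_ctx y \<Gamma>"
  shows "tp_wf \<Sigma> \<Gamma> A \<and> tp_wf \<Sigma> ((y, A) # \<Gamma>) (open_tp 0 y B)"
  using assms(1)
proof cases
  case (tp_wf_Pi A1 x A2)
  then have eq: "A1 = A" "B = close_tp 0 x A2" by (auto simp: tpi_def)
  have ar: "ar_tp (ctx_ar \<Gamma>) (Pi A B)" by (rule tp_wf_ar[OF assms(1-3)])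
  then have A1: "ar_tp (ctx_ar \<Gamma>) A" by (auto elim: ar_tp_PiE)
  have "y \<notin> fv_tp B" using fresh_ctx_fv[OF assms(4) ar] by simp
  moreover have "tp_wf \<Sigma> (ren_ctx (swap_var x y) ((x, A) # \<Gamma>)) (ren_tp (swap_var x y) A2)"
    using tp_wf_Pi eq by (intro tp_wf_ren assms(2) inj_swap_var) simp
  ultimately show ?thesis
    using ren_ctx_swap_var[OF assms(3) _ assms(4)] ren_tp_swap_var[OF A1 _ assms(4)] tp_wf_Pi eq
    by (simp add: ren_tp_swap_var_open) (simp add: swap_var_def)
qed

lemma kind_wf_Pi_inv:
  assumes "kind_wf \<Sigma> \<Gamma> (KPi A K)" "ar_sig \<Sigma>" "ar_ctx \<Gamma>" "fresh_ctx y \<Gamma>"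
  shows "tp_wf \<Sigma> \<Gamma> A \<and> kind_wf \<Sigma> ((y, A) # \<Gamma>) (open_kind 0 y K)"
  using assms(1)
proof cases
  case (kind_wf_Pi A1 x K1)
  then have eq: "A1 = A" "K = close_kind 0 x K1" by (auto simp: kpi_def)
  have ar: "ar_kind (ctx_ar \<Gamma>) (KPi A K)" by (rule kind_wf_ar[OF assms(1-3)])
  then have A1: "ar_tp (ctx_ar \<Gamma>) A" by (auto elim: ar_tp_PiE)
  have "y \<notin> fv_kind K" using fresh_ctx_fv[OF assms(4) ar] by simp
  moreover have "kind_wf \<Sigma> (ren_ctx (swap_var x y) ((x, A) # \<Gamma>)) (ren_kind (swap_var x y) K1)"
    using kind_wf_Pi eq by (intro kind_wf_ren assms(2) inj_swap_var) simp
  ultimately show ?thesis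
    using ren_ctx_swap_var[OF assms(3) _ assms(4)] ren_tp_swap_var[OF A1 _ assms(4)] kind_wf_Pi eq
      ren_kind_swap_var_open[of y x K1]
    by (simp add: swap_var_def[of x y x])
qed

section \<open>The substitution theorem\<close>

text \<open>The range is checked in all larger contexts, so that weakening
  comes out of the substitution theorem for the empty substitution.\<close>

definition wf_subst :: "sign \<Rightarrow> subst \<Rightarrow> ctx \<Rightarrow> ctx \<Rightarrow> bool" where
  "wf_subst \<Sigma> \<theta> \<Gamma> \<Delta> \<longleftrightarrow> ar_subst \<theta> (ctx_ar \<Gamma>) (ctx_ar \<Delta>) \<and>
    (\<forall>x A. (x, A) \<in> set \<Gamma> \<longrightarrow> (\<exists>A'. hs_tp \<theta> A A' \<and> (case fmlookup \<theta> x of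
       None \<Rightarrow> (x, A') \<in> set \<Delta>
     | Some (M, \<alpha>) \<Rightarrow> \<forall>\<Delta>'. ar_ctx \<Delta>' \<longrightarrow> set \<Delta> \<subseteq> set \<Delta>' \<longrightarrow> check \<Sigma> \<Delta>' M A')))"

lemma ctx_ar_mono:
  assumes "ar_ctx \<Gamma>" "ar_ctx \<Delta>" "set \<Gamma> \<subseteq> set \<Delta>" "x \<in> dom (ctx_ar \<Gamma>)"
  shows "ctx_ar \<Delta> x = ctx_ar \<Gamma> x"
proof -
  from assms(4) obtain A where "(x, A) \<in> set \<Gamma>" unfolding dom_ctx_ar by auto
  then show ?thesis using ar_ctx_lookup assms(1-3) by (metis subsetD)
qed

lemma ar_mono: "ar (ctx_ar \<Gamma>) M \<alpha> \<Longrightarrow> ar_ctx \<Gamma> \<Longrightarrow> ar_ctx \<Delta> \<Longrightarrow> set \<Gamma> \<subseteq> set \<Delta> \<Longrightarrow> ar (ctx_ar \<Delta>) M \<alpha>"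
  using ctx_ar_mono ar_fv by (blast intro: ar_cong)

lemma wf_subst_mono:
  assumes "wf_subst \<Sigma> \<theta> \<Gamma> \<Delta>" "ar_ctx \<Delta>" "ar_ctx \<Delta>'" "set \<Delta> \<subseteq> set \<Delta>'"
  shows "wf_subst \<Sigma> \<theta> \<Gamma> \<Delta>'"
  unfolding wf_subst_def
proof (intro conjI allI impI)
  show "ar_subst \<theta> (ctx_ar \<Gamma>) (ctx_ar \<Delta>')"
    unfolding ar_subst_def
  proof (intro allI impI)
    fix x \<alpha> assume x: "ctx_ar \<Gamma> x = Some \<alpha>"
    have sub: "ar_subst \<theta> (ctx_ar \<Gamma>) (ctx_ar \<Delta>)" using assms(1) by (simp add: wf_subst_def)
    show "case fmlookup \<theta> x of None \<Rightarrow> ctx_ar \<Delta>' x = Some \<alpha> | Some (M, \<beta>) \<Rightarrow> \<beta> = \<alpha> \<and> ar (ctx_ar \<Delta>') M \<alpha>"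
    proof (cases "fmlookup \<theta> x")
      case None
      from ar_subst_None[OF sub x None] ctx_ar_mono[OF assms(2-4), of x] None show ?thesis by auto
    next
      case (Some p)
      then obtain M \<beta> where p: "fmlookup \<theta> x = Some (M, \<beta>)" by (cases p) auto
      from ar_subst_Some[OF sub x p] ar_mono[OF _ assms(2-4)] p show ?thesis by auto
    qed
  qed
  fix x A assume "(x, A) \<in> set \<Gamma>"
  then obtain A' where A': "hs_tp \<theta> A A'" "case fmlookup \<theta> x of None \<Rightarrow> (x, A') \<in> set \<Delta>
     | Some (M, \<alpha>) \<Rightarrow> \<forall>\<Delta>'. ar_ctx \<Delta>' \<longrightarrow> set \<Delta> \<subseteq> set \<Delta>' \<longrightarrow> check \<Sigma> \<Delta>' M A'"
    using assms(1) unfolding wf_subst_def by blast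
  then show "\<exists>A'. hs_tp \<theta> A A' \<and> (case fmlookup \<theta> x of None \<Rightarrow> (x, A') \<in> set \<Delta>'
     | Some (M, \<alpha>) \<Rightarrow> \<forall>\<Delta>''. ar_ctx \<Delta>'' \<longrightarrow> set \<Delta>' \<subseteq> set \<Delta>'' \<longrightarrow> check \<Sigma> \<Delta>'' M A')"
    using assms(4) by (intro exI[of _ A']) (auto split: option.splits)
qed

text \<open>The range terms are already checked in every extension of \<open>\<Delta>\<close>, in
  particular in every extension of the context with the new entry, so going under a binder needs no
  separate weakening.\<close>

lemma wf_subst_binder:
  assumes "wf_subst \<Sigma> \<theta> \<Gamma> \<Delta>" "fresh_subst y \<theta>" "hs_tp \<theta> A A'"
  shows "wf_subst \<Sigma> \<theta> ((y, A) # \<Gamma>) ((y, A') # \<Delta>)"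
  unfolding wf_subst_def
proof (intro conjI allI impI)
  show "ar_subst \<theta> (ctx_ar ((y, A) # \<Gamma>)) (ctx_ar ((y, A') # \<Delta>))"
    using assms ar_subst_binder[OF _ assms(2)] hs_tp_erase[OF assms(3)] by (simp add: wf_subst_def)
  fix x B assume x: "(x, B) \<in> set ((y, A) # \<Gamma>)"
  show "\<exists>B'. hs_tp \<theta> B B' \<and> (case fmlookup \<theta> x of None \<Rightarrow> (x, B') \<in> set ((y, A') # \<Delta>)
     | Some (M, \<alpha>) \<Rightarrow> \<forall>\<Delta>'. ar_ctx \<Delta>' \<longrightarrow> set ((y, A') # \<Delta>) \<subseteq> set \<Delta>' \<longrightarrow> check \<Sigma> \<Delta>' M B')"
  proof (cases "(x, B) = (y, A)")
    case True
    then show ?thesis using assms(2,3) by (auto simp: fresh_subst_iff)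
  next
    case False
    with x have "(x, B) \<in> set \<Gamma>" by auto
    then obtain B' where B': "hs_tp \<theta> B B'" "case fmlookup \<theta> x of None \<Rightarrow> (x, B') \<in> set \<Delta>
       | Some (M, \<alpha>) \<Rightarrow> \<forall>\<Delta>'. ar_ctx \<Delta>' \<longrightarrow> set \<Delta> \<subseteq> set \<Delta>' \<longrightarrow> check \<Sigma> \<Delta>' M B'"
      using assms(1) unfolding wf_subst_def by blast
    then show ?thesis by (intro exI[of _ B']) (auto split: option.splits)
  qed
qed

lemma wf_subst_single:
  assumes "ar_ctx \<Gamma>" "ar_tp (ctx_ar \<Gamma>) A" "fresh_ctx y \<Gamma>" "ar (ctx_ar \<Gamma>) M (erase A)"
    "\<And>\<Gamma>'. ar_ctx \<Gamma>' \<Longrightarrow> set \<Gamma> \<subseteq> set \<Gamma>' \<Longrightarrow> check \<Sigma> \<Gamma>' M A"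
  shows "wf_subst \<Sigma> (single y M (erase A)) ((y, A) # \<Gamma>) \<Gamma>"
  unfolding wf_subst_def
proof (intro conjI allI impI)
  show "ar_subst (single y M (erase A)) (ctx_ar ((y, A) # \<Gamma>)) (ctx_ar \<Gamma>)"
    using ar_subst_single[OF assms(4)] by simp
  have id: "hs_tp (single y M (erase A)) B B" if "ar_tp (ctx_ar \<Gamma>) B" for B
    using fresh_ctx_fv[OF assms(3) that] by (intro hs_tp_ident[OF that]) auto
  fix x B assume x: "(x, B) \<in> set ((y, A) # \<Gamma>)"
  show "\<exists>B'. hs_tp (single y M (erase A)) B B' \<and> (case fmlookup (single y M (erase A)) x of None \<Rightarrow> (x, B') \<in> set \<Gamma>
     | Some (N, \<alpha>) \<Rightarrow> \<forall>\<Delta>'. ar_ctx \<Delta>' \<longrightarrow> set \<Gamma> \<subseteq> set \<Delta>' \<longrightarrow> check \<Sigma> \<Delta>' N B')"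
  proof (cases "(x, B) = (y, A)")
    case True
    then show ?thesis using assms(5) id[OF assms(2)] by auto
  next
    case False
    with x have xB: "(x, B) \<in> set \<Gamma>" by auto
    then have "x \<noteq> y" using assms(3) by force
    then show ?thesis using xB id ar_ctx_lookup[OF assms(1) xB] by auto
  qed
qed

lemma check_Atm_inv: "check \<Sigma> \<Gamma> (Atm R) A \<Longrightarrow> \<exists>P. A = At P \<and> synth \<Sigma> \<Gamma> R A"
  by (auto elim: check.cases)

lemma check_Lam_Pi: "check \<Sigma> \<Gamma> (Lam B) A \<Longrightarrow> \<exists>A1 A2. A = Pi A1 A2"
  by (erule check.cases) (auto simp: tpi_def)

inductive_cases synth_VarE: "synth \<Sigma> \<Gamma> (FVar x) A"
inductive_cases synth_ConstE: "synth \<Sigma> \<Gamma> (Const c) A"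
inductive_cases synth_AppE: "synth \<Sigma> \<Gamma> (App R M) A"

text \<open>An application either keeps its head, and then only the result type has to be adjusted,
  or its head turns into an abstraction, and then the reduction is a further substitution. The
  latter acts on a body that is no subterm but at a smaller arity, hence the outer induction on the
  bound as for totality.\<close>

lemma subst_bounded:
  assumes "ar_sig \<Sigma>"
  shows "\<forall>M \<Gamma> \<Delta> \<theta> A A' M'. lc M \<longrightarrow> arity_bound n \<theta> \<longrightarrow> ar_ctx \<Gamma> \<longrightarrow> ar_ctx \<Delta> \<longrightarrow> wf_subst \<Sigma> \<theta> \<Gamma> \<Delta> \<longrightarrow>
    ar_tp (ctx_ar \<Gamma>) A \<longrightarrow> check \<Sigma> \<Gamma> M A \<longrightarrow> hs \<theta> M M' \<longrightarrow> hs_tp \<theta> A A' \<longrightarrow> check \<Sigma> \<Delta> M' A'"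
proof (induction n rule: less_induct)
  case (less n)
  have main: "lc M \<Longrightarrow> \<lbrakk>arity_bound n \<theta>; ar_ctx \<Gamma>; ar_ctx \<Delta>; wf_subst \<Sigma> \<theta> \<Gamma> \<Delta>; ar_tp (ctx_ar \<Gamma>) A;
      check \<Sigma> \<Gamma> M A; hs \<theta> M M'; hs_tp \<theta> A A'\<rbrakk> \<Longrightarrow> check \<Sigma> \<Delta> M' A'"
    and "lc_at R \<Longrightarrow> \<lbrakk>arity_bound n \<theta>; ar_ctx \<Gamma>; ar_ctx \<Delta>; wf_subst \<Sigma> \<theta> \<Gamma> \<Delta>;
      synth \<Sigma> \<Gamma> R A; hs_tp \<theta> A A'\<rbrakk> \<Longrightarrow>
      (\<forall>R'. hs_at \<theta> R R' \<longrightarrow> synth \<Sigma> \<Delta> R' A') \<and> (\<forall>M' \<alpha>. hs_tm \<theta> R M' \<alpha> \<longrightarrow> check \<Sigma> \<Delta> M' A')"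
    for M R \<theta> \<Gamma> \<Delta> A A' M'
  proof (induction arbitrary: \<theta> \<Gamma> \<Delta> A A' M' and \<theta> \<Gamma> \<Delta> A A' rule: lc_lc_at.inducts)
    case (lc_Atm R)
    from check_Atm_inv[OF \<open>check \<Sigma> \<Gamma> (Atm R) A\<close>] obtain P where P: "A = At P" "synth \<Sigma> \<Gamma> R A" by blast
    note IH = lc_Atm.IH[OF lc_Atm.prems(1-4) P(2) lc_Atm.prems(8)]
    obtain P' where P': "A' = At P'" using \<open>hs_tp \<theta> A A'\<close> P(1) by (auto elim: hs_AtE)
    from \<open>hs \<theta> (Atm R) M'\<close> show ?case
    proof (rule hs_AtmE)
      fix R' assume "M' = Atm R'" "hs_at \<theta> R R'"
      then show ?thesis using IH P' by (auto intro: check_Atm)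
    next
      fix b assume "hs_tm \<theta> R M' b"
      then show ?thesis using IH by blast
    qed
  next
    case (lc_Lam L B)
    from check_Lam_Pi[OF \<open>check \<Sigma> \<Gamma> (Lam B) A\<close>] obtain A1 A2 where A: "A = Pi A1 A2" by blast
    from \<open>hs \<theta> (Lam B) M'\<close> obtain B' where B': "M' = Lam B'"
      "\<And>y. fmlookup \<theta> y = None \<Longrightarrow> hs \<theta> (open_canon 0 y B) (open_canon 0 y B')"
      by (rule hs_Lam_inv) blast
    from \<open>hs_tp \<theta> A A'\<close>[unfolded A] obtain A1' A2' where A': "A' = Pi A1' A2'" "hs_tp \<theta> A1 A1'"
      "\<And>y. fmlookup \<theta> y = None \<Longrightarrow> hs_tp \<theta> (open_tp 0 y A2) (open_tp 0 y A2')"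
      by (rule hs_Pi_inv) blast
    let ?S = "L \<union> fmdom' \<theta> \<union> fv_range \<theta> \<union> fst ` set \<Gamma> \<union> fst ` set \<Delta> \<union> fv_canon B' \<union> fv_tp A2 \<union> fv_tp A2'"
    obtain y where y: "y \<notin> ?S" using ex_fresh[of ?S] lc_Lam.hyps by auto
    then have fr: "fresh_subst y \<theta>" by (auto intro!: fresh_substI)
    have arA1: "ar_tp (ctx_ar \<Gamma>) A1" using lc_Lam.prems(5) A by (auto elim: ar_tp_PiE)
    have arA1': "ar_tp (ctx_ar \<Delta>) A1'"
      using lc_Lam.prems(4) by (intro hs_tp_ar[OF A'(2) arA1]) (simp add: wf_subst_def)
    have "check \<Sigma> ((y, A1') # \<Delta>) (open_canon 0 y B') (open_tp 0 y A2')"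
    proof (rule lc_Lam.IH[of y])
      show "ar_ctx ((y, A1) # \<Gamma>)" "ar_ctx ((y, A1') # \<Delta>)"
        using y lc_Lam.prems(2,3) arA1 arA1' by (auto intro!: ar_ctx_Cons)
      show "wf_subst \<Sigma> \<theta> ((y, A1) # \<Gamma>) ((y, A1') # \<Delta>)"
        by (rule wf_subst_binder[OF lc_Lam.prems(4) fr A'(2)])
      show "ar_tp (ctx_ar ((y, A1) # \<Gamma>)) (open_tp 0 y A2)"
        using ar_tp_Pi_inv[of "ctx_ar \<Gamma>" A1 A2 y] lc_Lam.prems(5) A y by simp
      show "check \<Sigma> ((y, A1) # \<Gamma>) (open_canon 0 y B) (open_tp 0 y A2)"
        using check_Lam_inv[of \<Sigma> \<Gamma> B A1 A2 y] lc_Lam.prems A y assms by simp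
      show "hs \<theta> (open_canon 0 y B) (open_canon 0 y B')" "hs_tp \<theta> (open_tp 0 y A2) (open_tp 0 y A2')"
        using B'(2) A'(3) fr by (auto simp: fresh_subst_iff)
    qed (use y lc_Lam.prems in auto)
    then have "check \<Sigma> \<Delta> (lam y (open_canon 0 y B')) (tpi y A1' (open_tp 0 y A2'))"
      using y by (intro check_Lam) auto
    then show ?case using y B'(1) A'(1) by (simp add: lam_open tpi_open)
  next
    case (lc_Const c)
    from \<open>synth \<Sigma> \<Gamma> (Const c) A\<close> have c: "ObjDecl c A \<in> set \<Sigma>" by (rule synth_ConstE)
    then have "ar_tp Map.empty A" using assms by (auto simp: ar_sig_def)
    then have "hs_tp \<theta> A A" using ar_tp_closed by (intro hs_tp_ident) auto
    then have "A' = A" using \<open>hs_tp \<theta> A A'\<close> hs_tp_functional by blast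
    then show ?case using c by (auto elim!: hs_at_ConstE hs_tm_ConstE intro: synth_Const)
  next
    case (lc_Var x)
    from \<open>synth \<Sigma> \<Gamma> (FVar x) A\<close> have "(x, A) \<in> set \<Gamma>" by (rule synth_VarE)
    then obtain A0 where A0: "hs_tp \<theta> A A0" "case fmlookup \<theta> x of None \<Rightarrow> (x, A0) \<in> set \<Delta>
       | Some (M, \<alpha>) \<Rightarrow> \<forall>\<Delta>'. ar_ctx \<Delta>' \<longrightarrow> set \<Delta> \<subseteq> set \<Delta>' \<longrightarrow> check \<Sigma> \<Delta>' M A0"
      using lc_Var.prems(4) unfolding wf_subst_def by blast
    then have "A0 = A'" using lc_Var.prems(6) hs_tp_functional by blast
    with A0(2) lc_Var.prems(3) show ?case
      by (auto elim!: hs_at_VarE hs_tm_VarE simp: fmlookup_dom'_iff intro: synth_Var split: option.splits)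
  next
    case (lc_App R N)
    from \<open>synth \<Sigma> \<Gamma> (App R N) A\<close> obtain x A1 A20 where R: "synth \<Sigma> \<Gamma> R (tpi x A1 A20)" and N: "check \<Sigma> \<Gamma> N A1"
      and A: "hs_tp (single x N (erase A1)) A20 A"
      by (rule synth_AppE)
    define A2 where "A2 = close_tp 0 x A20"
    define a where "a = erase A1"
    have R: "synth \<Sigma> \<Gamma> R (Pi A1 A2)" using R by (simp add: A2_def tpi_def)
    from synth_ar[OF R assms lc_App.prems(2)] have arR: "ar_at (ctx_ar \<Gamma>) R (Arr a (erase A2))"
      and arPi: "ar_tp (ctx_ar \<Gamma>) (Pi A1 A2)" by (auto simp: a_def)
    then have arA1: "ar_tp (ctx_ar \<Gamma>) A1" by (auto elim: ar_tp_PiE)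
    have arN: "ar (ctx_ar \<Gamma>) N a" unfolding a_def by (rule check_ar[OF N assms lc_App.prems(2) arA1])
    have sub: "ar_subst \<theta> (ctx_ar \<Gamma>) (ctx_ar \<Delta>)" using lc_App.prems(4) by (simp add: wf_subst_def)
    obtain T where T: "hs_tp \<theta> (Pi A1 A2) T" "ar_tp (ctx_ar \<Delta>) T" by (rule hs_tp_total[OF arPi sub])
    from T(1) obtain A1' A2' where A': "T = Pi A1' A2'" "hs_tp \<theta> A1 A1'"
      "\<And>y. fmlookup \<theta> y = None \<Longrightarrow> hs_tp \<theta> (open_tp 0 y A2) (open_tp 0 y A2')"
      by (rule hs_Pi_inv) blast
    have a': "erase A1' = a" using hs_tp_erase[OF A'(2)] by (simp add: a_def)
    obtain N' where N': "hs \<theta> N N'" "ar (ctx_ar \<Delta>) N' a" by (rule hs_total[OF arN sub])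
    \<comment> \<open>The inner hypothesis is applied over each extension of
      \<open>\<Delta>\<close>, because the substitution of \<open>N'\<close> for the bound variable
      has to satisfy \<open>wf_subst\<close>.\<close>
    have chk: "check \<Sigma> \<Delta>' N' A1'" if "ar_ctx \<Delta>'" "set \<Delta> \<subseteq> set \<Delta>'" for \<Delta>'
      by (rule lc_App.IH(2)[OF lc_App.prems(1,2) that(1) wf_subst_mono[OF lc_App.prems(4,3) that] arA1 N N'(1) A'(2)])
    note IH = lc_App.IH(1)[OF lc_App.prems(1-4) R T(1)]
    \<comment> \<open>Composition enters typing here: the substituted type of the application is
      also what the rule computes from the substituted function type and argument. Both cases below
      use it.\<close>
    have comm: "hs_tp (single y N' a) (open_tp 0 y A2') A'" if y: "fresh_subst y \<theta>" "y \<notin> fv_tp A2" for y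
    proof (rule hs_tp_commute[OF _ sub y(1) arN N'(1) _ \<open>hs_tp \<theta> A A'\<close>])
      show "ar_tp ((ctx_ar \<Gamma>)(y \<mapsto> a)) (open_tp 0 y A2)" unfolding a_def by (rule ar_tp_Pi_inv[OF arPi y(2)])
      show "hs_tp (single y N a) (open_tp 0 y A2) A"
        using hs_tp_single_alpha[OF _ A, of y "open_tp 0 y A2"] y(2) by (simp add: A2_def a_def)
      show "hs_tp \<theta> (open_tp 0 y A2) (open_tp 0 y A2')" using A'(3) y(1) by (simp add: fresh_subst_iff)
    qed
    show ?case
    proof (intro conjI allI impI)
      fix R1 assume "hs_at \<theta> (App R N) R1"
      then obtain R' N1 where R1: "R1 = App R' N1" "hs_at \<theta> R R'" "hs \<theta> N N1" by (rule hs_at_AppE)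
      have "N1 = N'" by (rule hs_functional[OF R1(3) N'(1)])
      let ?S = "fmdom' \<theta> \<union> fv_range \<theta> \<union> fv_tp A2 \<union> fv_tp A2'"
      obtain y where y: "y \<notin> ?S" using ex_fresh[of ?S] by auto
      then have fr: "fresh_subst y \<theta>" by (auto intro!: fresh_substI)
      have "synth \<Sigma> \<Delta> R' (tpi y A1' (open_tp 0 y A2'))"
        using IH R1(2) y A'(1) by (simp add: tpi_open)
      then have "synth \<Sigma> \<Delta> (App R' N') A'"
        by (rule synth_App) (use chk lc_App.prems(3) comm fr y a' in auto)
      then show "synth \<Sigma> \<Delta> R1 A'" using R1(1) \<open>N1 = N'\<close> by simp
    next
      fix M' b assume "hs_tm \<theta> (App R N) M' b"
      then obtain z B0 a0 N1 where tm: "hs_tm \<theta> R (lam z B0) (Arr a0 b)" and N1: "hs \<theta> N N1"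
        and M': "hs (single z N1 a0) B0 M'"
        by (rule hs_tm_AppE)
      define B where "B = close_canon 0 z B0"
      have tm: "hs_tm \<theta> R (Lam B) (Arr a0 b)" using tm by (simp add: B_def lam_def)
      have "N1 = N'" by (rule hs_functional[OF N1 N'(1)])
      from hs_tm_ar[OF tm arR sub lc_App.prems(1)] have "a0 = a" and arB: "ar (ctx_ar \<Delta>) (Lam B) (Arr a (erase A2))"
        and sz: "size a < n" by auto
      have chkB: "check \<Sigma> \<Delta> (Lam B) (Pi A1' A2')" using IH tm A'(1) by blast
      let ?S = "fmdom' \<theta> \<union> fv_range \<theta> \<union> fst ` set \<Delta> \<union> fv_canon B \<union> fv_tp A2 \<union> fv_tp A2'"
      obtain y where y: "y \<notin> ?S" using ex_fresh[of ?S] by auto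
      then have fr: "fresh_subst y \<theta>" by (auto intro!: fresh_substI)
      have arA1': "ar_tp (ctx_ar \<Delta>) A1'" using T(2) A'(1) by (auto elim: ar_tp_PiE)
      \<comment> \<open>As \<open>B\<close> is produced by the substitution, its local closure comes
        from its arity and not from the term under induction.\<close>
      have 1: "lc (open_canon 0 y B)" using ar_lc[OF ar_Lam_inv[OF arB]] y by simp
      have 2: "ar_ctx ((y, A1') # \<Delta>)" using y arA1' lc_App.prems(3) by (intro ar_ctx_Cons) auto
      have 3: "wf_subst \<Sigma> (single y N' a) ((y, A1') # \<Delta>) \<Delta>"
        using wf_subst_single[OF lc_App.prems(3) arA1', of y N'] N'(2) chk y a' by simp
      have 4: "ar_tp (ctx_ar ((y, A1') # \<Delta>)) (open_tp 0 y A2')"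
        using ar_tp_Pi_inv[of _ A1' A2' y] T(2) A'(1) y by simp
      have 5: "check \<Sigma> ((y, A1') # \<Delta>) (open_canon 0 y B) (open_tp 0 y A2')"
        using check_Lam_inv[OF chkB assms lc_App.prems(3)] T(2) A'(1) y by simp
      have 6: "hs (single y N' a) (open_canon 0 y B) M'"
        using hs_single_alpha[OF _ M', of y "open_canon 0 y B"] y \<open>N1 = N'\<close> \<open>a0 = a\<close> by (simp add: B_def)
      have 7: "hs_tp (single y N' a) (open_tp 0 y A2') A'" using comm fr y by simp
      \<comment> \<open>The reduct is the substitution of the single argument \<open>N'\<close> at
        arity \<open>a\<close>, which is strictly below the bound \<open>n\<close>.\<close>
      show "check \<Sigma> \<Delta> M' A'"
        by (rule less.IH[OF sz, rule_format, OF 1 arity_bound_single 2 lc_App.prems(3) 3 4 5 6 7])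
    qed
  qed
  show ?case by (intro allI impI, rule main) assumption+
qed

section \<open>Weakening, and substitution in atomic types, types and kinds\<close>

lemma check_subst:
  assumes "check \<Sigma> \<Gamma> M A" "hs \<theta> M M'" "hs_tp \<theta> A A'" "wf_subst \<Sigma> \<theta> \<Gamma> \<Delta>"
    "ar_sig \<Sigma>" "ar_ctx \<Gamma>" "ar_ctx \<Delta>" "ar_tp (ctx_ar \<Gamma>) A"
  shows "check \<Sigma> \<Delta> M' A'"
proof -
  have "lc M" by (rule ar_lc[OF check_ar[OF assms(1,5,6,8)]])
  then show ?thesis using ex_arity_bound[of \<theta>] subst_bounded[OF assms(5)] assms by blast
qed

lemma wf_subst_empty:
  assumes "ar_ctx \<Gamma>" "ar_ctx \<Delta>" "set \<Gamma> \<subseteq> set \<Delta>"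
  shows "wf_subst \<Sigma> fmempty \<Gamma> \<Delta>"
proof -
  have "hs_tp fmempty A A" if "(x, A) \<in> set \<Gamma>" for x A
    using ar_ctx_lookup[OF assms(1) that] by (intro hs_tp_ident) auto
  moreover have "ar_subst fmempty (ctx_ar \<Gamma>) (ctx_ar \<Delta>)"
    using ctx_ar_mono[OF assms] by (auto simp: ar_subst_def dom_def)
  ultimately show ?thesis using assms(3) unfolding wf_subst_def by auto
qed

lemma check_weaken:
  assumes "check \<Sigma> \<Gamma> M A" "ar_sig \<Sigma>" "ar_ctx \<Gamma>" "ar_ctx \<Delta>" "set \<Gamma> \<subseteq> set \<Delta>" "ar_tp (ctx_ar \<Gamma>) A"
  shows "check \<Sigma> \<Delta> M A"
proof (rule check_subst[OF assms(1) _ _ wf_subst_empty[OF assms(3-5)] assms(2-4,6)])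
  show "hs fmempty M M" by (rule hs_ident[OF check_ar[OF assms(1-3,6)]]) simp
  show "hs_tp fmempty A A" by (rule hs_tp_ident[OF assms(6)]) simp
qed

text \<open>Structural induction on \<open>P\<close> suffices: its head is a constant, which
  substitution leaves in place, so no reduction occurs along the spine.\<close>

lemma atyp_syn_subst:
  assumes "wf_subst \<Sigma> \<theta> \<Gamma> \<Delta>" "ar_sig \<Sigma>" "ar_ctx \<Gamma>" "ar_ctx \<Delta>"
  shows "atyp_syn \<Sigma> \<Gamma> P K \<Longrightarrow> hs_atyp \<theta> P P' \<Longrightarrow> hs_kind \<theta> K K' \<Longrightarrow> atyp_syn \<Sigma> \<Delta> P' K'"
proof (induction P arbitrary: K P' K')
  case (TConst a)
  from TConst.prems(1) have a: "TypDecl a K \<in> set \<Sigma>" by (auto elim: atyp_syn.cases)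
  then have "ar_kind Map.empty K" using assms(2) by (auto simp: ar_sig_def)
  then have "hs_kind \<theta> K K" using ar_tp_closed unfolding hs_kind_iff by (intro hs_tp_ident) auto
  then have "K' = K" using TConst.prems(3) hs_kind_functional by blast
  then show ?case using a TConst.prems(2) by (auto elim!: hs_TConstE intro: atyp_syn_Const)
next
  case (TApp P M)
  from TApp.prems(1) obtain x A K1 where P: "atyp_syn \<Sigma> \<Gamma> P (kpi x A K1)" and M: "check \<Sigma> \<Gamma> M A"
    and K: "hs_kind (single x M (erase A)) K1 K"
    by (auto elim: atyp_syn.cases)
  from TApp.prems(2) obtain P1 M1 where P': "P' = TApp P1 M1" "hs_atyp \<theta> P P1" "hs \<theta> M M1"
    by (rule hs_TAppE)
  define K2 where "K2 = close_kind 0 x K1"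
  have P: "atyp_syn \<Sigma> \<Gamma> P (KPi A K2)" using P by (simp add: kpi_def K2_def)
  have sub: "ar_subst \<theta> (ctx_ar \<Gamma>) (ctx_ar \<Delta>)" using assms(1) by (simp add: wf_subst_def)
  have arPi: "ar_kind (ctx_ar \<Gamma>) (KPi A K2)" using atyp_syn_ar[OF P assms(2,3)] by simp
  then have arA: "ar_tp (ctx_ar \<Gamma>) A" by (auto elim: ar_tp_PiE)
  obtain T where "hs_tp \<theta> (kind_tp (KPi A K2)) T" by (rule hs_tp_total[OF arPi sub])
  then obtain T' where T': "hs_kind \<theta> (KPi A K2) T'" using hs_tp_kind_tp by blast
  then obtain A' K2' where A': "T' = KPi A' K2'" "hs_tp \<theta> A A'"
    "\<And>y. fmlookup \<theta> y = None \<Longrightarrow> hs_kind \<theta> (open_kind 0 y K2) (open_kind 0 y K2')"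
    by (rule hs_KPi_inv) blast
  let ?S = "fmdom' \<theta> \<union> fv_range \<theta> \<union> fv_kind K2 \<union> fv_kind K2'"
  obtain y where y: "y \<notin> ?S" using ex_fresh[of ?S] by auto
  then have fr: "fresh_subst y \<theta>" by (auto intro!: fresh_substI)
  have "atyp_syn \<Sigma> \<Delta> P1 (kpi y A' (open_kind 0 y K2'))"
    using TApp.IH[OF P P'(2) T'] A'(1) y by (simp add: kpi_open)
  moreover have "check \<Sigma> \<Delta> M1 A'"
    by (rule check_subst[OF M P'(3) A'(2) assms(1-4) arA])
  moreover have "hs_kind (single y M1 (erase A')) (open_kind 0 y K2') K'"
    unfolding hs_kind_iff hs_tp_erase[OF A'(2)]
  proof (rule hs_tp_commute[OF _ sub fr check_ar[OF M assms(2,3) arA] P'(3)])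
    show "ar_tp ((ctx_ar \<Gamma>)(y \<mapsto> erase A)) (kind_tp (open_kind 0 y K2))"
      using ar_tp_Pi_inv[of "ctx_ar \<Gamma>" A "kind_tp K2" y] arPi y by simp
    show "hs_tp (single y M (erase A)) (kind_tp (open_kind 0 y K2)) (kind_tp K)"
      using hs_tp_single_alpha[of x "kind_tp K1" y "kind_tp (open_kind 0 y K2)"] K y
      by (simp add: hs_kind_iff K2_def)
    show "hs_tp \<theta> (kind_tp K) (kind_tp K')" using TApp.prems(3) by (simp add: hs_kind_iff)
    show "hs_tp \<theta> (kind_tp (open_kind 0 y K2)) (kind_tp (open_kind 0 y K2'))"
      using A'(3)[of y] fr by (simp add: hs_kind_iff fresh_subst_iff)
  qed
  ultimately show ?case unfolding P'(1) by (rule atyp_syn_App)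
qed

text \<open>The induction follows the arity derivation, whose cofinite premise covers the body at
  all but finitely many names, while a derivation of \<open>tp_wf\<close> fixes one.
  \<open>tp_wf_Pi_inv\<close> supplies well-formedness at the chosen name.\<close>

lemma tp_wf_subst:
  assumes "ar_tp \<Theta> A" "\<Theta> = ctx_ar \<Gamma>" "tp_wf \<Sigma> \<Gamma> A" "hs_tp \<theta> A A'" "wf_subst \<Sigma> \<theta> \<Gamma> \<Delta>"
    "ar_sig \<Sigma>" "ar_ctx \<Gamma>" "ar_ctx \<Delta>"
  shows "tp_wf \<Sigma> \<Delta> A'"
  using assms
proof (induction arbitrary: \<Gamma> \<Delta> A' rule: ar_tp.induct)
  case (ar_tp_At \<Theta> P)
  from \<open>hs_tp \<theta> (At P) A'\<close> obtain P' where P': "A' = At P'" "hs_atyp \<theta> P P'" by (auto elim: hs_AtE)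
  have "atyp_syn \<Sigma> \<Gamma> P KType" using \<open>tp_wf \<Sigma> \<Gamma> (At P)\<close> by (auto elim: tp_wf.cases)
  then have "atyp_syn \<Sigma> \<Delta> P' KType"
    using atyp_syn_subst[OF ar_tp_At.prems(4-7)] P'(2) hs_KType by blast
  then show ?case unfolding P'(1) by (rule tp_wf_At)
next
  case (ar_tp_Pi \<Theta> A L B)
  from \<open>hs_tp \<theta> (Pi A B) A'\<close> obtain A1 B1 where A1: "A' = Pi A1 B1" "hs_tp \<theta> A A1"
    "\<And>y. fmlookup \<theta> y = None \<Longrightarrow> hs_tp \<theta> (open_tp 0 y B) (open_tp 0 y B1)"
    by (rule hs_Pi_inv) blast
  let ?S = "L \<union> fmdom' \<theta> \<union> fv_range \<theta> \<union> fst ` set \<Gamma> \<union> fst ` set \<Delta> \<union> fv_tp B1"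
  obtain y where y: "y \<notin> ?S" using ex_fresh[of ?S] ar_tp_Pi.hyps by auto
  then have fr: "fresh_subst y \<theta>" by (auto intro!: fresh_substI)
  from tp_wf_Pi_inv[OF ar_tp_Pi.prems(2,5,6), of y] y
  have wf: "tp_wf \<Sigma> \<Gamma> A" "tp_wf \<Sigma> ((y, A) # \<Gamma>) (open_tp 0 y B)" by auto
  have wfA1: "tp_wf \<Sigma> \<Delta> A1" by (rule ar_tp_Pi.IH(1)[OF ar_tp_Pi.prems(1) wf(1) A1(2) ar_tp_Pi.prems(4-7)])
  have "tp_wf \<Sigma> ((y, A1) # \<Delta>) (open_tp 0 y B1)"
  proof (rule ar_tp_Pi.IH(2)[of y, OF _ _ wf(2) _ wf_subst_binder[OF ar_tp_Pi.prems(4) fr A1(2)] ar_tp_Pi.prems(5)])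
    show "hs_tp \<theta> (open_tp 0 y B) (open_tp 0 y B1)" using A1(3) fr by (simp add: fresh_subst_iff)
    show "ar_ctx ((y, A) # \<Gamma>)"
      using y tp_wf_ar[OF wf(1) ar_tp_Pi.prems(5,6)] ar_tp_Pi.prems(6) by (intro ar_ctx_Cons) auto
    show "ar_ctx ((y, A1) # \<Delta>)"
      using y tp_wf_ar[OF wfA1 ar_tp_Pi.prems(5,7)] ar_tp_Pi.prems(7) by (intro ar_ctx_Cons) auto
  qed (use y ar_tp_Pi.prems(1) in simp_all)
  then have "tp_wf \<Sigma> \<Delta> (tpi y A1 (open_tp 0 y B1))" using wfA1 y by (intro tp_wf_Pi) auto
  then show ?case using y A1(1) by (simp add: tpi_open)
qed

text \<open>Arities of kinds are defined through \<open>kind_tp\<close>; the variables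
  \<open>T\<close> and \<open>\<Theta>\<close> keep the induction on \<open>ar_tp\<close> general,
  and the equations recover the kind and the context.\<close>

lemma kind_wf_subst_aux:
  assumes "ar_tp \<Theta> T" "T = kind_tp K" "\<Theta> = ctx_ar \<Gamma>" "kind_wf \<Sigma> \<Gamma> K" "hs_kind \<theta> K K'" "wf_subst \<Sigma> \<theta> \<Gamma> \<Delta>"
    "ar_sig \<Sigma>" "ar_ctx \<Gamma>" "ar_ctx \<Delta>"
  shows "kind_wf \<Sigma> \<Delta> K'"
  using assms
proof (induction arbitrary: K \<Gamma> \<Delta> K' rule: ar_tp.induct)
  case (ar_tp_At \<Theta> P)
  then have "K = KType" by (cases K) auto
  then have "K' = KType" using \<open>hs_kind \<theta> K K'\<close> hs_kind_functional hs_KType by blast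
  then show ?case by (simp add: kind_wf_Type)
next
  case (ar_tp_Pi \<Theta> A L B)
  then obtain K1 where K1: "K = KPi A K1" "B = kind_tp K1" by (cases K) auto
  from \<open>hs_kind \<theta> K K'\<close>[unfolded K1(1)] obtain A' K1' where A1: "K' = KPi A' K1'" "hs_tp \<theta> A A'"
    "\<And>y. fmlookup \<theta> y = None \<Longrightarrow> hs_kind \<theta> (open_kind 0 y K1) (open_kind 0 y K1')"
    by (rule hs_KPi_inv) blast
  let ?S = "L \<union> fmdom' \<theta> \<union> fv_range \<theta> \<union> fst ` set \<Gamma> \<union> fst ` set \<Delta> \<union> fv_kind K1'"
  obtain y where y: "y \<notin> ?S" using ex_fresh[of ?S] ar_tp_Pi.hyps by auto
  then have fr: "fresh_subst y \<theta>" by (auto intro!: fresh_substI)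
  from kind_wf_Pi_inv[OF ar_tp_Pi.prems(3)[unfolded K1(1)] ar_tp_Pi.prems(6,7), of y] y
  have wf: "tp_wf \<Sigma> \<Gamma> A" "kind_wf \<Sigma> ((y, A) # \<Gamma>) (open_kind 0 y K1)" by auto
  have wfA': "tp_wf \<Sigma> \<Delta> A'"
    by (rule tp_wf_subst[OF ar_tp_Pi.hyps(1) ar_tp_Pi.prems(2) wf(1) A1(2) ar_tp_Pi.prems(5-8)])
  have "kind_wf \<Sigma> ((y, A') # \<Delta>) (open_kind 0 y K1')"
  proof (rule ar_tp_Pi.IH(2)[of y, OF _ _ _ wf(2) _ wf_subst_binder[OF ar_tp_Pi.prems(5) fr A1(2)] ar_tp_Pi.prems(6)])
    show "hs_kind \<theta> (open_kind 0 y K1) (open_kind 0 y K1')" using A1(3) fr by (simp add: fresh_subst_iff)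
    show "ar_ctx ((y, A) # \<Gamma>)"
      using y tp_wf_ar[OF wf(1) ar_tp_Pi.prems(6,7)] ar_tp_Pi.prems(7) by (intro ar_ctx_Cons) auto
    show "ar_ctx ((y, A') # \<Delta>)"
      using y tp_wf_ar[OF wfA' ar_tp_Pi.prems(6,8)] ar_tp_Pi.prems(8) by (intro ar_ctx_Cons) auto
  qed (use y ar_tp_Pi.prems(2) K1 in simp_all)
  then have "kind_wf \<Sigma> \<Delta> (kpi y A' (open_kind 0 y K1'))" using wfA' y by (intro kind_wf_Pi) auto
  then show ?case using y A1(1) by (simp add: kpi_open)
qed

lemma kind_wf_subst:
  assumes "kind_wf \<Sigma> \<Gamma> K" "hs_kind \<theta> K K'" "wf_subst \<Sigma> \<theta> \<Gamma> \<Delta>" "ar_sig \<Sigma>" "ar_ctx \<Gamma>" "ar_ctx \<Delta>"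
  shows "kind_wf \<Sigma> \<Delta> K'"
  using kind_wf_subst_aux[OF kind_wf_ar[OF assms(1,4,5)] refl refl] assms by blast

section \<open>Larger signatures, and well-formedness of synthesised kinds\<close>

lemma atyp_syn_sig_mono: "atyp_syn \<Sigma> \<Gamma> P K \<Longrightarrow> set \<Sigma> \<subseteq> set \<Sigma>' \<Longrightarrow> atyp_syn \<Sigma>' \<Gamma> P K"
  and check_sig_mono: "check \<Sigma> \<Gamma> M A \<Longrightarrow> set \<Sigma> \<subseteq> set \<Sigma>' \<Longrightarrow> check \<Sigma>' \<Gamma> M A"
  and synth_sig_mono: "synth \<Sigma> \<Gamma> R A \<Longrightarrow> set \<Sigma> \<subseteq> set \<Sigma>' \<Longrightarrow> synth \<Sigma>' \<Gamma> R A"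
  by (induction rule: atyp_syn_check_synth.inducts) (blast intro: atyp_syn_check_synth.intros)+

lemma tp_wf_sig_mono: "tp_wf \<Sigma> \<Gamma> A \<Longrightarrow> set \<Sigma> \<subseteq> set \<Sigma>' \<Longrightarrow> tp_wf \<Sigma>' \<Gamma> A"
proof (induction rule: tp_wf.induct)
  case (tp_wf_At \<Gamma> P)
  show ?case by (rule tp_wf.tp_wf_At[OF atyp_syn_sig_mono[OF tp_wf_At]])
next
  case (tp_wf_Pi \<Gamma> A\<^sub>1 x A\<^sub>2)
  then show ?case by (simp add: tp_wf.tp_wf_Pi)
qed

lemma kind_wf_sig_mono: "kind_wf \<Sigma> \<Gamma> K \<Longrightarrow> set \<Sigma> \<subseteq> set \<Sigma>' \<Longrightarrow> kind_wf \<Sigma>' \<Gamma> K"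
proof (induction rule: kind_wf.induct)
  case (kind_wf_Type \<Gamma>)
  show ?case by (rule kind_wf.kind_wf_Type)
next
  case (kind_wf_Pi \<Gamma> A x K)
  then show ?case using tp_wf_sig_mono[OF kind_wf_Pi.hyps(1)] by (simp add: kind_wf.kind_wf_Pi)
qed

text \<open>A declaration is well-formed relative to the preceding ones; monotonicity carries it to
  the whole signature.\<close>

lemma sig_wf_kind_wf: "sig_wf \<Sigma> \<Longrightarrow> TypDecl a K \<in> set \<Sigma> \<Longrightarrow> kind_wf \<Sigma> [] K"
proof (induction rule: sig_wf.induct)
  case (sig_wf_Obj \<Sigma> c A)
  then have "kind_wf \<Sigma> [] K" by auto
  then show ?case by (rule kind_wf_sig_mono) auto
next
  case (sig_wf_Typ \<Sigma> b L)
  then have "kind_wf \<Sigma> [] K" by auto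
  then show ?case by (rule kind_wf_sig_mono) auto
qed simp

lemma atyp_syn_kind_wf:
  assumes "sig_wf \<Sigma>" "ar_ctx \<Gamma>"
  shows "atyp_syn \<Sigma> \<Gamma> P K \<Longrightarrow> kind_wf \<Sigma> \<Gamma> K"
proof (induction P arbitrary: K)
  case (TConst a)
  then have a: "TypDecl a K \<in> set \<Sigma>" by (auto elim: atyp_syn.cases)
  have ar: "ar_sig \<Sigma>" "ar_ctx []" using assms(1) sig_wf_ar by (auto simp: ar_ctx_def)
  have "ar_kind Map.empty K" using a ar(1) by (auto simp: ar_sig_def)
  then have "hs_kind fmempty K K" unfolding hs_kind_iff by (rule hs_tp_ident) simp
  \<comment> \<open>The declared kind is well-formed in the empty context, and the empty
    substitution carries it to \<open>\<Gamma>\<close>.\<close>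
  with kind_wf_subst[OF sig_wf_kind_wf[OF assms(1) a]] wf_subst_empty[OF ar(2) assms(2)] ar assms(2)
  show ?case by simp
next
  case (TApp P M)
  have sig: "ar_sig \<Sigma>" by (rule sig_wf_ar[OF assms(1)])
  from TApp.prems(1) obtain x A K1 where P: "atyp_syn \<Sigma> \<Gamma> P (kpi x A K1)" and M: "check \<Sigma> \<Gamma> M A"
    and K: "hs_kind (single x M (erase A)) K1 K"
    by (auto elim: atyp_syn.cases)
  define K2 where "K2 = close_kind 0 x K1"
  have "kind_wf \<Sigma> \<Gamma> (KPi A K2)" using TApp.IH[OF P] by (simp add: kpi_def K2_def)
  let ?S = "fst ` set \<Gamma> \<union> fv_kind K2"
  obtain y where y: "y \<notin> ?S" using ex_fresh[of ?S] by auto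
  from kind_wf_Pi_inv[OF \<open>kind_wf \<Sigma> \<Gamma> (KPi A K2)\<close> sig assms(2), of y] y
  have wf: "tp_wf \<Sigma> \<Gamma> A" "kind_wf \<Sigma> ((y, A) # \<Gamma>) (open_kind 0 y K2)" by auto
  have arA: "ar_tp (ctx_ar \<Gamma>) A" by (rule tp_wf_ar[OF wf(1) sig assms(2)])
  \<comment> \<open>\<open>wf_subst\<close> asks for \<open>M\<close> in every larger context, which
    is supplied by weakening.\<close>
  have "wf_subst \<Sigma> (single y M (erase A)) ((y, A) # \<Gamma>) \<Gamma>"
    using y check_weaken[OF M sig assms(2)] arA
    by (intro wf_subst_single[OF assms(2) arA _ check_ar[OF M sig assms(2) arA]]) auto
  moreover have "hs_kind (single y M (erase A)) (open_kind 0 y K2) K"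
    using hs_tp_single_alpha[of x "kind_tp K1" y "kind_tp (open_kind 0 y K2)"] K y
    by (simp add: hs_kind_iff K2_def)
  moreover have "ar_ctx ((y, A) # \<Gamma>)" using y arA assms(2) by (intro ar_ctx_Cons) auto
  ultimately show ?case using kind_wf_subst[OF wf(2)] sig assms(2) by blast
qed

section \<open>Spines\<close>

lemma set_take_zip_fst: "fst ` set (take i (zip xs zs)) \<subseteq> set (take i xs)"
  by (auto simp: take_zip dest: set_zip_leftD)

lemma fmdom'_psubst: "fmdom' (psubst i ys Ms As) \<subseteq> set (take i ys)"
proof
  fix x assume "x \<in> fmdom' (psubst i ys Ms As)"
  then obtain p where "map_of (take i (zip ys (zip Ms (map erase As)))) x = Some p"
    by (auto simp: psubst_def fmlookup_dom'_iff fmlookup_of_list)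
  then show "x \<in> set (take i ys)" using set_take_zip_fst map_of_SomeD by force
qed

lemma psubst_0 [simp]: "psubst 0 ys Ms As = fmempty"
  by (simp add: psubst_def)

lemma nth_notin_take: "i < length xs \<Longrightarrow> distinct xs \<Longrightarrow> xs ! i \<notin> set (take i xs)"
  by (auto simp: in_set_conv_nth nth_eq_iff_index_eq)

text \<open>In \<open>map_of\<close> the earliest entry wins, whereas \<open>fmupd\<close> overrides
  with the latest; distinctness of \<open>ys\<close> removes the difference.\<close>

lemma psubst_Suc:
  assumes "i < length ys" "i < length Ms" "i < length As" "distinct ys"
  shows "psubst (Suc i) ys Ms As = fmupd (ys ! i) (Ms ! i, erase (As ! i)) (psubst i ys Ms As)"
proof -
  let ?L = "zip ys (zip Ms (map erase As))"
  have "ys ! i \<notin> fst ` set (take i ?L)"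
    using nth_notin_take[OF assms(1,4)] set_take_zip_fst[of i ys] by blast
  define m where "m = map_of (take i ?L)"
  have *: "m (ys ! i) = None" using \<open>ys ! i \<notin> fst ` set (take i ?L)\<close> by (simp add: m_def map_of_eq_None_iff)
  have "take (Suc i) ?L = take i ?L @ [(ys ! i, Ms ! i, erase (As ! i))]"
    using assms(1-3) by (simp add: take_Suc_conv_app_nth)
  then have "map_of (take (Suc i) ?L) = [ys ! i \<mapsto> (Ms ! i, erase (As ! i))] ++ m" by (simp add: m_def)
  then have "map_of (take (Suc i) ?L) = m(ys ! i \<mapsto> (Ms ! i, erase (As ! i)))"
    using * by (auto simp: map_add_def fun_eq_iff split: option.split)
  then show ?thesis
    unfolding psubst_def by (intro fmap_ext) (simp add: fmlookup_of_list m_def)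
qed

lemma psubst_append:
  assumes "i \<le> length ys" "length Ms = length ys" "length As = length ys"
  shows "psubst i (ys @ ys') (Ms @ Ms') (As @ As') = psubst i ys Ms As"
  using assms by (simp add: psubst_def)

lemma kpis_Nil [simp]: "kpis [] [] K = K"
  by (simp add: kpis_def)

lemma kpis_Cons [simp]: "kpis (y # ys) (A # As) K = kpi y A (kpis ys As K)"
  by (simp add: kpis_def)

lemma kpis_snoc: "length ys = length As \<Longrightarrow> kpis (ys @ [y]) (As @ [A]) K = kpis ys As (kpi y A K)"
  by (simp add: kpis_def)

lemma tapps_snoc: "tapps P (Ms @ [M]) = TApp (tapps P Ms) M"
  by (simp add: tapps_def)

lemma ar_subst_fmupd:
  assumes "ar_subst \<theta> \<Theta> \<Theta>'" "ar \<Theta>' M a"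
  shows "ar_subst (fmupd y (M, a) \<theta>) (\<Theta>(y \<mapsto> a)) \<Theta>'"
  using assms by (auto simp: ar_subst_def)

lemma ar_subst_empty: "ar_subst fmempty Map.empty \<Theta>"
  by (simp add: ar_subst_def)

text \<open>The last two conjuncts strengthen the claim for the induction: \<open>\<Theta>\<close>
  assigns arities to the \<open>ys\<close>, and with it the composition law applies to the rest
  \<open>K\<close> of the declared kind. The \<open>ys\<close> are chosen one by one along the
  spine.\<close>

lemma atyp_syn_spine:
  assumes "ar_sig \<Sigma>" "ar_ctx \<Gamma>"
  shows "atyp_syn \<Sigma> \<Gamma> P K' \<Longrightarrow> \<exists>a ys As K Ms As' \<Theta>.
    length ys = length Ms \<and> length As = length Ms \<and> length As' = length Ms \<and> distinct ys \<and>
    TypDecl a (kpis ys As K) \<in> set \<Sigma> \<and> P = tapps (TConst a) Ms \<and>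
    (\<forall>i<length Ms. hs_tp (psubst i ys Ms As) (As ! i) (As' ! i) \<and> check \<Sigma> \<Gamma> (Ms ! i) (As' ! i)) \<and>
    hs_kind (psubst (length Ms) ys Ms As) K K' \<and>
    ar_subst (psubst (length Ms) ys Ms As) \<Theta> (ctx_ar \<Gamma>) \<and> ar_kind \<Theta> K"
proof (induction P arbitrary: K')
  case (TConst a)
  then have a: "TypDecl a K' \<in> set \<Sigma>" by (auto elim: atyp_syn.cases)
  then have ar: "ar_kind Map.empty K'" using assms(1) by (auto simp: ar_sig_def)
  then have "hs_kind fmempty K' K'" unfolding hs_kind_iff by (rule hs_tp_ident) simp
  then show ?case using a ar ar_subst_empty
    by (intro exI[of _ a] exI[of _ "[]"] exI[of _ K'] exI[of _ Map.empty]) (simp add: tapps_def)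
next
  case (TApp P M)
  from TApp.prems(1) obtain x A' K1 where P: "atyp_syn \<Sigma> \<Gamma> P (kpi x A' K1)" and M: "check \<Sigma> \<Gamma> M A'"
    and K1: "hs_kind (single x M (erase A')) K1 K'"
    by (auto elim: atyp_syn.cases)
  from TApp.IH[OF P] obtain a ys As K Ms As' \<Theta> where
    len: "length ys = length Ms" "length As = length Ms" "length As' = length Ms" and dist: "distinct ys"
    and a: "TypDecl a (kpis ys As K) \<in> set \<Sigma>" and Peq: "P = tapps (TConst a) Ms"
    and args: "\<And>i. i < length Ms \<Longrightarrow> hs_tp (psubst i ys Ms As) (As ! i) (As' ! i) \<and> check \<Sigma> \<Gamma> (Ms ! i) (As' ! i)"
    and K: "hs_kind (psubst (length Ms) ys Ms As) K (kpi x A' K1)"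
    and sub: "ar_subst (psubst (length Ms) ys Ms As) \<Theta> (ctx_ar \<Gamma>)" and arK: "ar_kind \<Theta> K"
    by blast
  define \<theta> where "\<theta> = psubst (length Ms) ys Ms As"
  \<comment> \<open>Substitution preserves the outer form of a kind, so the declared kind has
    another Pi to match the next argument.\<close>
  have "K \<noteq> KType"
  proof
    assume "K = KType"
    then have "kpi x A' K1 = KType" using K hs_kind_functional hs_KType by blast
    then show False by simp
  qed
  then obtain A Kr where Keq: "K = KPi A Kr" by (cases K) auto
  from K[unfolded Keq, folded \<theta>_def] obtain B Kb where B: "kpi x A' K1 = KPi B Kb" "hs_tp \<theta> A B"
    "\<And>y. fmlookup \<theta> y = None \<Longrightarrow> hs_kind \<theta> (open_kind 0 y Kr) (open_kind 0 y Kb)"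
    by (rule hs_KPi_inv) blast
  then have A: "hs_tp \<theta> A A'" and Kb: "Kb = close_kind 0 x K1" by (auto simp: kpi_def)
  have arP: "ar_kind (ctx_ar \<Gamma>) (kpi x A' K1)" using atyp_syn_ar[OF P assms] by simp
  then have arA': "ar_tp (ctx_ar \<Gamma>) A'" by (simp add: kind_tp_kpi ar_tp_tpi)
  \<comment> \<open>\<open>M\<close> is checked against the substituted type \<open>A'\<close>,
    while the triple carries the erasure of the declared type \<open>A\<close>; substitution does
    not change erasure.\<close>
  have arM: "ar (ctx_ar \<Gamma>) M (erase A)" using check_ar[OF M assms arA'] hs_tp_erase[OF A] by simp
  let ?S = "set ys \<union> fmdom' \<theta> \<union> fv_range \<theta> \<union> fv_kind Kr \<union> fv_kind Kb"
  obtain y where y: "y \<notin> ?S" using ex_fresh[of ?S] by auto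
  then have fr: "fresh_subst y \<theta>" by (auto intro!: fresh_substI)
  have arKr: "ar_kind (\<Theta>(y \<mapsto> erase A)) (open_kind 0 y Kr)"
    using ar_tp_Pi_inv[of \<Theta> A "kind_tp Kr" y] arK y by (simp add: Keq)
  let ?ys = "ys @ [y]" and ?As = "As @ [A]" and ?Ms = "Ms @ [M]" and ?As' = "As' @ [A']"
  have pre: "psubst i ?ys ?Ms ?As = psubst i ys Ms As" if "i \<le> length Ms" for i
    using that len by (intro psubst_append) auto
  have full: "psubst (length ?Ms) ?ys ?Ms ?As = fmupd y (M, erase A) \<theta>"
    using psubst_Suc[of "length Ms" ?ys ?Ms ?As] pre[of "length Ms"] len dist y
    by (simp add: \<theta>_def nth_append)
  have "hs_kind (fmupd y (M, erase A) \<theta>) (open_kind 0 y Kr) K'"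
    unfolding hs_kind_iff
  proof (rule hs_tp_extend[OF arKr sub[folded \<theta>_def] fr arM])
    show "hs_tp \<theta> (kind_tp (open_kind 0 y Kr)) (kind_tp (open_kind 0 y Kb))"
      using B(3)[of y] fr by (simp add: hs_kind_iff fresh_subst_iff)
    show "hs_tp (single y M (erase A)) (kind_tp (open_kind 0 y Kb)) (kind_tp K')"
      using hs_tp_single_alpha[of x "kind_tp K1" y "kind_tp (open_kind 0 y Kb)"] K1 y hs_tp_erase[OF A]
      by (simp add: hs_kind_iff Kb)
  qed
  moreover have "hs_tp (psubst i ?ys ?Ms ?As) (?As ! i) (?As' ! i) \<and> check \<Sigma> \<Gamma> (?Ms ! i) (?As' ! i)"
    if "i < length ?Ms" for i
    using that args[of i] pre[of i] A M len by (cases "i = length Ms") (auto simp: nth_append \<theta>_def)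
  \<comment> \<open>Opening with the fresh \<open>y\<close> and binding it again gives back the same
    kind, so the declaration is unchanged.\<close>
  moreover have "TypDecl a (kpis ?ys ?As (open_kind 0 y Kr)) \<in> set \<Sigma>"
    using a len y by (simp add: kpis_snoc kpi_open Keq)
  moreover have "ar_subst (fmupd y (M, erase A) \<theta>) (\<Theta>(y \<mapsto> erase A)) (ctx_ar \<Gamma>)"
    by (rule ar_subst_fmupd[OF sub[folded \<theta>_def] arM])
  ultimately show ?case
    using len dist y arKr
    by (intro exI[of _ a] exI[of _ ?ys] exI[of _ ?As] exI[of _ "open_kind 0 y Kr"] exI[of _ ?Ms] exI[of _ ?As']
        exI[of _ "\<Theta>(y \<mapsto> erase A)"]) (simp only: full, simp add: Peq tapps_snoc)
qed

text \<open>The name \<open>y\<close> is given and may occur in the range of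
  \<open>\<theta>\<close>, where the composition law does not apply. The argument is therefore
  substituted for a fresh \<open>z\<close>, and only afterwards is \<open>z\<close> renamed to
  \<open>y\<close> in the domain.\<close>

lemma spine_step:
  assumes "hs_kind \<theta> (kpi y A Kr) K" "ar_subst \<theta> \<Theta> (ctx_ar \<Gamma>)" "ar_kind \<Theta> (kpi y A Kr)"
    "fmlookup \<theta> y = None" "atyp_syn \<Sigma> \<Gamma> P K" "hs_tp \<theta> A A'" "check \<Sigma> \<Gamma> M A'" "ar_sig \<Sigma>" "ar_ctx \<Gamma>"
  shows "\<exists>K'. atyp_syn \<Sigma> \<Gamma> (TApp P M) K' \<and> hs_kind (fmupd y (M, erase A) \<theta>) Kr K' \<and>
    ar_subst (fmupd y (M, erase A) \<theta>) (\<Theta>(y \<mapsto> erase A)) (ctx_ar \<Gamma>) \<and> ar_kind (\<Theta>(y \<mapsto> erase A)) Kr"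
proof -
  define Kc where "Kc = close_kind 0 y Kr"
  from assms(1) obtain A0 Kb where K: "K = KPi A0 Kb" "hs_tp \<theta> A A0"
    "\<And>z. fmlookup \<theta> z = None \<Longrightarrow> hs_kind \<theta> (open_kind 0 z Kc) (open_kind 0 z Kb)"
    unfolding kpi_def Kc_def by (rule hs_KPi_inv) blast
  have "A0 = A'" by (rule hs_tp_functional[OF K(2) assms(6)])
  let ?a = "erase A"
  have arA: "ar_tp \<Theta> A" and arKr: "ar_kind (\<Theta>(y \<mapsto> ?a)) Kr"
    using assms(3) by (auto simp: kind_tp_kpi ar_tp_tpi)
  have arA': "ar_tp (ctx_ar \<Gamma>) A'" by (rule hs_tp_ar[OF assms(6) arA assms(2)])
  have arM: "ar (ctx_ar \<Gamma>) M ?a"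
    using check_ar[OF assms(7-9) arA'] hs_tp_erase[OF assms(6)] by simp
  let ?S = "insert y (fmdom' \<theta> \<union> fv_range \<theta> \<union> fv_kind Kr \<union> fv_kind Kb)"
  obtain z where z: "z \<notin> ?S" using ex_fresh[of ?S] by auto
  then have fr: "fresh_subst z \<theta>" by (auto intro!: fresh_substI)
  have zc: "z \<notin> fv_kind Kc" using z by (simp add: Kc_def)
  have arKc: "ar_kind (\<Theta>(z \<mapsto> ?a)) (open_kind 0 z Kc)"
    using ar_tp_Pi_inv[of \<Theta> A "kind_tp Kc" z] assms(3) zc by (simp add: kpi_def Kc_def)
  have hsKc: "hs_kind \<theta> (open_kind 0 z Kc) (open_kind 0 z Kb)" using K(3) fr by (simp add: fresh_subst_iff)
  have "ar_kind ((ctx_ar \<Gamma>)(z \<mapsto> ?a)) (open_kind 0 z Kb)"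
    by (rule hs_kind_ar[OF hsKc arKc ar_subst_binder[OF assms(2) fr]])
  then obtain T where "hs_tp (single z M ?a) (kind_tp (open_kind 0 z Kb)) T"
    using hs_tp_total ar_subst_single[OF arM] by blast
  then obtain K' where K': "hs_kind (single z M ?a) (open_kind 0 z Kb) K'" using hs_tp_kind_tp by blast
  have "atyp_syn \<Sigma> \<Gamma> P (kpi z A' (open_kind 0 z Kb))"
    using assms(5) K(1) \<open>A0 = A'\<close> z by (simp add: kpi_open)
  then have syn: "atyp_syn \<Sigma> \<Gamma> (TApp P M) K'"
    by (rule atyp_syn_App) (use assms(6,7) K' hs_tp_erase in auto)
  have ext: "hs_kind (fmupd z (M, ?a) \<theta>) (open_kind 0 z Kc) K'"
    using hs_tp_extend[OF arKc assms(2) fr arM] hsKc K' by (simp add: hs_kind_iff)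
  \<comment> \<open>The source is renamed by \<open>f\<close> and the result by the identity, so
    occurrences of \<open>y\<close> that stem from the range remain as they are. In
    \<open>Kc\<close> the name \<open>y\<close> is bound, so \<open>f\<close> identifies no two free
    variables of the opened kind.\<close>
  define f where "f = (\<lambda>w. if w = z then y else w)"
  have "hs_tp (fmupd y (M, ?a) \<theta>) (ren_tp f (kind_tp (open_kind 0 z Kc))) (ren_tp (\<lambda>w. w) (kind_tp K'))"
  proof (rule hs_tp_ren)
    show "hs_tp (fmupd z (M, ?a) \<theta>) (kind_tp (open_kind 0 z Kc)) (kind_tp K')"
      using ext by (simp add: hs_kind_iff)
    fix w assume "w \<in> fv_kind (open_kind 0 z Kc)"
    then have "w = z \<or> w \<in> fv_kind Kc" using fv_open_tp_upper[of 0 z "kind_tp Kc"] by auto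
    then show "ren_compat f (\<lambda>w. w) (fmupd z (M, ?a) \<theta>) (fmupd y (M, ?a) \<theta>) w"
      using zc by (auto simp: ren_compat_def f_def Kc_def split: option.split)
  qed
  moreover have "ren_tp f (kind_tp (open_kind 0 z Kc)) = kind_tp Kr"
  proof -
    have "ren_tp f (kind_tp Kc) = kind_tp Kc" using zc by (intro ren_tp_id) (auto simp: f_def)
    then show ?thesis by (simp add: ren_open_tp f_def Kc_def)
  qed
  ultimately have "hs_kind (fmupd y (M, ?a) \<theta>) Kr K'" by (simp add: hs_kind_iff)
  then show ?thesis using syn arKr ar_subst_fmupd[OF assms(2) arM] by blast
qed

text \<open>After \<open>i\<close> arguments the synthesised kind is the remainder of the declared
  kind under the first \<open>i\<close> triples. Its existence is all that is claimed, since
  functionality determines it.\<close>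

lemma spine_atyp_syn:
  assumes "ar_sig \<Sigma>" "ar_ctx \<Gamma>" "length ys = n" "length As = n" "length Ms = n" "distinct ys"
    "TypDecl a (kpis ys As K) \<in> set \<Sigma>"
    "\<And>i. i < n \<Longrightarrow> hs_tp (psubst i ys Ms As) (As ! i) (As' ! i) \<and> check \<Sigma> \<Gamma> (Ms ! i) (As' ! i)"
  shows "i \<le> n \<Longrightarrow> \<exists>Ki \<Theta>. atyp_syn \<Sigma> \<Gamma> (tapps (TConst a) (take i Ms)) Ki \<and>
    hs_kind (psubst i ys Ms As) (kpis (drop i ys) (drop i As) K) Ki \<and>
    ar_subst (psubst i ys Ms As) \<Theta> (ctx_ar \<Gamma>) \<and> ar_kind \<Theta> (kpis (drop i ys) (drop i As) K)"
proof (induction i)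
  case 0
  have ar: "ar_kind Map.empty (kpis ys As K)" using assms(1,7) by (auto simp: ar_sig_def)
  then have "hs_kind fmempty (kpis ys As K) (kpis ys As K)" unfolding hs_kind_iff by (rule hs_tp_ident) simp
  then show ?case using ar assms(7) ar_subst_empty
    by (intro exI[of _ "kpis ys As K"] exI[of _ Map.empty]) (simp add: tapps_def atyp_syn_Const)
next
  case (Suc i)
  then have i: "i < n" by simp
  from Suc.IH i obtain Ki \<Theta> where
    IH: "atyp_syn \<Sigma> \<Gamma> (tapps (TConst a) (take i Ms)) Ki"
    "hs_kind (psubst i ys Ms As) (kpis (drop i ys) (drop i As) K) Ki"
    "ar_subst (psubst i ys Ms As) \<Theta> (ctx_ar \<Gamma>)" "ar_kind \<Theta> (kpis (drop i ys) (drop i As) K)"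
    by auto
  have eq: "kpis (drop i ys) (drop i As) K = kpi (ys ! i) (As ! i) (kpis (drop (Suc i) ys) (drop (Suc i) As) K)"
    using i assms(3,4) by (simp add: Cons_nth_drop_Suc[symmetric])
  have "ys ! i \<notin> set (take i ys)"
    using i assms(3,6) by (intro nth_notin_take) auto
  then have "ys ! i \<notin> fmdom' (psubst i ys Ms As)" using fmdom'_psubst by blast
  then have "fmlookup (psubst i ys Ms As) (ys ! i) = None" by (simp add: notin_fmdom'_iff)
  from spine_step[OF IH(2)[unfolded eq] IH(3) IH(4)[unfolded eq] this IH(1) conjunct1[OF assms(8)[OF i]]
      conjunct2[OF assms(8)[OF i]] assms(1,2)]
  have "\<exists>Ki \<Theta>. atyp_syn \<Sigma> \<Gamma> (TApp (tapps (TConst a) (take i Ms)) (Ms ! i)) Ki \<and>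
    hs_kind (fmupd (ys ! i) (Ms ! i, erase (As ! i)) (psubst i ys Ms As)) (kpis (drop (Suc i) ys) (drop (Suc i) As) K) Ki \<and>
    ar_subst (fmupd (ys ! i) (Ms ! i, erase (As ! i)) (psubst i ys Ms As)) \<Theta> (ctx_ar \<Gamma>) \<and>
    ar_kind \<Theta> (kpis (drop (Suc i) ys) (drop (Suc i) As) K)"
    by blast
  then show ?case
    using i assms(3-6) by (simp add: psubst_Suc take_Suc_conv_app_nth tapps_snoc)
qed

theorem theorem2p21:
  fixes \<Sigma> :: sign and \<Gamma> :: ctx and P :: atyp and K' :: kind
  assumes "sig_wf \<Sigma>" and "ctx_wf \<Sigma> \<Gamma>"
  shows "atyp_syn \<Sigma> \<Gamma> P K' \<longleftrightarrow>
    (\<exists>(n::nat) a ys As K Ms.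
       length ys = n \<and> length As = n \<and> length Ms = n \<and> distinct ys \<and>
       TypDecl a (kpis ys As K) \<in> set \<Sigma> \<and>
       P = tapps (TConst a) Ms \<and>
       (\<exists>As'. length As' = n \<and>
          (\<forall>i<n. hs_tp (psubst i ys Ms As) (As ! i) (As' ! i) \<and> check \<Sigma> \<Gamma> (Ms ! i) (As' ! i))) \<and>
       hs_kind (psubst n ys Ms As) K K' \<and> kind_wf \<Sigma> \<Gamma> K')"
    (is "_ \<longleftrightarrow> ?spine")
proof -
  have sig: "ar_sig \<Sigma>" by (rule sig_wf_ar[OF assms(1)])
  have ctx: "ar_ctx \<Gamma>" by (rule ctx_wf_ar[OF assms(2) sig])
  show ?thesis
  proof
    assume syn: "atyp_syn \<Sigma> \<Gamma> P K'"
    have "kind_wf \<Sigma> \<Gamma> K'" by (rule atyp_syn_kind_wf[OF assms(1) ctx syn])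
    with atyp_syn_spine[OF sig ctx syn] show ?spine by metis
  next
    assume ?spine
    then obtain n a ys As K Ms As' where *:
      "length ys = n" "length As = n" "length Ms = n" "distinct ys" "TypDecl a (kpis ys As K) \<in> set \<Sigma>"
      "P = tapps (TConst a) Ms" "hs_kind (psubst n ys Ms As) K K'"
      "\<And>i. i < n \<Longrightarrow> hs_tp (psubst i ys Ms As) (As ! i) (As' ! i) \<and> check \<Sigma> \<Gamma> (Ms ! i) (As' ! i)"
      by blast
    from spine_atyp_syn[OF sig ctx *(1-5,8), of n] *(1-3) obtain K0 where
      "atyp_syn \<Sigma> \<Gamma> (tapps (TConst a) Ms) K0" "hs_kind (psubst n ys Ms As) K K0"
      by auto
    \<comment> \<open>\<open>K0\<close> and \<open>K'\<close> result from the same substitution in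
      \<open>K\<close>, so they coincide.\<close>
    then show "atyp_syn \<Sigma> \<Gamma> P K'" using *(6,7) hs_kind_functional by blast
  qed
qed

end
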